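(* Let $g\ge 2$ be an integer with $\alpha_g<\frac15$, or equivalently $g\ge 31699$. Then there exist effectively computable constants $c\in(0,1)$ and $C>0$, depending only on $g$, such that for all integers $a$, $q\ge 2$ and $N\ge 2$ with \[ q\le \exp\Big(c\cdot\frac{N}{\log N}\Big), \] we have \[ \Big|\overleftarrow{\pi}_{N}(a,q)-\frac{(q,(g^{2}-1)g^{N})}{q}\sum_{\substack{p\in\mathscr{G}_{N}\\ \overleftarrow{p}\equiv a \ (\mathrm{mod}\ (q,(g^{2}-1)g^{N}))}}1\Big|\le C\, g^{N}\exp\Big(-c\cdot\frac{N}{\log q}\Big). \]
   Context: Fix an integer base $g\ge2$. Every positive integer $n$ has a unique base-$g$ representation $n=\sum_{0\le i<N}n_i g^i$ with digits $n_i\in\{0,\dots,g-1\}$ and $n_{N-1}\neq0$; $N$ is the length of $n$. The digital reverse of $n$ is $\overleftarrow{n}=\sum_{0\le i<N}n_{i}g^{N-i-1}$. For $N\ge1$, $\mathscr{G}_N=\{n\in\mathbb{Z}: g^{N-1}\le n<g^N,\ n\not\equiv 0 \ (\mathrm{mod}\ g)\}$. For integers $a,q$ with $q\ge1$, $\overleftarrow{\pi}_{N}(a,q)$ is the number of primes $p\in\mathscr{G}_N$ with $\overleftarrow{p}\equiv a\ (\mathrm{mod}\ q)$. The symbol $(x,y,\dots)$ denotes the greatest common divisor. Define \[ C_g=\frac{2}{\pi}\log\cot\frac{\pi}{2g}+\frac{1}{g\sin\frac{\pi}{2g}}+1,\qquad \alpha_g=\frac{\log C_g}{\log g}. \] 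*)

theory Defs
  imports
    "HOL-Analysis.Analysis"
    "HOL-Computational_Algebra.Primes"
    "HOL-Number_Theory.Cong"
    "HOL-Library.Log_Nat"
begin

definition digit :: "nat \<Rightarrow> nat \<Rightarrow> nat \<Rightarrow> nat" where
  "digit g n i = n div g ^ i mod g"

(* floorlog g n is the number N of base-g digits: g^(N-1) <= n < g^N, see floorlog_bounds. *)
definition digit_reverse :: "nat \<Rightarrow> nat \<Rightarrow> nat" where
  "digit_reverse g n = (\<Sum>i<floorlog g n. digit g n i * g ^ (floorlog g n - i - 1))"

definition G_set :: "nat \<Rightarrow> nat \<Rightarrow> nat set" where
  "G_set g N = {n. g ^ (N - 1) \<le> n \<and> n < g ^ N \<and> \<not> [n = 0] (mod g)}"

definition reverse_prime_count :: "nat \<Rightarrow> nat \<Rightarrow> int \<Rightarrow> nat \<Rightarrow> nat" where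
  "reverse_prime_count g N a q =
     card {p \<in> G_set g N. prime p \<and> [int (digit_reverse g p) = a] (mod int q)}"

definition C_const :: "nat \<Rightarrow> real" where
  "C_const g = 2 / pi * ln (cot (pi / (2 * real g))) + 1 / (real g * sin (pi / (2 * real g))) + 1"

definition alpha_const :: "nat \<Rightarrow> real" where
  "alpha_const g = ln (C_const g) / ln (real g)"

lemma digit_expansion_less_power: "(\<Sum>i<N. digit g n i * g ^ i) = n mod g ^ N"
proof (induction N)
  case (Suc N)
  have "n mod g ^ Suc N = g ^ N * (n div g ^ N mod g) + n mod g ^ N"
    by (simp only: power_Suc2 mod_mult2_eq)
  with Suc show ?case
    by (simp add: digit_def)
qed simp

lemma digit_expansion:
  assumes "g \<ge> 2" "n > 0"
  shows "n = (\<Sum>i<floorlog g n. digit g n i * g ^ i)"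
    and "digit g n (floorlog g n - 1) \<noteq> 0"
proof -
  have b: "g ^ (floorlog g n - 1) \<le> n" "n < g ^ floorlog g n"
    using floorlog_bounds[of n g] assms by auto
  show "n = (\<Sum>i<floorlog g n. digit g n i * g ^ i)"
    using b by (simp add: digit_expansion_less_power)
  have "floorlog g n \<noteq> 0"
    using assms by (simp add: floorlog_eq_zero_iff)
  then have "n < g * g ^ (floorlog g n - 1)"
    using b(2) by (cases "floorlog g n") auto
  then have "n div g ^ (floorlog g n - 1) < g"
    by (simp add: less_mult_imp_div_less)
  moreover have "n div g ^ (floorlog g n - 1) > 0"
    using b(1) assms by (simp add: div_greater_zero_iff)
  ultimately show "digit g n (floorlog g n - 1) \<noteq> 0"
    by (simp add: digit_def)
qed

(* Kleene's mu-recursive functions, with evaluation as a relation so that partiality is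
   harmless. Prec recurses on the first argument; Mu minimises over the first argument. *)
datatype recfun =
    Zero
  | Succ
  | Proj nat
  | Comp recfun "recfun list"
  | Prec recfun recfun
  | Mu recfun

inductive evaluates :: "recfun \<Rightarrow> nat list \<Rightarrow> nat \<Rightarrow> bool" where
  evaluates_Zero: "evaluates Zero xs 0"
| evaluates_Succ: "evaluates Succ [x] (Suc x)"
| evaluates_Proj: "i < length xs \<Longrightarrow> evaluates (Proj i) xs (xs ! i)"
| evaluates_Comp: "length ys = length hs \<Longrightarrow> (\<And>i. i < length hs \<Longrightarrow> evaluates (hs ! i) xs (ys ! i)) \<Longrightarrow>
    evaluates f ys y \<Longrightarrow> evaluates (Comp f hs) xs y"
| evaluates_Prec_0: "evaluates f xs y \<Longrightarrow> evaluates (Prec f h) (0 # xs) y"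
| evaluates_Prec_Suc: "evaluates (Prec f h) (n # xs) r \<Longrightarrow> evaluates h (n # r # xs) y \<Longrightarrow>
    evaluates (Prec f h) (Suc n # xs) y"
| evaluates_Mu: "evaluates f (n # xs) 0 \<Longrightarrow> (\<And>m. m < n \<Longrightarrow> \<exists>r. evaluates f (m # xs) (Suc r)) \<Longrightarrow>
    evaluates (Mu f) xs n"

lemma evaluates_deterministic: "evaluates f xs y \<Longrightarrow> evaluates f xs z \<Longrightarrow> y = z"
proof (induction arbitrary: z rule: evaluates.induct)
  case (evaluates_Comp ys hs xs f y)
  from evaluates_Comp.prems obtain zs where zs: "length zs = length hs"
    "\<And>i. i < length hs \<Longrightarrow> evaluates (hs ! i) xs (zs ! i)" "evaluates f zs z"
    by (cases rule: evaluates.cases) auto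
  have "ys = zs"
    using evaluates_Comp.hyps evaluates_Comp.IH zs by (intro nth_equalityI) auto
  then show ?case
    using evaluates_Comp.IH zs by blast
next
  case (evaluates_Prec_0 f xs y h)
  from evaluates_Prec_0.prems show ?case
    by (cases rule: evaluates.cases) (auto intro: evaluates_Prec_0.IH)
next
  case (evaluates_Prec_Suc f h n xs r y)
  from evaluates_Prec_Suc.prems show ?case
    by (cases rule: evaluates.cases) (use evaluates_Prec_Suc.IH in blast)
next
  case (evaluates_Mu f n xs)
  from evaluates_Mu.prems have z: "evaluates f (z # xs) 0"
    "\<And>m. m < z \<Longrightarrow> \<exists>r. evaluates f (m # xs) (Suc r)"
    by (cases rule: evaluates.cases; auto)+
  have "\<not> n < z"
    using z(2)[of n] evaluates_Mu.IH(1) by blast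
  moreover have "\<not> z < n"
    using z(1) evaluates_Mu.IH(2)[of z] by blast
  ultimately show ?case by simp
qed (auto elim: evaluates.cases)

definition recursive2 :: "(nat \<Rightarrow> nat \<Rightarrow> nat) \<Rightarrow> bool" where
  "recursive2 F \<longleftrightarrow> (\<exists>f. \<forall>x y. evaluates f [x, y] (F x y))"

(* Computable sequence of reals in the sense of Turing and Grzegorczyk: from n and k one can
   compute a dyadic approximation of c n with error at most 2^(-k); its integer numerator is
   given as the difference of two naturals. *)
definition effectively_computable :: "(nat \<Rightarrow> real) \<Rightarrow> bool" where
  "effectively_computable c \<longleftrightarrow>
     (\<exists>u v. recursive2 u \<and> recursive2 v \<and>
        (\<forall>n k. \<bar>c n - (real (u n k) - real (v n k)) / 2 ^ k\<bar> \<le> 1 / 2 ^ k))"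

end

theory Submission
  imports
    Defs
    "HOL-Number_Theory.Prime_Powers"
    "HOL-Computational_Algebra.Squarefree"
    "HOL-Real_Asymp.Real_Asymp"
begin

text \<open>
  Detecting the congruence by additive characters modulo \<open>q\<close>, the frequencies \<open>h/q\<close> with
  \<open>(g\<^sup>2 - 1) g\<^sup>N h/q\<close> integral give exactly the main term, so one has to bound
  \<open>\<Sum>\<^sub>p e(\<theta> rev p)\<close> for the other \<open>\<theta> = h/q\<close>. By Fourier inversion modulo \<open>x = g\<^sup>N\<close> this sum is
  \<open>x\<^sup>-\<^sup>1 \<Sum>\<^sub>b F(b) S(b/x)\<close>, where \<open>S\<close> is the exponential sum over primes and
  \<open>F(b) = \<Prod>\<^sub>i \<phi>(\<theta> g\<^bsup>N-1-i\<^esup> - b g\<^sup>i/x)\<close> is a product of Dirichlet kernels over the digits.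

  Vinogradov's bound (via Vaughan's identity) gives \<open>S(\<beta>) \<lless> x/\<surd>r + x\<^bsup>4/5\<^esup> + \<surd>(x r)\<close> up to logarithms,
  and the \<open>L\<^sup>1\<close> norm of \<open>F/x\<close> is at most \<open>C\<^sub>g\<^sup>N = x\<^bsup>\<alpha>\<^esup>\<close>; so the term \<open>x\<^bsup>4/5\<^esup>\<close> is harmless exactly when
  \<open>\<alpha> < 1/5\<close>. Near a rational with small denominator \<open>r\<close> the same \<open>L\<^sup>1\<close> bound is applied only to the
  lowest and the highest digits, which are the ones that resolve the rational and the distance to it.
  On the remaining middle digits one uses that consecutive frequencies \<open>x\<^sub>i\<close> satisfy
  \<open>g x\<^sub>i - x\<^bsub>i+1\<^esub> = (g\<^sup>2 - 1) \<theta> g\<^bsup>N-2-i\<^esup>\<close>: since \<open>(g\<^sup>2 - 1) \<theta> g\<^sup>N\<close> is not an integer, every window of about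
  \<open>log q / log g\<close> digits contains a factor bounded away from \<open>g\<close>, which saves
  \<open>exp (- c N / log q)\<close>. The condition on \<open>q\<close> makes this saving absorb all powers of \<open>N\<close>.

  All constants that do not depend on \<open>g\<close> may be chosen ineffectively, because a constant sequence is
  computable; the dependence on \<open>g\<close> is absorbed by powers of two.
\<close>

section \<open>Exponential sums\<close>

text \<open>No asymptotics for primes in progressions enter, hence no exceptional zeros: near a
  rational \<open>a / r\<close> the bound for \<open>S\<close> may be trivial, as the saving comes
  from \<open>F\<close>. Put \<open>k = max 1 (x * \<bar>\<beta> - a / r\<bar>)\<close>. In the
  class with \<open>r\<close> about \<open>g ^ j\<close> and \<open>k\<close> about
  \<open>g ^ m\<close>, \<open>S\<close> is at most \<open>x * g ^ (- (j + m) / 2)\<close>, up to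
  logarithms and the term \<open>x powr (4/5)\<close>, while resolving the class takes
  \<open>2 * (j + 1)\<close> low and \<open>m + 1\<close> high digits, at a cost of
  \<open>C_const g + 3\<close> for each. Since \<open>(C_const g + 3) ^ 4 \<le> g\<close>, decay and
  cost balance up to one factor \<open>g\<close>, and the free digits in the middle are pure profit.
  At least \<open>N div 10\<close> of them remain because \<open>r * k \<le> x powr (2/5)\<close>.
  The 3 pays for a supremum over the position of \<open>b\<close> within a cell: the low digits
  depend on \<open>b\<close> continuously, the high ones only on a residue of \<open>b\<close>. The
  reversal of a number depends on its length; the product formula is therefore applied to reversal
  in a window of fixed length, and primes with exactly \<open>N\<close> digits become a difference
  of two such sums.\<close>

definition ee :: "real \<Rightarrow> complex" where
  "ee t = cis (2 * pi * t)"

definition dist_int :: "real \<Rightarrow> real" where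
  "dist_int t = \<bar>t - of_int (round t)\<bar>"

lemma norm_ee [simp]: "norm (ee t) = 1"
  by (simp add: ee_def)

lemma ee_0 [simp]: "ee 0 = 1"
  by (simp add: ee_def)

lemma ee_add: "ee (s + t) = ee s * ee t"
  by (simp add: ee_def cis_mult algebra_simps)

lemma ee_minus: "ee (- t) = cnj (ee t)"
  by (simp add: ee_def cis_cnj)

lemma ee_of_int [simp]: "ee (of_int n) = 1"
  by (simp add: ee_def)

lemma ee_sum: "ee (\<Sum>i\<in>A. f i) = (\<Prod>i\<in>A. ee (f i))"
  by (induction A rule: infinite_finite_induct) (auto simp: ee_add)

lemma ee_power: "ee t ^ n = ee (real n * t)"
  unfolding ee_def Complex.DeMoivre by (rule arg_cong[of _ _ cis]) simp

lemma dist_int_nonneg [simp]: "dist_int t \<ge> 0"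
  by (simp add: dist_int_def)

lemma dist_int_le: "dist_int t \<le> \<bar>t - of_int m\<bar>"
  unfolding dist_int_def by (rule round_diff_minimal)

lemma dist_int_le_half: "dist_int t \<le> 1 / 2"
  using of_int_round_abs_le[of t] by (simp add: dist_int_def abs_minus_commute)

lemma dist_int_le_abs: "dist_int t \<le> \<bar>t\<bar>"
  using dist_int_le[of t 0] by simp

lemma dist_int_minus [simp]: "dist_int (- t) = dist_int t"
proof -
  have "dist_int (- t) \<le> dist_int t" for t
    using dist_int_le[of "-t" "- round t"] by (simp add: dist_int_def abs_minus_commute)
  from this[of t] this[of "-t"] show ?thesis by simp
qed

lemma dist_int_triangle: "dist_int (s + t) \<le> dist_int s + dist_int t"
  using dist_int_le[of "s + t" "round s + round t"] by (simp add: dist_int_def)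

lemma dist_int_of_int [simp]: "dist_int (of_int m) = 0"
  by (simp add: dist_int_def)

lemma dist_int_add_int [simp]: "dist_int (t + of_int m) = dist_int t"
proof -
  have "dist_int (t + of_int m) \<le> dist_int t" for t m
    using dist_int_triangle[of t "of_int m"] by simp
  from this[of t m] this[of "t + of_int m" "-m"] show ?thesis by simp
qed

lemma dist_int_nat_mult: "dist_int (real n * t) \<le> real n * dist_int t"
  using dist_int_le[of "real n * t" "int n * round t"]
  by (simp add: dist_int_def abs_mult flip: right_diff_distrib)

lemma norm_one_minus_ee: "norm (1 - ee t) = 2 * \<bar>sin (pi * t)\<bar>"
proof -
  have "1 - ee t = - (cis (pi * t) * (cis (pi * t) - cis (- (pi * t))))"
    by (simp add: ee_def cis_mult right_diff_distrib algebra_simps)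
  also have "cis (pi * t) - cis (- (pi * t)) = 2 * \<i> * of_real (sin (pi * t))"
    by (simp add: complex_eq_iff)
  finally show ?thesis
    by (simp add: norm_mult)
qed

text \<open>Jordan's inequality, from the concavity of the sine on the first quarter period.\<close>

lemma sin_ge_linear:
  assumes "0 \<le> u" "u \<le> 1 / 2"
  shows "sin (pi * u) \<ge> 2 * u"
proof -
  have "concave_on {0..pi/2} sin"
  proof (rule f''_le0_imp_concave)
    show "(sin has_real_derivative cos x) (at x)" for x by (auto intro!: derivative_eq_intros)
    show "(cos has_real_derivative - sin x) (at x)" for x by (auto intro!: derivative_eq_intros)
    show "- sin x \<le> 0" if "x \<in> {0..pi/2}" for x
      using that sin_ge_zero[of x] pi_gt_zero by auto
  qed auto
  then have "sin ((1 - 2 * u) *\<^sub>R 0 + (2 * u) *\<^sub>R (pi / 2)) \<ge> (1 - 2 * u) * sin 0 + 2 * u * sin (pi / 2)"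
    using assms by (intro concave_onD) auto
  then show ?thesis by (simp add: mult_ac)
qed

lemma abs_sin_pi_ge: "\<bar>sin (pi * t)\<bar> \<ge> 2 * dist_int t"
proof -
  define u where "u = t - of_int (round t)"
  have "\<bar>sin (pi * t)\<bar> = \<bar>sin (pi * \<bar>u\<bar>)\<bar>"
  proof -
    have "pi * t = pi * u + pi * of_int (round t)" by (simp add: u_def algebra_simps)
    then have "sin (pi * t) = sin (pi * u) * cos (pi * of_int (round t))"
      by (simp add: sin_add sin_integer_2pi mult.commute sin_zero_iff_int2)
    moreover have "\<bar>cos (pi * of_int (round t))\<bar> = 1"
      using cos_one_2pi_int sin_cos_squared_add[of "pi * of_int (round t)"]
      by (auto simp add: sin_zero_iff_int2 mult.commute power2_eq_1_iff)
    ultimately show ?thesis by (cases "u \<ge> 0") (auto simp: abs_mult)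
  qed
  moreover have "sin (pi * \<bar>u\<bar>) \<ge> 2 * \<bar>u\<bar>"
    using dist_int_le_half[of t] by (intro sin_ge_linear) (auto simp: u_def dist_int_def)
  ultimately show ?thesis by (simp add: dist_int_def u_def)
qed

section \<open>Geometric sums and their majorant\<close>

lemma norm_geometric_sum_sin: "norm (\<Sum>n<k. ee (real n * t)) * \<bar>sin (pi * t)\<bar> \<le> 1"
proof -
  have "(1 - ee t) * (\<Sum>n<k. ee (real n * t)) = 1 - ee t ^ k"
    using one_diff_power_eq[of "ee t" k] by (simp add: ee_power)
  then have "norm (1 - ee t) * norm (\<Sum>n<k. ee (real n * t)) = norm (1 - ee t ^ k)"
    by (metis norm_mult)
  also have "\<dots> \<le> 2"
    by (rule order.trans[OF norm_triangle_ineq4]) (simp add: norm_power)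
  finally show ?thesis
    by (simp add: norm_one_minus_ee mult_ac)
qed

text \<open>A majorant of \<open>min M (1 / t)\<close> that needs no convention at \<open>t = 0\<close>.\<close>

definition kern :: "real \<Rightarrow> real \<Rightarrow> real" where
  "kern M t = 2 * M / (1 + M * t)"

lemma kern_nonneg: "M \<ge> 0 \<Longrightarrow> t \<ge> 0 \<Longrightarrow> kern M t \<ge> 0"
  by (simp add: kern_def)

lemma kern_mono: "0 \<le> M \<Longrightarrow> M \<le> M' \<Longrightarrow> 0 \<le> t \<Longrightarrow> kern M t \<le> kern M' t"
proof -
  assume *: "0 \<le> M" "M \<le> M'" "0 \<le> t"
  then have "1 + M * t > 0" "1 + M' * t > 0"
    by (auto intro: add_pos_nonneg)
  then show ?thesis
    using * by (simp add: kern_def divide_simps) (simp add: algebra_simps)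
qed

lemma kern_le_left: "0 \<le> M \<Longrightarrow> 0 \<le> t \<Longrightarrow> kern M t \<le> 2 * M"
proof -
  assume *: "0 \<le> M" "0 \<le> t"
  then have "1 + M * t > 0" by (auto intro: add_pos_nonneg)
  then show ?thesis using * by (simp add: kern_def pos_divide_le_eq distrib_left)
qed

lemma kern_le_right: "0 \<le> M \<Longrightarrow> 0 < t \<Longrightarrow> kern M t \<le> 2 / t"
proof -
  assume "0 \<le> M" "0 < t"
  then have "1 + M * t > 0" by (auto intro: add_pos_nonneg)
  with \<open>0 < t\<close> show ?thesis by (simp add: kern_def divide_simps) 
qed

lemma norm_geometric_sum_kern: "norm (\<Sum>n<k. ee (real n * t)) \<le> kern (real k) (dist_int t)"
proof -
  let ?S = "norm (\<Sum>n<k. ee (real n * t))"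
  have 1: "?S \<le> real k"
    using sum_norm_le[of "{..<k}" "\<lambda>n. ee (real n * t)" "\<lambda>_. 1"] by simp
  have "?S * (2 * dist_int t) \<le> ?S * \<bar>sin (pi * t)\<bar>"
    by (intro mult_left_mono abs_sin_pi_ge) auto
  also have "\<dots> \<le> 1" by (rule norm_geometric_sum_sin)
  finally have "?S * (2 * dist_int t) * real k \<le> 1 * real k"
    by (intro mult_right_mono) auto
  \<comment> \<open>The trivial bound plus \<open>k\<close> times the sine bound; this combination
    is the reason for the denominator \<open>1 + M * t\<close> of \<open>kern\<close>.\<close>
  then have "?S * (1 + real k * dist_int t) \<le> 2 * real k"
    using 1 by (simp add: algebra_simps)
  moreover have "1 + real k * dist_int t > 0" by (auto intro: add_pos_nonneg)
  ultimately show ?thesis by (simp add: kern_def pos_le_divide_eq)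
qed

lemma norm_geometric_interval_kern:
  assumes "real (b - a) \<le> M"
  shows "norm (\<Sum>n\<in>{a..<b}. ee (real n * t)) \<le> kern M (dist_int t)"
proof -
  have "(\<Sum>n\<in>{a..<b}. ee (real n * t)) = (\<Sum>n<b - a. ee (real (n + a) * t))"
    by (cases "a \<le> b")
       (auto intro!: sum.reindex_bij_witness[of _ "\<lambda>n. n + a" "\<lambda>n. n - a"])
  also have "\<dots> = ee (real a * t) * (\<Sum>n<b - a. ee (real n * t))"
    unfolding sum_distrib_left ee_add[symmetric] by (simp add: algebra_simps)
  finally have "norm (\<Sum>n\<in>{a..<b}. ee (real n * t)) = norm (\<Sum>n<b - a. ee (real n * t))"
    by (simp add: norm_mult)
  also have "\<dots> \<le> kern M (dist_int t)"
    using norm_geometric_sum_kern kern_mono assms by (meson dist_int_nonneg of_nat_0_le_iff order_trans)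
  finally show ?thesis .
qed

lemma sum_reciprocal_shift:
  "(\<Sum>\<rho><n + 2. if \<rho> \<le> 1 then X else Y / (real \<rho> - 1)) = 2 * X + Y * harm n"
proof (induction n)
  case 0
  then show ?case by (simp add: lessThan_Suc numeral_2_eq_2 harm_def)
next
  case (Suc n)
  then show ?case by (simp add: harm_Suc field_simps)
qed

lemma sum_reciprocal_shift_le:
  assumes "X \<ge> 0" "Y \<ge> 0"
  shows "(\<Sum>\<rho><r. if \<rho> \<le> 1 then X else Y / (real \<rho> - 1)) \<le> 2 * X + Y * harm r"
proof -
  have "(\<Sum>\<rho><r. if \<rho> \<le> 1 then X else Y / (real \<rho> - 1)) \<le> (\<Sum>\<rho><r + 2. if \<rho> \<le> 1 then X else Y / (real \<rho> - 1))"
    using assms by (intro sum_mono2) auto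
  then show ?thesis by (simp only: sum_reciprocal_shift)
qed

text \<open>The shift \<open>\<nu>\<close> is a fractional part in [0, 1) plus a drift of absolute
  value at most 1, hence the range from -1 to 2. The residues at both ends may be moved onto an
  integer, and there the bound is vacuous.\<close>

lemma dist_int_shifted_fraction:
  fixes \<rho> r :: nat and \<nu> :: real
  assumes "\<rho> < r" "-1 \<le> \<nu>" "\<nu> \<le> 2"
  shows "dist_int ((real \<rho> + \<nu>) / real r) \<ge> min ((real \<rho> - 1) / real r) ((real r - real \<rho> - 2) / real r)"
proof -
  define m where "m = round ((real \<rho> + \<nu>) / real r)"
  have d: "dist_int ((real \<rho> + \<nu>) / real r) = \<bar>(real \<rho> + \<nu>) / real r - of_int m\<bar>"
    by (simp add: dist_int_def m_def)
  have r: "real r > 0" using assms by simp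
  show ?thesis
  proof (cases "m \<le> 0")
    case True
    have "(real \<rho> - 1) / real r \<le> (real \<rho> + \<nu>) / real r"
      using assms by (intro divide_right_mono) auto
    also have "\<dots> \<le> (real \<rho> + \<nu>) / real r - of_int m" using True by simp
    finally show ?thesis using d by linarith
  next
    case False
    then have "real_of_int m \<ge> 1" by simp
    moreover have "(real r - real \<rho> - 2) / real r \<le> 1 - (real \<rho> + \<nu>) / real r"
      using assms r by (simp add: field_simps)
    ultimately show ?thesis using d by linarith
  qed
qed

section \<open>Sums of \<open>kern\<close> along the multiples of a nearly rational number\<close>

locale rational_approx =
  fixes \<beta> :: real and a :: int and r :: nat
  assumes r_pos: "r \<ge> 1" and coprime_ar: "coprime a (int r)"
    and approx: "\<bar>\<beta> - of_int a / real r\<bar> \<le> 1 / (real r)\<^sup>2"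
begin

lemma residues_inj: "inj_on (\<lambda>j. nat ((c + int j * a) mod int r)) {..<r}"
proof (rule inj_onI)
  fix i j assume ij: "i \<in> {..<r}" "j \<in> {..<r}"
    and "nat ((c + int i * a) mod int r) = nat ((c + int j * a) mod int r)"
  then have "(c + int i * a) mod int r = (c + int j * a) mod int r"
    using r_pos by (metis Euclidean_Rings.pos_mod_sign eq_nat_nat_iff int_ops(2) of_nat_le_0_iff not_one_le_zero zle_int linorder_not_le)
  then have "[c + int i * a = c + int j * a] (mod int r)" by (simp add: cong_def)
  then have "[int i * a = int j * a] (mod int r)" by (simp add: cong_add_lcancel)
  then have "[int i = int j] (mod int r)"
    using coprime_ar by (simp add: cong_mult_rcancel)
  then show "i = j" using ij by (simp add: cong_int_iff cong_def)
qed

text \<open>Over \<open>r\<close> consecutive multiples, \<open>j * a\<close> runs once through all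
  residues modulo \<open>r\<close>, and the error \<open>\<delta>\<close> displaces each point by at
  most \<open>1 / r\<close>. Apart from the residues at the ends, the distances to the nearest
  integer are those of an arithmetic progression, which gives a harmonic sum.\<close>

lemma kern_block:
  assumes "M \<ge> 0"
  shows "(\<Sum>j<r. kern M (dist_int (of_int (h0 + int j) * \<beta>))) \<le> 8 * M + 4 * real r * harm r"
proof -
  define \<delta> where "\<delta> = \<beta> - of_int a / real r"
  define c where "c = \<lfloor>real r * (of_int h0 * \<beta>)\<rfloor>"
  define \<nu>0 where "\<nu>0 = real r * (of_int h0 * \<beta>) - of_int c"
  define \<rho> where "\<rho> = (\<lambda>j. nat ((c + int j * a) mod int r))"
  \<comment> \<open>\<open>A\<close> bounds the kernel by the distance from the left end of the unit
    interval; the mirrored index \<open>r - 1 - \<rho>\<close> serves the right end, and adding both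
    avoids deciding which end is nearer.\<close>
  define A where "A = (\<lambda>\<rho>. if \<rho> \<le> 1 then 2 * M else 2 * real r / (real \<rho> - 1))"
  have r: "real r > 0" using r_pos by simp
  have \<nu>0: "0 \<le> \<nu>0" "\<nu>0 < 1" unfolding \<nu>0_def c_def by linarith+
  have \<rho>_less: "\<rho> j < r" for j using r_pos by (simp add: \<rho>_def nat_less_iff)
  have bij: "bij_betw \<rho> {..<r} {..<r}"
    unfolding bij_betw_def \<rho>_def
    by (intro conjI residues_inj endo_inj_surj)
       (use \<rho>_less residues_inj in \<open>auto simp: \<rho>_def\<close>)
  have le: "kern M (dist_int (of_int (h0 + int j) * \<beta>)) \<le> A (\<rho> j) + A (r - 1 - \<rho> j)" if j: "j < r" for j
  proof -
    define \<nu> where "\<nu> = \<nu>0 + real r * (real j * \<delta>)"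
    have "\<bar>real r * (real j * \<delta>)\<bar> \<le> real r * (real r * (1 / (real r)\<^sup>2))"
      unfolding abs_mult using approx j by (intro mult_mono) (auto simp: \<delta>_def)
    also have "\<dots> = 1" using r by (simp add: power2_eq_square)
    finally have \<nu>: "-1 \<le> \<nu>" "\<nu> \<le> 2" using \<nu>0 by (auto simp: \<nu>_def)
    have "of_int (h0 + int j) * \<beta> = (real_of_int (c + int j * a) + \<nu>) / real r"
      using r by (simp add: \<nu>_def \<nu>0_def \<delta>_def field_simps)
    also have "c + int j * a = int (\<rho> j) + int r * ((c + int j * a) div int r)"
      using r_pos by (simp add: \<rho>_def)
    also have "(real_of_int (int (\<rho> j) + int r * ((c + int j * a) div int r)) + \<nu>) / real r =
        (real (\<rho> j) + \<nu>) / real r + of_int ((c + int j * a) div int r)"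
      using r by (simp add: field_simps)
    finally have "dist_int (of_int (h0 + int j) * \<beta>) = dist_int ((real (\<rho> j) + \<nu>) / real r)"
      by simp
    then have d: "dist_int (of_int (h0 + int j) * \<beta>) \<ge> min ((real (\<rho> j) - 1) / real r) ((real r - real (\<rho> j) - 2) / real r)"
      using dist_int_shifted_fraction[OF \<rho>_less \<nu>] by simp
    have A0: "A n \<ge> 0" for n using assms by (auto simp: A_def)
    let ?d = "dist_int (of_int (h0 + int j) * \<beta>)"
    have step: "kern M ?d \<le> 2 * real r / y" if "?d \<ge> y / real r" "y > 0" for y
    proof -
      have "kern M ?d \<le> 2 / ?d" 
        using that r by (intro kern_le_right assms) (smt (verit) divide_pos_pos)
      also have "\<dots> \<le> 2 / (y / real r)"
        using that r by (intro divide_left_mono) (auto intro!: mult_pos_pos divide_pos_pos intro: less_le_trans[of 0 "y / real r"])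
      finally show ?thesis by simp
    qed
    have left: "kern M ?d \<le> A (\<rho> j)" if "?d \<ge> (real (\<rho> j) - 1) / real r"
      using kern_le_left[OF assms, of ?d] step[OF that] by (cases "\<rho> j \<le> 1") (simp_all add: A_def)
    have right: "kern M ?d \<le> A (r - 1 - \<rho> j)" if "?d \<ge> (real r - real (\<rho> j) - 2) / real r"
    proof (cases "r - 1 - \<rho> j \<le> 1")
      case True
      then show ?thesis using kern_le_left[OF assms, of ?d] by (simp add: A_def)
    next
      case False
      then have "real (r - 1 - \<rho> j) - 1 = real r - real (\<rho> j) - 2" "real r - real (\<rho> j) - 2 > 0"
        using \<rho>_less[of j] by (auto simp: of_nat_diff)
      then show ?thesis using step[OF that] False by (simp add: A_def)
    qed
    show ?thesis
      using d left right A0[of "\<rho> j"] A0[of "r - 1 - \<rho> j"] by linarith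
  qed
  have "(\<Sum>j<r. kern M (dist_int (of_int (h0 + int j) * \<beta>))) \<le> (\<Sum>j<r. A (\<rho> j) + A (r - 1 - \<rho> j))"
    using le by (intro sum_mono) auto
  also have "\<dots> = (\<Sum>j<r. A j + A (r - 1 - j))"
    by (rule sum.reindex_bij_betw[OF bij])
  also have "\<dots> = (\<Sum>j<r. A j) + (\<Sum>j<r. A (r - 1 - j))" by (rule sum.distrib)
  also have "(\<Sum>j<r. A (r - 1 - j)) = (\<Sum>j<r. A j)"
    using sum.nat_diff_reindex[of A r] by simp
  also have "(\<Sum>j<r. A j) \<le> 2 * (2 * M) + 2 * real r * harm r"
    unfolding A_def using assms by (intro sum_reciprocal_shift_le) auto
  finally show ?thesis by (simp add: mult_ac)
qed

lemma kern_interval: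
  assumes "M \<ge> 0"
  shows "(\<Sum>j<Z. kern M (dist_int (of_int (h0 + int j) * \<beta>))) \<le> (real Z / real r + 1) * (8 * M + 4 * real r * harm r)"
proof -
  define n where "n = Z div r + 1"
  let ?f = "\<lambda>j. kern M (dist_int (of_int (h0 + int j) * \<beta>))"
  have "Z < n * r" using dividend_less_div_times[of r Z] r_pos by (simp add: n_def algebra_simps)
  then have "(\<Sum>j<Z. ?f j) \<le> (\<Sum>j<n * r. ?f j)"
    using assms by (intro sum_mono2) (auto intro: kern_nonneg)
  also have "\<dots> = (\<Sum>l<n. \<Sum>j\<in>{l * r..<l * r + r}. ?f j)"
    by (rule sum.nat_group[symmetric])
  also have "\<dots> \<le> (\<Sum>l<n. 8 * M + 4 * real r * harm r)"
  proof (rule sum_mono)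
    fix l
    have "(\<Sum>j\<in>{l * r..<l * r + r}. ?f j) = (\<Sum>j<r. kern M (dist_int (of_int ((h0 + int (l * r)) + int j) * \<beta>)))"
      by (rule sum.reindex_bij_witness[of _ "\<lambda>j. j + l * r" "\<lambda>j. j - l * r"]) (auto simp: algebra_simps)
    also have "\<dots> \<le> 8 * M + 4 * real r * harm r" by (rule kern_block[OF assms])
    finally show "(\<Sum>j\<in>{l * r..<l * r + r}. ?f j) \<le> 8 * M + 4 * real r * harm r" .
  qed
  also have "\<dots> = real n * (8 * M + 4 * real r * harm r)" by simp
  also have "\<dots> \<le> (real Z / real r + 1) * (8 * M + 4 * real r * harm r)"
    using assms by (intro mult_right_mono add_nonneg_nonneg) (auto simp: n_def harm_nonneg of_nat_div_le_of_nat)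
  finally show ?thesis .
qed

text \<open>For \<open>m\<close> at most \<open>r / 2\<close> the fraction \<open>m * a / r\<close>
  is not an integer, hence at distance at least \<open>1 / r\<close>, and the approximation error
  eats at most half of that. These are the \<open>m\<close> for which the height
  \<open>X / m\<close> in \<open>kern_type_I\<close> is too large to be of use.\<close>

lemma dist_int_initial:
  assumes "1 \<le> m" "2 * m \<le> r"
  shows "dist_int (real m * \<beta>) \<ge> 1 / (2 * real r)"
proof -
  define \<delta> where "\<delta> = \<beta> - of_int a / real r"
  have r: "real r > 0" using r_pos by simp
  let ?y = "real m * (of_int a / real r)"
  have "\<not> int r dvd int m * a"
  proof
    assume "int r dvd int m * a"
    then have "int r dvd int m" using coprime_ar by (simp add: coprime_commute coprime_dvd_mult_left_iff)
    then have "r dvd m" by simp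
    then show False using assms by (auto dest: dvd_imp_le)
  qed
  then have ne: "int m * a - int r * round ?y \<noteq> 0"
    by auto
  have "1 / real r \<le> \<bar>real_of_int (int m * a - int r * round ?y)\<bar> / real r"
    using ne by (intro divide_right_mono) (simp_all add: of_int_abs[symmetric] del: of_int_abs of_int_diff of_int_mult)
  also have "\<dots> = \<bar>real_of_int (int m * a - int r * round ?y) / real r\<bar>" using r by simp
  also have "real_of_int (int m * a - int r * round ?y) / real r = ?y - of_int (round ?y)"
    using r by (simp add: field_simps)
  finally have "dist_int ?y \<ge> 1 / real r" by (simp add: dist_int_def)
  moreover have "dist_int ?y \<le> dist_int (real m * \<beta>) + dist_int (- (real m * \<delta>))"
    using dist_int_triangle[of "real m * \<beta>" "- (real m * \<delta>)"] by (simp add: \<delta>_def algebra_simps)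
  moreover have "dist_int (- (real m * \<delta>)) \<le> 1 / (2 * real r)"
  proof -
    have "dist_int (- (real m * \<delta>)) \<le> \<bar>real m * \<delta>\<bar>" using dist_int_le_abs[of "- (real m * \<delta>)"] by simp
    also have "\<dots> \<le> (real r / 2) * (1 / (real r)\<^sup>2)"
      unfolding abs_mult using approx assms by (intro mult_mono) (auto simp: \<delta>_def)
    also have "\<dots> = 1 / (2 * real r)" using r by (simp add: power2_eq_square)
    finally show ?thesis .
  qed
  moreover have "1 / real r = 1 / (2 * real r) + 1 / (2 * real r)" using r by (simp add: field_simps)
  ultimately show ?thesis by linarith
qed

text \<open>The heights \<open>X / m\<close> vary with \<open>m\<close>. For
  \<open>m \<le> r / 2\<close> they are ignored, as no multiple is close to an integer. After that,
  block number \<open>l\<close> of length \<open>r\<close> starts beyond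
  \<open>(l + 1) * r / 2\<close>, so its height is at most \<open>2 * X / ((l + 1) * r)\<close>, and
  the heights of all blocks add up to a harmonic sum.\<close>

lemma kern_type_I:
  assumes "X \<ge> 0" "harm r \<le> H" "harm (Z + 1) \<le> H" "1 \<le> H"
  shows "(\<Sum>m=1..Z. kern (X / real m) (dist_int (real m * \<beta>))) \<le> 44 * H * (X / real r + real Z + real r)"
proof -
  define s where "s = r div 2"
  define n where "n = Z div r + 1"
  let ?f = "\<lambda>m. kern (X / real m) (dist_int (real m * \<beta>))"
  have r: "real r > 0" using r_pos by simp
  have f0: "?f m \<ge> 0" for m using assms by (auto intro!: kern_nonneg)
  have sub: "{1..Z} \<subseteq> {1..s} \<union> {s+1..<s+1 + n * r}"
  proof -
    have "Z < n * r" using dividend_less_div_times[of r Z] r_pos by (simp add: n_def algebra_simps)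
    then show ?thesis by auto
  qed
  have "(\<Sum>m=1..Z. ?f m) \<le> (\<Sum>m\<in>{1..s} \<union> {s+1..<s+1 + n * r}. ?f m)"
    using sub f0 by (intro sum_mono2) auto
  also have "\<dots> = (\<Sum>m=1..s. ?f m) + (\<Sum>m\<in>{s+1..<s+1 + n * r}. ?f m)"
    by (intro sum.union_disjoint) auto
  also have "(\<Sum>m=1..s. ?f m) \<le> (\<Sum>m=1..s. 2 * kern (2 * real r) (dist_int (real m * \<beta>)))"
  proof (rule sum_mono)
    fix m assume m: "m \<in> {1..s}"
    define d where "d = dist_int (real m * \<beta>)"
    have d: "d \<ge> 1 / (2 * real r)" unfolding d_def using m by (intro dist_int_initial) (auto simp: s_def)
    then have d0: "d > 0" using r by (smt (verit) divide_pos_pos)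
    \<comment> \<open>At distance at least \<open>1 / (2 * r)\<close> the kernel of height
      \<open>2 * r\<close> already dominates \<open>1 / d\<close>, which turns the initial part into
      a block sum.\<close>
    have "2 * real r * d \<ge> 1" using d r by (simp add: field_simps)
    moreover have "1 + 2 * real r * d > 0" using r d0 by (simp add: add_pos_nonneg)
    ultimately have "1 / d \<le> kern (2 * real r) d" using d0 by (simp add: kern_def field_simps)
    moreover have "kern (X / real m) d \<le> 2 / d" using d0 assms by (intro kern_le_right) auto
    ultimately show "?f m \<le> 2 * kern (2 * real r) (dist_int (real m * \<beta>))"
      by (simp add: d_def)
  qed
  also have "(\<Sum>m=1..s. 2 * kern (2 * real r) (dist_int (real m * \<beta>))) \<le>
      (\<Sum>m<r. 2 * kern (2 * real r) (dist_int (of_int (0 + int m) * \<beta>)))"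
    using r_pos by (simp, intro sum_mono2) (auto simp: s_def intro!: kern_nonneg)
  also have "\<dots> \<le> 2 * (8 * (2 * real r) + 4 * real r * harm r)"
    unfolding sum_distrib_left[symmetric] by (intro mult_left_mono kern_block) auto
  also have "\<dots> \<le> 40 * (H * real r)"
    using mult_right_mono[OF assms(2), of "real r"] mult_right_mono[OF assms(4), of "real r"] by (simp add: mult_ac)
  also have "(\<Sum>m\<in>{s+1..<s+1 + n * r}. ?f m) = (\<Sum>j<n * r. ?f (s + 1 + j))"
    by (rule sum.reindex_bij_witness[of _ "\<lambda>j. s + 1 + j" "\<lambda>m. m - (s + 1)"]) auto
  also have "\<dots> = (\<Sum>l<n. \<Sum>j\<in>{l * r..<l * r + r}. ?f (s + 1 + j))"
    by (rule sum.nat_group[symmetric])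
  also have "\<dots> \<le> (\<Sum>l<n. 16 * (X / real r) * inverse (real (Suc l)) + 4 * real r * harm r)"
  proof (rule sum_mono)
    fix l
    define M where "M = 2 * X / (real (Suc l) * real r)"
    have M: "M \<ge> 0" using assms by (simp add: M_def)
    have "(\<Sum>j\<in>{l * r..<l * r + r}. ?f (s + 1 + j)) = (\<Sum>j<r. ?f (s + 1 + l * r + j))"
      by (rule sum.reindex_bij_witness[of _ "\<lambda>j. j + l * r" "\<lambda>j. j - l * r"]) (auto simp: algebra_simps)
    also have "\<dots> \<le> (\<Sum>j<r. kern M (dist_int (of_int (int (s + 1 + l * r) + int j) * \<beta>)))"
    proof (rule sum_mono)
      fix j
      have "real (Suc l) * real r / 2 \<le> real (s + 1 + l * r + j)"
      proof -
        have "r \<le> 2 * (s + 1)" by (simp add: s_def)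
        then have "Suc l * r \<le> 2 * (s + 1 + l * r + j)" by simp
        then have "real (Suc l * r) \<le> real (2 * (s + 1 + l * r + j))" by (simp only: of_nat_le_iff)
        then show ?thesis by (simp add: algebra_simps)
      qed
      then have "X / real (s + 1 + l * r + j) \<le> X / (real (Suc l) * real r / 2)"
        using assms r by (intro divide_left_mono) (auto intro!: mult_pos_pos simp: add_pos_nonneg)
      also have "\<dots> = M" by (simp add: M_def)
      finally have "?f (s + 1 + l * r + j) \<le> kern M (dist_int (real (s + 1 + l * r + j) * \<beta>))"
        using assms by (intro kern_mono) auto
      then show "?f (s + 1 + l * r + j) \<le> kern M (dist_int (of_int (int (s + 1 + l * r) + int j) * \<beta>))"
        by (simp add: add.assoc)
    qed
    also have "\<dots> \<le> 8 * M + 4 * real r * harm r" by (rule kern_block[OF M])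
    also have "8 * M = 16 * (X / real r) * inverse (real (Suc l))"
      by (simp add: M_def field_simps)
    finally show "(\<Sum>j\<in>{l * r..<l * r + r}. ?f (s + 1 + j)) \<le>
        16 * (X / real r) * inverse (real (Suc l)) + 4 * real r * harm r" .
  qed
  also have "\<dots> = 16 * (X / real r) * harm n + real n * (4 * real r * harm r)"
    by (simp add: sum.distrib harm_altdef sum_distrib_left)
  also have "16 * (X / real r) * harm n \<le> 16 * (X / real r) * H"
  proof (intro mult_left_mono)
    have "n \<le> Z + 1" by (simp add: n_def)
    then show "harm n \<le> H" using harm_mono[of n "Z + 1", where 'a = real] assms by linarith
  qed (use assms in auto)
  also have "real n * (4 * real r * harm r) \<le> 4 * (real Z + real r) * H"
  proof -
    have "n * r \<le> Z + r" by (simp add: n_def)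
    then have "real n * real r \<le> real Z + real r" by (metis of_nat_add of_nat_le_iff of_nat_mult)
    then have "(real n * real r) * harm r \<le> (real Z + real r) * H"
      using assms harm_nonneg by (intro mult_mono) auto
    then show ?thesis by (simp add: algebra_simps)
  qed
  finally have "(\<Sum>m=1..Z. ?f m) \<le> 40 * (H * real r) + 16 * (X / real r) * H + 4 * (real Z + real r) * H" by simp
  also have "\<dots> \<le> 44 * H * (X / real r + real Z + real r)"
  proof -
    define W where "W = X / real r"
    have "H * W \<ge> 0" "H * real Z \<ge> 0" using assms by (auto simp: W_def)
    then show ?thesis unfolding W_def[symmetric] by (simp add: algebra_simps)
  qed
  finally show ?thesis .
qed

end

section \<open>Vaughan's identity\<close>

definition moeb :: "nat \<Rightarrow> int" where
  "moeb n = (if squarefree n then (-1) ^ card (prime_factors n) else 0)"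

lemma abs_moeb_le: "\<bar>moeb n\<bar> \<le> 1"
  by (simp add: moeb_def)

lemma moeb_prime_mult:
  assumes "prime p" "\<not> p dvd d" "d > 0"
  shows "moeb (p * d) = - moeb d"
proof -
  have cop: "coprime p d" using assms by (simp add: prime_imp_coprime)
  have "squarefree (p * d) \<longleftrightarrow> squarefree d"
    using cop assms by (auto simp: squarefree_mult_coprime squarefree_prime dest: squarefree_multD)
  moreover have "prime_factors (p * d) = insert p (prime_factors d)"
    using assms by (auto simp: prime_factors_product prime_prime_factors)
  moreover have "p \<notin> prime_factors d" using assms by auto
  ultimately show ?thesis by (simp add: moeb_def)
qed

text \<open>A fixed prime divisor \<open>p\<close> of \<open>n\<close> pairs \<open>d\<close> with
  \<open>p * d\<close> for \<open>d\<close> prime to \<open>p\<close>, with opposite signs; the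
  divisors left over are divisible by the square of \<open>p\<close>.\<close>

lemma sum_moeb_dvd:
  assumes "n > 0"
  shows "(\<Sum>d | d dvd n. moeb d) = (if n = 1 then 1 else 0)"
proof (cases "n = 1")
  case True
  then show ?thesis by (simp add: moeb_def)
next
  case False
  then obtain p where p: "prime p" "p dvd n" using prime_factor_nat by blast
  define A where "A = {d. d dvd n \<and> \<not> p dvd d \<and> p * d dvd n}"
  have fin: "finite {d. d dvd n}" using assms by simp
  have "(\<Sum>d | d dvd n. moeb d) = (\<Sum>d\<in>A \<union> (\<lambda>d. p * d) ` A. moeb d)"
  proof (rule sum.mono_neutral_right[OF fin])
    show "A \<union> (\<lambda>d. p * d) ` A \<subseteq> {d. d dvd n}" by (auto simp: A_def)
    show "\<forall>d\<in>{d. d dvd n} - (A \<union> (\<lambda>d. p * d) ` A). moeb d = 0"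
    proof
      fix d assume d: "d \<in> {d. d dvd n} - (A \<union> (\<lambda>d. p * d) ` A)"
      show "moeb d = 0"
      proof (cases "p dvd d")
        case False
        then have "coprime p d" using p by (simp add: prime_imp_coprime)
        then have "p * d dvd n" using p d by (simp add: divides_mult)
        then show ?thesis using d False by (auto simp: A_def)
      next
        case True
        then obtain d' where d': "d = p * d'" by auto
        then have "d' dvd n" using d by (metis DiffD1 dvd_mult_right mem_Collect_eq)
        then have "p dvd d'" using d d' by (auto simp: A_def)
        then have "p\<^sup>2 dvd d" using d' by (simp add: power2_eq_square)
        then have "\<not> squarefree d" using p by (metis not_prime_unit squarefreeD)
        then show ?thesis by (simp add: moeb_def)
      qed
    qed
  qed
  also have "\<dots> = (\<Sum>d\<in>A. moeb d) + (\<Sum>d\<in>(\<lambda>d. p * d) ` A. moeb d)"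
  proof (rule sum.union_disjoint)
    show "finite A" by (rule finite_subset[OF _ fin]) (auto simp: A_def)
    then show "finite ((\<lambda>d. p * d) ` A)" by simp
    show "A \<inter> (\<lambda>d. p * d) ` A = {}" by (auto simp: A_def)
  qed
  also have "(\<Sum>d\<in>(\<lambda>d. p * d) ` A. moeb d) = (\<Sum>d\<in>A. moeb (p * d))"
    using p by (subst sum.reindex) (auto simp: inj_on_def prime_gt_0_nat)
  also have "\<dots> = (\<Sum>d\<in>A. - moeb d)"
    using p assms by (intro sum.cong moeb_prime_mult) (auto simp: A_def intro!: Nat.gr0I)
  finally show ?thesis using False by (simp add: sum_negf)
qed

lemma sum_multiples_swap:
  fixes F :: "nat \<Rightarrow> nat \<Rightarrow> complex"
  shows "(\<Sum>m=1..y. \<Sum>n=1..y div m. F m n) = (\<Sum>l=1..y. \<Sum>d | d dvd l. F d (l div d))"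
proof -
  have "(\<Sum>m=1..y. \<Sum>n=1..y div m. F m n) = (\<Sum>(m, n)\<in>(SIGMA m:{1..y}. {1..y div m}). F m n)"
    by (rule sum.Sigma) auto
  also have "\<dots> = (\<Sum>(l, d)\<in>(SIGMA l:{1..y}. {d. d dvd l}). F d (l div d))"
  proof (rule sum.reindex_bij_witness[of _ "\<lambda>(l, d). (d, l div d)" "\<lambda>(m, n). (m * n, m)"], goal_cases)
    case (4 z)
    then obtain l d where z: "z = (l, d)" "1 \<le> l" "l \<le> y" "d dvd l" by auto
    then have "d > 0" "d \<le> l" "l div d > 0" by (auto intro: Nat.gr0I dest: dvd_imp_le simp: div_greater_zero_iff)
    then show ?case using z by (auto simp: div_le_mono)
  next
    case (2 z)
    then obtain m n where z: "z = (m, n)" "1 \<le> m" "m \<le> y" "1 \<le> n" "n \<le> y div m" by auto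
    then have "m * n \<le> y" by (simp add: less_eq_div_iff_mult_less_eq mult.commute)
    then show ?case using z by simp
  qed auto
  also have "\<dots> = (\<Sum>l=1..y. \<Sum>d | d dvd l. F d (l div d))"
    by (rule sum.Sigma[symmetric]) auto
  finally show ?thesis .
qed

text \<open>The convolution of the constant 1 with the part of the von Mangoldt function beyond
  \<open>V\<close>: the second factor in Vaughan's bilinear term.\<close>

definition mangoldt_gt :: "nat \<Rightarrow> nat \<Rightarrow> real" where
  "mangoldt_gt V n = (\<Sum>c | c dvd n \<and> V < c. mangoldt c)"

lemma mangoldt_nonneg: "(mangoldt n :: real) \<ge> 0"
proof (cases "primepow n")
  case True
  then have "real (aprimedivisor n) \<ge> 1"
    using aprimedivisor_pos_nat primepow_gt_Suc_0 
    by (metis One_nat_def Suc_leI of_nat_1 of_nat_le_iff)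
  then show ?thesis by (simp add: mangoldt_def)
qed (simp add: mangoldt_def)

lemma mangoldt_split:
  assumes "n > 0"
  shows "mangoldt_gt V n = ln (real n) - (\<Sum>c | c dvd n \<and> c \<le> V. mangoldt c)"
proof -
  have "ln (real n) = (\<Sum>c | c dvd n. mangoldt c)"
    using mangoldt_sum[of n, where 'a = real] assms by simp
  also have "{c. c dvd n} = {c. c dvd n \<and> V < c} \<union> {c. c dvd n \<and> c \<le> V}" by auto
  also have "(\<Sum>c\<in>\<dots>. mangoldt c) = mangoldt_gt V n + (\<Sum>c | c dvd n \<and> c \<le> V. mangoldt c)"
    unfolding mangoldt_gt_def using assms by (intro sum.union_disjoint) auto
  finally show ?thesis by simp
qed

lemma mangoldt_gt_nonneg: "mangoldt_gt V n \<ge> 0"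
  by (auto simp: mangoldt_gt_def intro!: sum_nonneg mangoldt_nonneg)

lemma mangoldt_gt_le: "n > 0 \<Longrightarrow> mangoldt_gt V n \<le> ln (real n)"
  by (auto simp: mangoldt_split intro!: sum_nonneg mangoldt_nonneg)

lemma mangoldt_gt_eq_0: "n \<le> V \<Longrightarrow> mangoldt_gt V n = 0"
proof (cases "n = 0")
  \<comment> \<open>Every number divides 0, so the index set is infinite and the sum takes its
    default value 0.\<close>
  case True
  then have "{c. c dvd n \<and> V < c} = {V<..}" by auto
  then show ?thesis by (simp add: mangoldt_gt_def infinite_Ioi)
next
  case False
  moreover assume "n \<le> V"
  ultimately have "{c. c dvd n \<and> V < c} = {}" by (auto dest: dvd_imp_le)
  then show ?thesis unfolding mangoldt_gt_def by (simp only: sum.empty)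
qed

lemma mangoldt_le_ln: "n > 0 \<Longrightarrow> mangoldt n \<le> ln (real n)"
proof -
  assume n: "n > 0"
  have "mangoldt n \<le> (\<Sum>c | c dvd n. mangoldt c :: real)"
    using n by (intro member_le_sum) (auto intro: mangoldt_nonneg)
  then show ?thesis using mangoldt_sum[of n, where 'a = real] n by simp
qed

text \<open>Associativity of Dirichlet convolution: the Moebius function cancels the constant 1
  inside \<open>mangoldt_gt\<close>, after an exchange of the two divisors.\<close>

lemma moebius_inversion_mangoldt:
  assumes "l > 0"
  shows "(\<Sum>d | d dvd l. real_of_int (moeb d) * mangoldt_gt V (l div d)) = (if V < l then mangoldt l else 0)"
proof -
  have dvd_iff: "d dvd l \<and> c dvd l div d \<longleftrightarrow> c * d dvd l" for c d
    using assms by (cases "d = 0") (auto simp: dvd_div_iff_mult dest: dvd_mult_right)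
  have fin: "finite {c. c dvd l div d}" if "d dvd l" for d
    using assms that by (intro finite_divisors_nat) (auto simp: dvd_div_eq_0_iff)
  have swap: "c dvd l \<and> d dvd l div c" if "d dvd l" "c dvd l div d" for c d
    using dvd_iff[of d c] dvd_iff[of c d] that by (metis mult.commute)
  have "(\<Sum>d | d dvd l. real_of_int (moeb d) * mangoldt_gt V (l div d)) =
      (\<Sum>d | d dvd l. \<Sum>c | c dvd l div d \<and> V < c. real_of_int (moeb d) * mangoldt c)"
    by (simp add: mangoldt_gt_def sum_distrib_left)
  also have "\<dots> = (\<Sum>(d, c)\<in>(SIGMA d:{d. d dvd l}. {c. c dvd l div d \<and> V < c}). real_of_int (moeb d) * mangoldt c)"
    using assms fin by (intro sum.Sigma) auto
  also have "\<dots> = (\<Sum>(c, d)\<in>(SIGMA c:{c. c dvd l \<and> V < c}. {d. d dvd l div c}). real_of_int (moeb d) * mangoldt c)"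
    by (intro sum.reindex_bij_witness[of _ "\<lambda>(c, d). (d, c)" "\<lambda>(d, c). (c, d)"])
       (auto dest: swap)
  also have "\<dots> = (\<Sum>c | c dvd l \<and> V < c. \<Sum>d | d dvd l div c. real_of_int (moeb d) * mangoldt c)"
    using assms fin by (intro sum.Sigma[symmetric]) auto
  also have "\<dots> = (\<Sum>c | c dvd l \<and> V < c. mangoldt c * (if c = l then 1 else 0))"
  proof (rule sum.cong[OF refl])
    fix c assume c: "c \<in> {c. c dvd l \<and> V < c}"
    then have "c > 0" "l div c > 0" using assms by (auto elim!: dvdE intro!: Nat.gr0I)
    have "(\<Sum>d | d dvd l div c. real_of_int (moeb d) * mangoldt c) = mangoldt c * of_int (\<Sum>d | d dvd l div c. moeb d)"
      by (simp add: sum_distrib_left mult.commute)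
    also have "\<dots> = mangoldt c * (if c = l then 1 else 0)"
      using c \<open>c > 0\<close> \<open>l div c > 0\<close> by (subst sum_moeb_dvd) (auto elim!: dvdE)
    finally show "(\<Sum>d | d dvd l div c. real_of_int (moeb d) * mangoldt c) = mangoldt c * (if c = l then 1 else 0)" .
  qed
  also have "\<dots> = (if V < l then mangoldt l else 0)"
  proof -
    have "(\<Sum>c | c dvd l \<and> V < c. mangoldt c * (if c = l then 1 else 0)) =
        (\<Sum>c | c dvd l \<and> V < c. if c = l then mangoldt c else 0 :: real)"
      by (intro sum.cong) auto
    also have "\<dots> = (if V < l then mangoldt l else 0)"
      using assms by (subst sum.delta) auto
    finally show ?thesis .
  qed
  finally show ?thesis .
qed

text \<open>Beyond \<open>V\<close> the von Mangoldt function is the convolution of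
  \<open>moeb\<close> with \<open>mangoldt_gt V\<close>. For \<open>m \<le> U\<close> the factor
  \<open>mangoldt_gt V\<close> is rewritten as the logarithm minus a short divisor sum, which leaves
  a long smooth inner variable; in the remaining sum both \<open>m > U\<close> and effectively
  \<open>n > V\<close>.\<close>

lemma vaughan_identity:
  fixes f :: "nat \<Rightarrow> complex"
  assumes "U \<le> y"
  shows "(\<Sum>l=1..y. of_real (mangoldt l) * f l) =
      (\<Sum>l | l \<in> {1..y} \<and> l \<le> V. of_real (mangoldt l) * f l)
    + (\<Sum>m=1..U. of_int (moeb m) * (\<Sum>n=1..y div m. of_real (ln (real n)) * f (m * n)))
    - (\<Sum>m=1..U. of_int (moeb m) * (\<Sum>n=1..y div m. of_real (\<Sum>c | c dvd n \<and> c \<le> V. mangoldt c) * f (m * n)))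
    + (\<Sum>m=U+1..y. of_int (moeb m) * (\<Sum>n=1..y div m. of_real (mangoldt_gt V n) * f (m * n)))"
proof -
  define G where "G = (\<lambda>m. of_int (moeb m) * (\<Sum>n=1..y div m. of_real (mangoldt_gt V n) * f (m * n)) :: complex)"
  have "(\<Sum>m=1..y. G m) = (\<Sum>m=1..y. \<Sum>n=1..y div m. of_real (of_int (moeb m) * mangoldt_gt V n) * f (m * n))"
    by (simp add: G_def sum_distrib_left mult.assoc)
  also have "\<dots> = (\<Sum>l=1..y. \<Sum>d | d dvd l. of_real (of_int (moeb d) * mangoldt_gt V (l div d)) * f (d * (l div d)))"
    by (rule sum_multiples_swap)
  also have "\<dots> = (\<Sum>l=1..y. of_real (\<Sum>d | d dvd l. of_int (moeb d) * mangoldt_gt V (l div d)) * f l)"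
    unfolding of_real_sum sum_distrib_right by (intro sum.cong refl) auto
  also have "\<dots> = (\<Sum>l=1..y. of_real (if V < l then mangoldt l else 0) * f l)"
    by (intro sum.cong refl, subst moebius_inversion_mangoldt) auto
  finally have 1: "(\<Sum>m=1..y. G m) = (\<Sum>l=1..y. of_real (if V < l then mangoldt l else 0) * f l)" .
  have "(\<Sum>l=1..y. of_real (mangoldt l) * f l) = (\<Sum>l=1..y. (if l \<le> V then of_real (mangoldt l) * f l else 0)
       + of_real (if V < l then mangoldt l else 0) * f l)"
    by (intro sum.cong) auto
  also have "\<dots> = (\<Sum>l | l \<in> {1..y} \<and> l \<le> V. of_real (mangoldt l) * f l) + (\<Sum>m=1..y. G m)"
    by (simp only: sum.distrib 1 sum.inter_filter[OF finite_atLeastAtMost])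
  also have "(\<Sum>m=1..y. G m) = (\<Sum>m=1..U. G m) + (\<Sum>m=U+1..y. G m)"
  proof -
    have "{1..y} = {1..U} \<union> {U+1..y}" using assms by auto
    then show ?thesis by (simp only:) (rule sum.union_disjoint; auto)
  qed
  also have "(\<Sum>m=1..U. G m) = (\<Sum>m=1..U. of_int (moeb m) * (\<Sum>n=1..y div m. of_real (ln (real n)) * f (m * n)))
    - (\<Sum>m=1..U. of_int (moeb m) * (\<Sum>n=1..y div m. of_real (\<Sum>c | c dvd n \<and> c \<le> V. mangoldt c) * f (m * n)))"
  proof -
    have "G m = of_int (moeb m) * (\<Sum>n=1..y div m. of_real (ln (real n)) * f (m * n))
      - of_int (moeb m) * (\<Sum>n=1..y div m. of_real (\<Sum>c | c dvd n \<and> c \<le> V. mangoldt c) * f (m * n))" for m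
    proof -
      have "of_real (mangoldt_gt V n) * f (m * n) = of_real (ln (real n)) * f (m * n)
          - of_real (\<Sum>c | c dvd n \<and> c \<le> V. mangoldt c) * f (m * n)" if "n \<in> {1..y div m}" for n
      proof -
        have "n > 0" using that by auto
        then show ?thesis by (subst mangoldt_split) (simp_all only: of_real_diff left_diff_distrib)
      qed
      then have "(\<Sum>n=1..y div m. of_real (mangoldt_gt V n) * f (m * n)) =
          (\<Sum>n=1..y div m. of_real (ln (real n)) * f (m * n)
            - of_real (\<Sum>c | c dvd n \<and> c \<le> V. mangoldt c) * f (m * n))"
        by (rule sum.cong[OF refl])
      then show ?thesis
        unfolding G_def by (simp only: sum_subtractf right_diff_distrib)
    qed
    then show ?thesis by (simp only: sum_subtractf)
  qed
  finally show ?thesis by (simp add: G_def)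
qed

section \<open>Exponential sums over primes\<close>

lemma harm_le_ln: "n \<ge> 1 \<Longrightarrow> harm n \<le> 1 + ln (real n)"
proof -
  assume "n \<ge> 1"
  then obtain m where m: "n = Suc m" by (cases n) auto
  have "harm (Suc m) - ln (real (Suc m)) \<le> harm (Suc 0) - ln (real (Suc 0))"
    using decseqD[OF decseq_harm_diff_ln, of 0 m] by simp
  then show ?thesis by (simp add: m harm_expand)
qed

section \<open>Partial summation\<close>

lemma abel_norm_le:
  fixes a :: "nat \<Rightarrow> complex" and w :: "nat \<Rightarrow> real"
  assumes "\<And>j. j \<le> Suc k \<Longrightarrow> norm (\<Sum>i<j. a i) \<le> B"
  shows "norm (\<Sum>i<Suc k. of_real (w i) * a i) \<le> B * (\<bar>w k\<bar> + (\<Sum>i<k. \<bar>w i - w (Suc i)\<bar>))"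
proof -
  define A where "A = (\<lambda>j. \<Sum>i<j. a i)"
  have eq: "(\<Sum>i<Suc k. of_real (w i) * a i) = of_real (w k) * A (Suc k) + (\<Sum>i<k. of_real (w i - w (Suc i)) * A (Suc i))" for k
    by (induction k) (simp_all add: A_def algebra_simps)
  have "norm (\<Sum>i<Suc k. of_real (w i) * a i) \<le> \<bar>w k\<bar> * norm (A (Suc k)) + (\<Sum>i<k. \<bar>w i - w (Suc i)\<bar> * norm (A (Suc i)))"
    unfolding eq by (intro order.trans[OF norm_triangle_ineq] add_mono order.trans[OF norm_sum] sum_mono)
      (simp_all only: norm_mult norm_of_real order.refl)
  also have "\<dots> \<le> \<bar>w k\<bar> * B + (\<Sum>i<k. \<bar>w i - w (Suc i)\<bar> * B)"
    unfolding A_def by (intro add_mono sum_mono mult_left_mono assms) auto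
  also have "\<dots> = B * (\<bar>w k\<bar> + (\<Sum>i<k. \<bar>w i - w (Suc i)\<bar>))"
    by (simp add: sum_distrib_left distrib_left mult.commute)
  finally show ?thesis .
qed

lemma abel_norm_le_increasing:
  fixes a :: "nat \<Rightarrow> complex" and w :: "nat \<Rightarrow> real"
  assumes "\<And>j. j \<le> k \<Longrightarrow> norm (\<Sum>i<j. a i) \<le> B" "\<And>i. i < k \<Longrightarrow> 0 \<le> w i" "\<And>i. w i \<le> w (Suc i)"
    "\<And>i. i < k \<Longrightarrow> w i \<le> W" "0 \<le> W"
  shows "norm (\<Sum>i<k. of_real (w i) * a i) \<le> 2 * W * B"
proof (cases k)
  case 0
  then show ?thesis using assms(1)[of 0] assms(5) by simp
next
  case (Suc l)
  have B: "B \<ge> 0" using assms(1)[of 0] by simp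
  have "(\<Sum>i<l. \<bar>w i - w (Suc i)\<bar>) = (\<Sum>i<l. w (Suc i) - w i)"
    by (intro sum.cong refl) (use assms(3) in \<open>simp add: abs_if not_less order.antisym\<close>)
  also have "\<dots> = w l - w 0" by (rule sum_lessThan_telescope)
  finally have "norm (\<Sum>i<Suc l. of_real (w i) * a i) \<le> B * (\<bar>w l\<bar> + (w l - w 0))"
    using abel_norm_le[of l a B w] assms(1) Suc by simp
  also have "\<dots> \<le> B * (2 * W)"
    using assms(2)[of l] assms(2)[of 0] assms(4)[of l] Suc B by (intro mult_left_mono) auto
  finally show ?thesis using Suc by (simp add: mult_ac)
qed

lemma abel_norm_le_decreasing:
  fixes a :: "nat \<Rightarrow> complex" and w :: "nat \<Rightarrow> real"
  assumes "\<And>j. j \<le> k \<Longrightarrow> norm (\<Sum>i<j. a i) \<le> B" "\<And>i. 0 \<le> w i" "\<And>i. w (Suc i) \<le> w i"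
  shows "norm (\<Sum>i<k. of_real (w i) * a i) \<le> w 0 * B"
proof (cases k)
  case 0
  then show ?thesis using assms(1)[of 0] assms(2)[of 0] by simp
next
  case (Suc l)
  have "(\<Sum>i<l. \<bar>w i - w (Suc i)\<bar>) = (\<Sum>i<l. w i - w (Suc i))"
    by (intro sum.cong refl abs_of_nonneg) (simp add: assms(3))
  also have "\<dots> = w 0 - w l" by (rule sum_lessThan_telescope')
  finally have "norm (\<Sum>i<Suc l. of_real (w i) * a i) \<le> B * (\<bar>w l\<bar> + (w 0 - w l))"
    using abel_norm_le[of l a B w] assms(1) Suc by simp
  then show ?thesis using Suc assms(2)[of l] by (simp add: mult_ac)
qed

section \<open>Bilinear sums\<close>

context rational_approx
begin

text \<open>Cauchy-Schwarz over \<open>m\<close> removes the coefficients \<open>A\<close>. After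
  the square is opened, the sum over \<open>m\<close> is geometric with frequency
  \<open>(n1 - n2) * \<beta>\<close>, and for fixed \<open>n1\<close> these differences are
  consecutive integers, so \<open>kern_interval\<close> applies.\<close>

lemma type_II_dyadic:
  fixes A b :: "nat \<Rightarrow> complex" and M y :: nat
  defines "Z \<equiv> y div M"
  assumes A: "\<And>m. norm (A m) \<le> 1" and b: "\<And>n. n \<in> {1..Z} \<Longrightarrow> norm (b n) \<le> B" and "B \<ge> 0" "M \<ge> 1"
  shows "(norm (\<Sum>m\<in>{M..<2 * M}. A m * (\<Sum>n=1..y div m. b n * ee (real (m * n) * \<beta>))))\<^sup>2 \<le>
     real M * (real Z * (B\<^sup>2 * ((real Z / real r + 1) * (8 * real M + 4 * real r * harm r))))"
proof -
  \<comment> \<open>The condition \<open>m * n \<le> y\<close> moves into the summand, which makes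
    the range of \<open>n\<close> independent of \<open>m\<close>; for fixed \<open>n1\<close> and
    \<open>n2\<close> the surviving \<open>m\<close> still form an interval.\<close>
  define h where "h = (\<lambda>n m. if m * n \<le> y then ee (real (m * n) * \<beta>) else 0)"
  define c where "c = (\<lambda>m. \<Sum>n=1..Z. b n * h n m)"
  have c_eq: "(\<Sum>n=1..y div m. b n * ee (real (m * n) * \<beta>)) = c m" if m: "m \<in> {M..<2 * M}" for m
  proof -
    have "m > 0" using m \<open>M \<ge> 1\<close> by auto
    then have iff: "n \<le> y div m \<longleftrightarrow> m * n \<le> y" for n
      by (simp add: less_eq_div_iff_mult_less_eq mult.commute)
    have "y div m \<le> Z" using m \<open>M \<ge> 1\<close> by (auto simp: Z_def intro: div_le_mono2)
    then have "c m = (\<Sum>n=1..y div m. b n * h n m)"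
      unfolding c_def by (intro sum.mono_neutral_right) (auto simp: h_def iff)
    then show ?thesis by (simp add: h_def iff)
  qed
  have inner: "norm (\<Sum>m\<in>{M..<2 * M}. h n1 m * cnj (h n2 m)) \<le> kern (real M) (dist_int ((real n1 - real n2) * \<beta>))"
    if n: "n1 \<in> {1..Z}" "n2 \<in> {1..Z}" for n1 n2
  proof -
    define K where "K = min (2 * M) (y div (max n1 n2) + 1)"
    have mx: "max n1 n2 > 0" using n by auto
    have iff: "m * n1 \<le> y \<and> m * n2 \<le> y \<longleftrightarrow> m < y div (max n1 n2) + 1" for m
    proof -
      have "m < y div (max n1 n2) + 1 \<longleftrightarrow> m * max n1 n2 \<le> y"
        using mx by (simp add: less_Suc_eq_le less_eq_div_iff_mult_less_eq)
      then show ?thesis by (auto simp: max_def) (meson le_trans mult_le_mono2 nat_le_linear)+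
    qed
    have "h n1 m * cnj (h n2 m) = (if m < y div (max n1 n2) + 1 then ee (real m * ((real n1 - real n2) * \<beta>)) else 0)" for m
    proof -
      have "ee (real (m * n1) * \<beta>) * cnj (ee (real (m * n2) * \<beta>)) = ee (real m * ((real n1 - real n2) * \<beta>))"
        unfolding ee_minus[symmetric] ee_add[symmetric] by (simp add: algebra_simps)
      then show ?thesis unfolding h_def iff[symmetric] by auto
    qed
    then have "(\<Sum>m\<in>{M..<2 * M}. h n1 m * cnj (h n2 m)) = (\<Sum>m\<in>{M..<2 * M}. if m < y div (max n1 n2) + 1 then ee (real m * ((real n1 - real n2) * \<beta>)) else 0)"
      by (simp only:)
    also have "\<dots> = (\<Sum>m | m \<in> {M..<2 * M} \<and> m < y div (max n1 n2) + 1. ee (real m * ((real n1 - real n2) * \<beta>)))"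
      by (rule sum.inter_filter[symmetric]) auto
    also have "{m. m \<in> {M..<2 * M} \<and> m < y div (max n1 n2) + 1} = {M..<K}"
      by (auto simp: K_def)
    finally show ?thesis
      by (simp only:) (rule norm_geometric_interval_kern, simp add: K_def)
  qed
  have row: "(\<Sum>n2=1..Z. kern (real M) (dist_int ((real n1 - real n2) * \<beta>))) \<le>
      (real Z / real r + 1) * (8 * real M + 4 * real r * harm r)" for n1
  proof -
    have "(\<Sum>n2=1..Z. kern (real M) (dist_int ((real n1 - real n2) * \<beta>))) =
        (\<Sum>j<Z. kern (real M) (dist_int (of_int ((1 - int n1) + int j) * \<beta>)))"
    proof (rule sum.reindex_bij_witness[of _ Suc "\<lambda>n. n - 1"], goal_cases)
      case (5 n)
      then have "of_int ((1 - int n1) + int (n - 1)) * \<beta> = - ((real n1 - real n) * \<beta>)"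
        by (auto simp: of_nat_diff algebra_simps)
      then show ?case by (simp only: dist_int_minus)
    qed auto
    also have "\<dots> \<le> (real Z / real r + 1) * (8 * real M + 4 * real r * harm r)"
      by (rule kern_interval) simp
    finally show ?thesis .
  qed
  have "complex_of_real (\<Sum>m\<in>{M..<2 * M}. (norm (c m))\<^sup>2) = (\<Sum>m\<in>{M..<2 * M}. c m * cnj (c m))"
    unfolding of_real_sum by (intro sum.cong refl) (rule complex_norm_square)
  also have "\<dots> = (\<Sum>m\<in>{M..<2 * M}. \<Sum>n1=1..Z. \<Sum>n2=1..Z. b n1 * cnj (b n2) * (h n1 m * cnj (h n2 m)))"
    unfolding c_def cnj_sum sum_product by (intro sum.cong refl) (simp add: mult_ac)
  also have "\<dots> = (\<Sum>n1=1..Z. \<Sum>m\<in>{M..<2 * M}. \<Sum>n2=1..Z. b n1 * cnj (b n2) * (h n1 m * cnj (h n2 m)))"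
    by (rule sum.swap)
  also have "\<dots> = (\<Sum>n1=1..Z. \<Sum>n2=1..Z. \<Sum>m\<in>{M..<2 * M}. b n1 * cnj (b n2) * (h n1 m * cnj (h n2 m)))"
    by (intro sum.cong refl sum.swap)
  also have "\<dots> = (\<Sum>n1=1..Z. \<Sum>n2=1..Z. b n1 * cnj (b n2) * (\<Sum>m\<in>{M..<2 * M}. h n1 m * cnj (h n2 m)))"
    by (simp only: sum_distrib_left)
  finally have "norm (complex_of_real (\<Sum>m\<in>{M..<2 * M}. (norm (c m))\<^sup>2)) =
      norm (\<Sum>n1=1..Z. \<Sum>n2=1..Z. b n1 * cnj (b n2) * (\<Sum>m\<in>{M..<2 * M}. h n1 m * cnj (h n2 m)))"
    by (rule arg_cong)
  also have "\<dots> \<le> (\<Sum>n1=1..Z. \<Sum>n2=1..Z. B\<^sup>2 * kern (real M) (dist_int ((real n1 - real n2) * \<beta>)))"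
  proof (intro order.trans[OF norm_sum] sum_mono)
    fix n1 n2 assume n: "n1 \<in> {1..Z}" "n2 \<in> {1..Z}"
    show "norm (b n1 * cnj (b n2) * (\<Sum>m\<in>{M..<2 * M}. h n1 m * cnj (h n2 m))) \<le>
        B\<^sup>2 * kern (real M) (dist_int ((real n1 - real n2) * \<beta>))"
      unfolding norm_mult complex_mod_cnj power2_eq_square
      using b[OF n(1)] b[OF n(2)] inner[OF n] \<open>B \<ge> 0\<close> by (intro mult_mono) auto
  qed
  also have "\<dots> = (\<Sum>n1=1..Z. B\<^sup>2 * (\<Sum>n2=1..Z. kern (real M) (dist_int ((real n1 - real n2) * \<beta>))))"
    by (simp only: sum_distrib_left)
  also have "\<dots> \<le> (\<Sum>n1=1..Z. B\<^sup>2 * ((real Z / real r + 1) * (8 * real M + 4 * real r * harm r)))"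
    by (intro sum_mono mult_left_mono row) auto
  also have "\<dots> = real Z * (B\<^sup>2 * ((real Z / real r + 1) * (8 * real M + 4 * real r * harm r)))"
    by simp
  finally have sq: "(\<Sum>m\<in>{M..<2 * M}. (norm (c m))\<^sup>2) \<le>
      real Z * (B\<^sup>2 * ((real Z / real r + 1) * (8 * real M + 4 * real r * harm r)))"
    unfolding norm_of_real by linarith
  have "norm (\<Sum>m\<in>{M..<2 * M}. A m * (\<Sum>n=1..y div m. b n * ee (real (m * n) * \<beta>))) \<le> (\<Sum>m\<in>{M..<2 * M}. norm (c m))"
  proof (intro order.trans[OF norm_sum] sum_mono)
    fix m assume m: "m \<in> {M..<2 * M}"
    show "norm (A m * (\<Sum>n=1..y div m. b n * ee (real (m * n) * \<beta>))) \<le> norm (c m)"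
      unfolding c_eq[OF m] norm_mult using mult_right_mono[OF A, of "norm (c m)" m] by simp
  qed
  then have "(norm (\<Sum>m\<in>{M..<2 * M}. A m * (\<Sum>n=1..y div m. b n * ee (real (m * n) * \<beta>))))\<^sup>2 \<le> (\<Sum>m\<in>{M..<2 * M}. norm (c m))\<^sup>2"
    by (intro power_mono) auto
  also have "\<dots> \<le> (\<Sum>m\<in>{M..<2 * M}. (norm (c m))\<^sup>2) * real M"
    using sum_squared_le_sum_of_squares[of "\<lambda>m. norm (c m)" "{M..<2 * M}"] by simp
  also have "\<dots> \<le> (real Z * (B\<^sup>2 * ((real Z / real r + 1) * (8 * real M + 4 * real r * harm r)))) * real M"
    using sq by (intro mult_right_mono) auto
  finally show ?thesis by (simp only: mult.commute)
qed

lemma log_weighted_sum: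
  assumes "k \<ge> 1" "real k \<le> X" "ln (real k) \<le> W"
  shows "norm (\<Sum>n=1..k. of_real (ln (real n)) * ee (real n * t)) \<le> 2 * W * kern X (dist_int t)"
proof -
  have "(\<Sum>n=1..k. of_real (ln (real n)) * ee (real n * t)) = (\<Sum>i<k. of_real (ln (real (Suc i))) * ee (real (Suc i) * t))"
    by (rule sum.reindex_bij_witness[of _ Suc "\<lambda>n. n - 1"]) auto
  also have "norm \<dots> \<le> 2 * W * kern X (dist_int t)"
  proof (rule abel_norm_le_increasing)
    fix j assume j: "j \<le> k"
    have "(\<Sum>i<j. ee (real (Suc i) * t)) = (\<Sum>n\<in>{1..<Suc j}. ee (real n * t))"
      by (rule sum.reindex_bij_witness[of _ "\<lambda>n. n - 1" Suc]) auto
    then show "norm (\<Sum>i<j. ee (real (Suc i) * t)) \<le> kern X (dist_int t)"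
      using j assms by (simp only:) (rule norm_geometric_interval_kern, simp)
  next
    show "ln (real (Suc i)) \<le> W" if "i < k" for i
    proof -
      have "ln (real (Suc i)) \<le> ln (real k)" using that by (subst ln_le_cancel_iff) auto
      with assms(3) show ?thesis by simp
    qed
    have "ln (real k) \<ge> 0" using assms(1) by simp
    then show "0 \<le> W" using assms by linarith
  qed auto
  finally show ?thesis .
qed

end

lemma log2_bound:
  fixes x :: nat
  assumes x: "x \<ge> 2"
  obtains K where "x < 2 ^ K" "real K \<le> 2 * (1 + ln (real x))"
proof
  define K where "K = floorlog 2 x"
  have b: "2 ^ (K - 1) \<le> x" "x < 2 ^ K" using floorlog_bounds[of x 2] x by (auto simp: K_def)
  show "x < 2 ^ K" by (rule b)
  have "real (K - 1) * ln 2 = ln (real (2 ^ (K - 1)))" by (simp add: ln_realpow)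
  also have "\<dots> \<le> ln (real x)" using b(1) x by (subst ln_le_cancel_iff) (auto simp flip: of_nat_le_iff)
  finally have 1: "real (K - 1) * ln 2 \<le> ln (real x)" .
  have "real (K - 1) * (2 / 3) \<le> real (K - 1) * ln 2" using ln2_ge_two_thirds by (intro mult_left_mono) auto
  with 1 have "real (K - 1) \<le> 3 / 2 * ln (real x)" by simp
  moreover have "real K \<le> real (K - 1) + 1" by linarith
  moreover have "ln (real x) \<ge> 0" using x by simp
  ultimately show "real K \<le> 2 * (1 + ln (real x))" by simp
qed

lemma sum_dyadic:
  fixes f :: "nat \<Rightarrow> complex"
  shows "(\<Sum>m\<in>{w..<w * 2 ^ K}. f m) = (\<Sum>k<K. \<Sum>m\<in>{w * 2 ^ k..<2 * (w * 2 ^ k)}. f m)"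
proof (induction K)
  case (Suc K)
  have "(\<Sum>m\<in>{w..<w * 2 ^ Suc K}. f m) = (\<Sum>m\<in>{w..<w * 2 ^ K}. f m) + (\<Sum>m\<in>{w * 2 ^ K..<w * 2 ^ Suc K}. f m)"
    by (rule sum.atLeastLessThan_concat[symmetric]) auto
  then show ?case using Suc by (simp add: mult_ac)
qed auto

section \<open>The parts of Vaughan's identity, uniformly in the truncation
  \<open>y \<le> x\<close>\<close>

context rational_approx
begin

context
  fixes x y :: nat and H :: real
  assumes x: "x \<ge> 2" and rx: "r \<le> x" and yx: "y \<le> x"
  defines "H \<equiv> 1 + ln (real x)"
begin

lemma H_ge: "H \<ge> 1"
  using x by (simp add: H_def)

lemma ln_le_H: "0 < n \<Longrightarrow> n \<le> x \<Longrightarrow> ln (real n) \<le> H" for n :: nat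
proof -
  assume "0 < n" "n \<le> x"
  then have "ln (real n) \<le> ln (real x)" by (subst ln_le_cancel_iff) auto
  then show ?thesis by (simp add: H_def)
qed

lemma harm_le_H: "1 \<le> n \<Longrightarrow> n \<le> x \<Longrightarrow> harm n \<le> H"
proof -
  assume "1 \<le> n" "n \<le> x"
  then have "ln (real n) \<le> ln (real x)" by (subst ln_le_cancel_iff) auto
  then show ?thesis using harm_le_ln[OF \<open>1 \<le> n\<close>] by (simp add: H_def)
qed

lemma real_div_le: "m \<ge> 1 \<Longrightarrow> real (y div m) \<le> real x / real m"
proof -
  assume "m \<ge> 1"
  have "real (y div m) \<le> real y / real m" by (rule of_nat_div_le_of_nat)
  also have "\<dots> \<le> real x / real m" using yx by (intro divide_right_mono) auto
  finally show ?thesis .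
qed

lemma type_I_log_bound:
  assumes "U + 1 \<le> x"
  shows "norm (\<Sum>m=1..U. of_int (moeb m) * (\<Sum>n=1..y div m. of_real (ln (real n)) * ee (real (m * n) * \<beta>)))
    \<le> 88 * H\<^sup>2 * (real x / real r + real U + real r)"
proof -
  have "norm (\<Sum>m=1..U. of_int (moeb m) * (\<Sum>n=1..y div m. of_real (ln (real n)) * ee (real (m * n) * \<beta>)))
    \<le> (\<Sum>m=1..U. 2 * H * kern (real x / real m) (dist_int (real m * \<beta>)))"
  proof (intro order.trans[OF norm_sum] sum_mono)
    fix m assume m: "m \<in> {1..U}"
    let ?S = "\<Sum>n=1..y div m. of_real (ln (real n)) * ee (real (m * n) * \<beta>)"
    have "norm (of_int (moeb m) * ?S) \<le> 1 * norm ?S"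
      unfolding norm_mult norm_of_int using abs_moeb_le[of m] by (intro mult_right_mono norm_ge_zero) linarith
    also have "norm ?S \<le> 2 * H * kern (real x / real m) (dist_int (real m * \<beta>))"
    proof (cases "y div m = 0")
      case True
      then show ?thesis using H_ge by (auto intro!: mult_nonneg_nonneg kern_nonneg)
    next
      case False
      have "?S = (\<Sum>n=1..y div m. of_real (ln (real n)) * ee (real n * (real m * \<beta>)))"
        by (intro sum.cong refl) (simp add: mult_ac)
      also have "norm \<dots> \<le> 2 * H * kern (real x / real m) (dist_int (real m * \<beta>))"
      proof (rule log_weighted_sum)
        show "1 \<le> y div m" using False by simp
        show "real (y div m) \<le> real x / real m" using m by (intro real_div_le) auto
        have "y div m \<le> x" using yx by (meson div_le_dividend order_trans)
        then show "ln (real (y div m)) \<le> H" using ln_le_H[of "y div m"] False by simp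
      qed
      finally show ?thesis .
    qed
    finally show "norm (of_int (moeb m) * ?S) \<le> 2 * H * kern (real x / real m) (dist_int (real m * \<beta>))" by simp
  qed
  also have "\<dots> = 2 * H * (\<Sum>m=1..U. kern (real x / real m) (dist_int (real m * \<beta>)))"
    by (simp add: sum_distrib_left)
  also have "\<dots> \<le> 2 * H * (44 * H * (real x / real r + real U + real r))"
    using H_ge assms rx r_pos by (intro mult_left_mono kern_type_I harm_le_H) auto
  finally show ?thesis by (simp add: power2_eq_square mult_ac)
qed

text \<open>Opening the divisor sum as \<open>n = c * k\<close> leaves a geometric sum over
  \<open>k\<close> with frequency \<open>m * c * \<beta>\<close>.\<close>

lemma type_I_inner:
  assumes "m \<ge> 1"
  shows "norm (\<Sum>n=1..y div m. of_real (\<Sum>c | c dvd n \<and> c \<le> V. mangoldt c) * ee (real (m * n) * \<beta>))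
     \<le> (\<Sum>c=1..V. mangoldt c * kern (real x / real (m * c)) (dist_int (real (m * c) * \<beta>)))"
proof -
  define Y where "Y = y div m"
  \<comment> \<open>\<open>L\<close> vanishes beyond \<open>V\<close>, so that the sum over all
    divisors can be regrouped before the restriction is restored.\<close>
  define L where "L = (\<lambda>c. if c \<le> V then mangoldt c else 0 :: real)"
  define F where "F = (\<lambda>c k. of_real (L c) * ee (real (m * (c * k)) * \<beta>))"
  have "(\<Sum>n=1..Y. of_real (\<Sum>c | c dvd n \<and> c \<le> V. mangoldt c) * ee (real (m * n) * \<beta>)) =
      (\<Sum>n=1..Y. \<Sum>c | c dvd n. F c (n div c))"
  proof (intro sum.cong refl)
    fix n assume n: "n \<in> {1..Y}"
    have "(\<Sum>c | c dvd n. F c (n div c)) = of_real (\<Sum>c | c dvd n. L c) * ee (real (m * n) * \<beta>)"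
      unfolding of_real_sum sum_distrib_right by (intro sum.cong refl) (simp add: F_def del: of_nat_mult)
    also have "(\<Sum>c | c dvd n. L c) = (\<Sum>c | c \<in> {c. c dvd n} \<and> c \<le> V. mangoldt c)"
      unfolding L_def using n by (intro sum.inter_filter[symmetric]) auto
    finally show "of_real (\<Sum>c | c dvd n \<and> c \<le> V. mangoldt c) * ee (real (m * n) * \<beta>) = (\<Sum>c | c dvd n. F c (n div c))"
      by simp
  qed
  also have "\<dots> = (\<Sum>c=1..Y. \<Sum>k=1..Y div c. F c k)"
    by (rule sum_multiples_swap[symmetric])
  finally have "norm (\<Sum>n=1..Y. of_real (\<Sum>c | c dvd n \<and> c \<le> V. mangoldt c) * ee (real (m * n) * \<beta>)) =
     norm (\<Sum>c=1..Y. \<Sum>k=1..Y div c. F c k)" by (rule arg_cong)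
  also have "\<dots> \<le> (\<Sum>c=1..Y. if c \<le> V then mangoldt c * kern (real x / real (m * c)) (dist_int (real (m * c) * \<beta>)) else 0)"
  proof (rule order.trans[OF norm_sum], rule sum_mono)
    fix c assume c: "c \<in> {1..Y}"
    have "(\<Sum>k=1..Y div c. F c k) = of_real (L c) * (\<Sum>k\<in>{1..<Suc (Y div c)}. ee (real k * (real (m * c) * \<beta>)))"
      unfolding F_def sum_distrib_left by (intro sum.cong) (auto simp: mult_ac)
    then have "norm (\<Sum>k=1..Y div c. F c k) = \<bar>L c\<bar> * norm (\<Sum>k\<in>{1..<Suc (Y div c)}. ee (real k * (real (m * c) * \<beta>)))"
      by (simp only: norm_mult norm_of_real)
    also have "\<dots> \<le> \<bar>L c\<bar> * kern (real x / real (m * c)) (dist_int (real (m * c) * \<beta>))"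
    proof (intro mult_left_mono norm_geometric_interval_kern)
      have "Y div c = y div (m * c)" by (simp add: Y_def div_mult2_eq)
      then show "real (Suc (Y div c) - 1) \<le> real x / real (m * c)"
        using real_div_le[of "m * c"] assms c by (simp del: of_nat_mult)
    qed auto
    also have "\<dots> = (if c \<le> V then mangoldt c * kern (real x / real (m * c)) (dist_int (real (m * c) * \<beta>)) else 0)"
      using mangoldt_nonneg[of c] by (simp add: L_def)
    finally show "norm (\<Sum>k=1..Y div c. F c k) \<le>
      (if c \<le> V then mangoldt c * kern (real x / real (m * c)) (dist_int (real (m * c) * \<beta>)) else 0)" .
  qed
  also have "\<dots> = (\<Sum>c | c \<in> {1..Y} \<and> c \<le> V. mangoldt c * kern (real x / real (m * c)) (dist_int (real (m * c) * \<beta>)))"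
    by (rule sum.inter_filter[symmetric]) auto
  also have "\<dots> \<le> (\<Sum>c=1..V. mangoldt c * kern (real x / real (m * c)) (dist_int (real (m * c) * \<beta>)))"
    by (intro sum_mono2) (auto intro!: mult_nonneg_nonneg mangoldt_nonneg kern_nonneg)
  finally show ?thesis by (simp add: Y_def)
qed

text \<open>The pairs \<open>(m, c)\<close> are collected by their product \<open>l\<close>. All
  pairs with the same \<open>l\<close> together carry at most the sum of \<open>mangoldt c\<close>
  over \<open>c dvd l\<close>, which is \<open>ln l\<close>; the double sum thus costs one logarithm
  more than a single sum.\<close>

lemma type_I_bound:
  assumes "U * V + 1 \<le> x"
  shows "norm (\<Sum>m=1..U. of_int (moeb m) * (\<Sum>n=1..y div m. of_real (\<Sum>c | c dvd n \<and> c \<le> V. mangoldt c) * ee (real (m * n) * \<beta>)))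
    \<le> 44 * H\<^sup>2 * (real x / real r + real (U * V) + real r)"
proof -
  define G where "G = (\<lambda>(l, c). mangoldt c * kern (real x / real l) (dist_int (real l * \<beta>)))"
  have G0: "G z \<ge> 0" for z by (cases z) (auto simp: G_def intro!: mult_nonneg_nonneg mangoldt_nonneg kern_nonneg)
  have "norm (\<Sum>m=1..U. of_int (moeb m) * (\<Sum>n=1..y div m. of_real (\<Sum>c | c dvd n \<and> c \<le> V. mangoldt c) * ee (real (m * n) * \<beta>)))
    \<le> (\<Sum>m=1..U. \<Sum>c=1..V. G (m * c, c))"
  proof (intro order.trans[OF norm_sum] sum_mono)
    fix m assume m: "m \<in> {1..U}"
    let ?S = "(\<Sum>n=1..y div m. of_real (\<Sum>c | c dvd n \<and> c \<le> V. mangoldt c) * ee (real (m * n) * \<beta>))"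
    have "norm (of_int (moeb m) * ?S) \<le> 1 * norm ?S"
      unfolding norm_mult norm_of_int using abs_moeb_le[of m] by (intro mult_right_mono norm_ge_zero) linarith
    also have "norm ?S \<le> (\<Sum>c=1..V. G (m * c, c))"
      using type_I_inner[of m V] m by (simp add: G_def)
    finally show "norm (of_int (moeb m) * ?S) \<le> (\<Sum>c=1..V. G (m * c, c))" by simp
  qed
  also have "\<dots> = (\<Sum>z\<in>{1..U} \<times> {1..V}. G ((\<lambda>(m, c). (m * c, c)) z))"
    by (simp add: sum.cartesian_product case_prod_unfold)
  also have "\<dots> = (\<Sum>z\<in>(\<lambda>(m, c). (m * c, c)) ` ({1..U} \<times> {1..V}). G z)"
    by (subst sum.reindex) (auto simp: inj_on_def)
  also have "\<dots> \<le> (\<Sum>z\<in>(SIGMA l:{1..U * V}. {c. c dvd l}). G z)"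
    by (intro sum_mono2 G0) (auto intro: mult_le_mono)
  also have "\<dots> = (\<Sum>l=1..U * V. \<Sum>c | c dvd l. G (l, c))"
    by (subst sum.Sigma) auto
  also have "\<dots> \<le> (\<Sum>l=1..U * V. H * kern (real x / real l) (dist_int (real l * \<beta>)))"
  proof (rule sum_mono)
    fix l assume l: "l \<in> {1..U * V}"
    have "(\<Sum>c | c dvd l. G (l, c)) = (\<Sum>c | c dvd l. mangoldt c) * kern (real x / real l) (dist_int (real l * \<beta>))"
      by (simp add: G_def sum_distrib_right)
    also have "(\<Sum>c | c dvd l. mangoldt c) = ln (real l)" using l mangoldt_sum[of l, where 'a = real] by simp
    also have "ln (real l) * kern (real x / real l) (dist_int (real l * \<beta>)) \<le> H * kern (real x / real l) (dist_int (real l * \<beta>))"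
      using ln_le_H[of l] l assms by (intro mult_right_mono kern_nonneg) auto
    finally show "(\<Sum>c | c dvd l. G (l, c)) \<le> H * kern (real x / real l) (dist_int (real l * \<beta>))" .
  qed
  also have "\<dots> = H * (\<Sum>l=1..U * V. kern (real x / real l) (dist_int (real l * \<beta>)))"
    by (simp add: sum_distrib_left)
  also have "\<dots> \<le> H * (44 * H * (real x / real r + real (U * V) + real r))"
    using H_ge assms rx r_pos by (intro mult_left_mono kern_type_I harm_le_H) auto
  finally show ?thesis by (simp add: power2_eq_square mult_ac)
qed

text \<open>If \<open>y div M \<le> V\<close>, all coefficients vanish. Otherwise both
  \<open>M\<close> and \<open>y div M\<close> are at least \<open>\<xi>\<close>, and as their
  product is at most \<open>x\<close>, both are at most \<open>x / \<xi>\<close>. The bound goes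
  through \<open>E\<close> with a condition on \<open>E\<^sup>2\<close>, so that no square root of a
  sum has to be handled.\<close>

lemma type_II_single:
  fixes V M :: nat and \<xi> E :: real
  assumes "M \<ge> 1" "real M \<ge> \<xi>" "real V + 1 \<ge> \<xi>" "\<xi> > 0" "E \<ge> 0"
    and E: "E\<^sup>2 \<ge> real x * (real x / real r + real x / \<xi> + real r)"
  shows "norm (\<Sum>m\<in>{M..<2 * M}. of_int (moeb m) * (\<Sum>n=1..y div m. of_real (mangoldt_gt V n) * ee (real (m * n) * \<beta>)))
    \<le> 4 * H\<^sup>2 * E"
proof (cases "y div M \<le> V")
  case True
  have "(\<Sum>m\<in>{M..<2 * M}. of_int (moeb m) * (\<Sum>n=1..y div m. of_real (mangoldt_gt V n) * ee (real (m * n) * \<beta>))) = 0"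
  proof (intro sum.neutral ballI)
    fix m assume m: "m \<in> {M..<2 * M}"
    have "mangoldt_gt V n = 0" if "n \<in> {1..y div m}" for n
    proof -
      have "y div m \<le> y div M" using m assms(1) by (intro div_le_mono2) auto
      then show ?thesis using that True by (intro mangoldt_gt_eq_0) auto
    qed
    then show "of_int (moeb m) * (\<Sum>n=1..y div m. of_real (mangoldt_gt V n) * ee (real (m * n) * \<beta>)) = 0"
      by simp
  qed
  then show ?thesis using \<open>E \<ge> 0\<close> by simp
next
  case False
  define Z where "Z = y div M"
  have Z: "real Z \<ge> \<xi>" using False assms(3) by (simp add: Z_def)
  have MZ: "real M * real Z \<le> real x"
  proof -
    have "M * Z \<le> y" by (simp add: Z_def)
    then show ?thesis using yx by (metis of_nat_le_iff of_nat_mult order_trans)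
  qed
  have Mx: "real M \<le> real x / \<xi>" 
    using mult_left_mono[OF Z, of "real M"] MZ \<open>\<xi> > 0\<close> by (simp add: pos_le_divide_eq)
  have Zx: "real Z \<le> real x / \<xi>"
    using mult_right_mono[OF assms(2), of "real Z"] MZ \<open>\<xi> > 0\<close> by (simp add: pos_le_divide_eq mult.commute)
  have r: "real r > 0" using r_pos by simp
  let ?S = "\<Sum>m\<in>{M..<2 * M}. of_int (moeb m) * (\<Sum>n=1..y div m. of_real (mangoldt_gt V n) * ee (real (m * n) * \<beta>))"
  have "(norm ?S)\<^sup>2 \<le> real M * (real Z * (H\<^sup>2 * ((real Z / real r + 1) * (8 * real M + 4 * real r * harm r))))"
    unfolding Z_def
  proof (rule type_II_dyadic)
    show "norm (of_int (moeb m) :: complex) \<le> 1" for m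
      using abs_moeb_le[of m] by (simp only: norm_of_int)
    show "norm (complex_of_real (mangoldt_gt V n)) \<le> H" if "n \<in> {1..y div M}" for n
    proof -
      have "n \<le> x" using that yx by (meson atLeastAtMost_iff div_le_dividend order_trans)
      moreover have "n > 0" using that by auto
      ultimately show ?thesis
        using mangoldt_gt_le[of n V] mangoldt_gt_nonneg[of V n] ln_le_H[of n] by simp
    qed
  qed (use assms(1) H_ge in auto)
  also have "\<dots> = H\<^sup>2 * ((real M * real Z) * ((real Z / real r + 1) * (8 * real M + 4 * real r * harm r)))"
    by (simp add: mult_ac)
  also have "\<dots> \<le> H\<^sup>2 * (real x * (8 * H * (real x / real r + 2 * (real x / \<xi>) + real r)))"
  proof (rule mult_left_mono[OF mult_mono[OF MZ]])
    have "(real Z / real r + 1) * (8 * real M + 4 * real r * harm r) \<le> (real Z / real r + 1) * (8 * real M + 4 * real r * H)"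
      using rx r_pos harm_le_H by (intro mult_left_mono add_mono order.refl) auto
    also have "\<dots> = 8 * ((real M * real Z) / real r) + 4 * (H * real Z) + 8 * real M + 4 * (H * real r)"
      using r by (simp add: field_simps)
    also have "\<dots> \<le> 8 * (H * (real x / real r)) + 8 * (H * (real x / \<xi>)) + 8 * (H * (real x / \<xi>)) + 8 * (H * real r)"
    proof -
      have "(real M * real Z) / real r \<le> real x / real r" using MZ by (intro divide_right_mono) auto
      also have "\<dots> \<le> H * (real x / real r)" using H_ge mult_right_mono[of 1 H "real x / real r"] by simp
      finally have 1: "(real M * real Z) / real r \<le> H * (real x / real r)" .
      have 2: "H * real Z \<le> H * (real x / \<xi>)" using Zx H_ge by (intro mult_left_mono) auto
      have "real x / \<xi> \<le> H * (real x / \<xi>)" using H_ge mult_right_mono[of 1 H "real x / \<xi>"] \<open>\<xi> > 0\<close> by simp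
      then have 3: "real M \<le> H * (real x / \<xi>)" using Mx by linarith
      have 4: "H * real r \<ge> 0" "H * (real x / \<xi>) \<ge> 0" using H_ge \<open>\<xi> > 0\<close> by auto
      from 1 2 3 4 show ?thesis by linarith
    qed
    also have "\<dots> = 8 * H * (real x / real r + 2 * (real x / \<xi>) + real r)" by (simp add: algebra_simps)
    finally show "(real Z / real r + 1) * (8 * real M + 4 * real r * harm r) \<le> 8 * H * (real x / real r + 2 * (real x / \<xi>) + real r)" .
  qed (use H_ge in \<open>auto intro!: mult_nonneg_nonneg add_nonneg_nonneg harm_nonneg\<close>)
  also have "\<dots> \<le> H\<^sup>2 * (16 * H * E\<^sup>2)"
  proof (intro mult_left_mono)
    have "real x * (8 * H * (real x / real r + 2 * (real x / \<xi>) + real r)) \<le> real x * (16 * H * (real x / real r + real x / \<xi> + real r))"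
    proof (rule mult_left_mono)
      have "8 * H * (real x / real r + 2 * (real x / \<xi>) + real r) \<le> 8 * H * (2 * (real x / real r + real x / \<xi> + real r))"
      proof (rule mult_left_mono)
        have ineq: "a + 2 * b + c \<le> 2 * (a + b + c)" if "a \<ge> 0" "c \<ge> 0" for a b c :: real
          using that by simp
        show "real x / real r + 2 * (real x / \<xi>) + real r \<le> 2 * (real x / real r + real x / \<xi> + real r)"
          by (rule ineq) auto
      qed (use H_ge in auto)
      moreover have "8 * H * (2 * u) = 16 * H * u" for u by simp
      ultimately show "8 * H * (real x / real r + 2 * (real x / \<xi>) + real r) \<le> 16 * H * (real x / real r + real x / \<xi> + real r)"
        by (simp only:)
    qed auto
    also have "\<dots> = 16 * H * (real x * (real x / real r + real x / \<xi> + real r))" by (simp add: mult_ac)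
    also have "\<dots> \<le> 16 * H * E\<^sup>2" using E H_ge by (intro mult_left_mono) auto
    finally show "real x * (8 * H * (real x / real r + 2 * (real x / \<xi>) + real r)) \<le> 16 * H * E\<^sup>2" .
  qed auto
  also have "\<dots> \<le> H\<^sup>2 * (16 * H\<^sup>2 * E\<^sup>2)"
    using H_ge by (intro mult_left_mono mult_right_mono) (auto simp: power2_eq_square)
  also have "\<dots> = (4 * H\<^sup>2 * E)\<^sup>2" by (simp add: power_mult_distrib power2_eq_square)
  finally show ?thesis
    by (rule power2_le_imp_le) (use \<open>E \<ge> 0\<close> in auto)
qed

lemma type_II_bound:
  fixes U V :: nat and \<xi> E :: real
  assumes "real U + 1 \<ge> \<xi>" "real V + 1 \<ge> \<xi>" "\<xi> > 0" "E \<ge> 0"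
    and E: "E\<^sup>2 \<ge> real x * (real x / real r + real x / \<xi> + real r)"
  shows "norm (\<Sum>m=U+1..y. of_int (moeb m) * (\<Sum>n=1..y div m. of_real (mangoldt_gt V n) * ee (real (m * n) * \<beta>)))
    \<le> 8 * H ^ 3 * E"
proof -
  obtain K where K: "x < 2 ^ K" "real K \<le> 2 * H" using log2_bound[OF x] unfolding H_def by blast
  let ?f = "\<lambda>m. of_int (moeb m) * (\<Sum>n=1..y div m. of_real (mangoldt_gt V n) * ee (real (m * n) * \<beta>))"
  have "y < (U + 1) * 2 ^ K" using K(1) yx by (simp add: add.commute trans_less_add2 add_strict_increasing)
  then have "(\<Sum>m=U+1..y. ?f m) = (\<Sum>m\<in>{U+1..<(U+1) * 2 ^ K}. ?f m)"
    by (intro sum.mono_neutral_left) auto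
  also have "\<dots> = (\<Sum>k<K. \<Sum>m\<in>{(U+1) * 2 ^ k..<2 * ((U+1) * 2 ^ k)}. ?f m)" by (rule sum_dyadic)
  also have "norm \<dots> \<le> (\<Sum>k<K. 4 * H\<^sup>2 * E)"
  proof (rule order.trans[OF norm_sum], rule sum_mono, rule type_II_single[where \<xi> = \<xi>])
    fix k
    have "(U + 1) * 1 \<le> (U + 1) * 2 ^ k" by (intro mult_left_mono) auto
    then have "real (U + 1) \<le> real ((U + 1) * 2 ^ k)" by (simp only: of_nat_le_iff mult_1_right)
    then show "\<xi> \<le> real ((U + 1) * 2 ^ k)" using assms(1) by simp
  qed (use assms in \<open>auto simp: Suc_le_eq\<close>)
  also have "\<dots> = real K * (4 * H\<^sup>2 * E)" by simp
  also have "\<dots> \<le> 2 * H * (4 * H\<^sup>2 * E)" using K(2) assms(4) by (intro mult_right_mono) auto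
  finally show ?thesis by (simp add: power2_eq_square power3_eq_cube mult_ac)
qed

end

end

text \<open>The middle term reflects the choice \<open>U = V = x powr (2/5)\<close> up to rounding:
  it makes the type I length \<open>U * V\<close> and the type II loss \<open>x / sqrt U\<close>
  both of size \<open>x powr (4/5)\<close>.\<close>

definition vino :: "nat \<Rightarrow> nat \<Rightarrow> real" where
  "vino x r = real x / sqrt (real r) + real x powr (4/5) + sqrt (real x * real r)"

lemma vino_nonneg: "vino x r \<ge> 0"
  by (simp add: vino_def)

lemma vino_square:
  assumes "x \<ge> 2"
  shows "(vino x r)\<^sup>2 \<ge> real x * (real x / real r + real x / real x powr (2/5) + real r)"
proof -
  define A where "A = real x / sqrt (real r)"
  define B where "B = real x powr (4/5)"
  define C where "C = sqrt (real x * real r)"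
  have nn: "A \<ge> 0" "B \<ge> 0" "C \<ge> 0" by (auto simp: A_def B_def C_def)
  have "real x * (real x / real x powr (2/5)) = B\<^sup>2"
  proof -
    have "real x * (real x / real x powr (2/5)) = real x powr 1 * (real x powr 1 / real x powr (2/5))"
      using assms by simp
    also have "\<dots> = real x powr (8/5)" by (simp only: powr_diff[symmetric] powr_add[symmetric]) simp
    also have "\<dots> = B\<^sup>2" by (simp add: B_def power2_eq_square powr_add[symmetric])
    finally show ?thesis .
  qed
  moreover have "real x * (real x / real r) = A\<^sup>2"
    by (simp add: A_def power_divide power2_eq_square)
  moreover have "real x * real r = C\<^sup>2" by (simp add: C_def)
  ultimately have "real x * (real x / real r + real x / real x powr (2/5) + real r) = A\<^sup>2 + B\<^sup>2 + C\<^sup>2"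
    by (simp only: distrib_left)
  also have "\<dots> \<le> (A + B + C)\<^sup>2" using nn by (simp add: power2_eq_square algebra_simps)
  finally show ?thesis by (simp add: vino_def A_def B_def C_def)
qed

text \<open>Proper prime powers up to \<open>x\<close> have the form \<open>p ^ k\<close> with
  \<open>p \<le> sqrt x\<close> and \<open>k < K\<close>; counting the pairs is enough.\<close>

lemma nonprime_mangoldt_sum:
  fixes x :: nat
  defines "H \<equiv> 1 + ln (real x)"
  assumes "x \<ge> 2"
  shows "(\<Sum>l | l \<in> {1..x} \<and> \<not> prime l. mangoldt l :: real) \<le> 2 * H\<^sup>2 * sqrt (real x)"
proof -
  obtain K where K: "x < 2 ^ K" "real K \<le> 2 * H"
    using log2_bound[OF assms(2)] unfolding H_def by blast
  define s where "s = nat \<lfloor>sqrt (real x)\<rfloor>"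
  have s: "real s \<le> sqrt (real x)" by (simp add: s_def)
  define W where "W = {l \<in> {1..x}. primepow l \<and> \<not> prime l}"
  have sub: "W \<subseteq> (\<lambda>(p, k). p ^ k) ` ({1..s} \<times> {..<K})"
  proof
    fix l assume "l \<in> W"
    then have l: "l \<le> x" "primepow l" "\<not> prime l" by (auto simp: W_def)
    then obtain p k where pk: "prime p" "k > 0" "l = p ^ k" by (auto simp: primepow_def)
    then have "k \<noteq> 1" using l by auto
    then have k: "k \<ge> 2" using pk by auto
    have p: "p \<ge> 2" using pk prime_ge_2_nat by blast
    have "p ^ 2 \<le> p ^ k" using p k by (intro power_increasing) auto
    then have "real (p ^ 2) \<le> real x" using l pk by (simp only: of_nat_le_iff)
    then have "real p \<le> sqrt (real x)" by (intro real_le_rsqrt) simp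
    then have "p \<le> s" by (simp add: s_def le_nat_floor)
    moreover have "2 ^ k < (2::nat) ^ K"
    proof -
      have "2 ^ k \<le> p ^ k" using p by (intro power_mono) auto
      then show ?thesis using l pk K by linarith
    qed
    then have "k < K" by simp
    ultimately show "l \<in> (\<lambda>(p, k). p ^ k) ` ({1..s} \<times> {..<K})"
      using pk p by (intro image_eqI[of _ _ "(p, k)"]) auto
  qed
  have "card W \<le> card ((\<lambda>(p, k). p ^ k) ` ({1..s} \<times> {..<K}))"
    using sub by (intro card_mono) auto
  also have "\<dots> \<le> s * K" by (rule order.trans[OF card_image_le]) auto
  finally have "real (card W) \<le> real s * real K" by (metis of_nat_le_iff of_nat_mult)
  also have "\<dots> \<le> sqrt (real x) * (2 * H)" using s K by (intro mult_mono) auto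
  finally have card: "real (card W) \<le> sqrt (real x) * (2 * H)" .
  have H: "H \<ge> 1" using assms by (simp add: H_def)
  have "(\<Sum>l | l \<in> {1..x} \<and> \<not> prime l. mangoldt l :: real) = (\<Sum>l\<in>W. mangoldt l)"
    by (intro sum.mono_neutral_right) (auto simp: W_def mangoldt_def)
  also have "\<dots> \<le> (\<Sum>l\<in>W. H)"
  proof (rule sum_mono)
    fix l assume l: "l \<in> W"
    then have "ln (real l) \<le> ln (real x)" by (subst ln_le_cancel_iff) (auto simp: W_def)
    moreover have "l > 0" using l by (auto simp: W_def)
    ultimately show "mangoldt l \<le> H" using mangoldt_le_ln[of l] unfolding H_def by linarith
  qed
  also have "\<dots> = real (card W) * H" by simp
  also have "\<dots> \<le> sqrt (real x) * (2 * H) * H" using card H by (intro mult_right_mono) auto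
  finally show ?thesis by (simp add: power2_eq_square mult_ac)
qed

context rational_approx
begin

text \<open>The constant is 1 + 88 + 44 + 8, from the initial segment, the two type I sums and the
  type II sum.\<close>

lemma mangoldt_exp_sum:
  fixes x y :: nat
  assumes x: "x \<ge> 2" and "r \<le> x" "y \<le> x"
  shows "norm (\<Sum>l=1..y. of_real (mangoldt l) * ee (real l * \<beta>)) \<le> 141 * (1 + ln (real x)) ^ 3 * vino x r"
proof -
  define H where "H = 1 + ln (real x)"
  define \<xi> where "\<xi> = real x powr (2/5)"
  define U where "U = nat \<lfloor>\<xi>\<rfloor>"
  define E where "E = vino x r"
  have H: "H \<ge> 1" using x by (simp add: H_def)
  have \<xi>: "\<xi> \<ge> 1" using x by (simp add: \<xi>_def ge_one_powr_ge_zero)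
  have U: "real U \<le> \<xi>" "\<xi> \<le> real U + 1" "U \<ge> 1"
    using \<xi> by (simp_all add: U_def le_nat_iff)
  have \<xi>2: "\<xi> * \<xi> = real x powr (4/5)" by (simp add: \<xi>_def powr_add[symmetric])
  have UU: "real (U * U) \<le> real x powr (4/5)"
    unfolding \<xi>2[symmetric] of_nat_mult using U by (intro mult_mono) auto
  \<comment> \<open>It keeps the logarithms and harmonic numbers of the type I sums below
    \<open>H\<close>. For \<open>U \<ge> 2\<close> it follows from
    \<open>U ^ 5 \<le> x\<^sup>2\<close> and
    \<open>(U * U + 1)\<^sup>2 \<le> 2 * U ^ 4 \<le> U ^ 5\<close>.\<close>
  have UUx: "U * U + 1 \<le> x"
  proof (cases "U = 1")
    case False
    then have U2: "real U \<ge> 2" using U by simp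
    have "real U ^ 5 \<le> \<xi> ^ 5" using U by (intro power_mono) auto
    also have "\<xi> ^ 5 = (real x)\<^sup>2"
    proof -
      have "\<xi> ^ 5 = \<xi> powr 5" using \<xi> by (simp add: powr_numeral)
      also have "\<dots> = real x powr 2" by (simp add: \<xi>_def powr_powr)
      finally show ?thesis using x by simp
    qed
    finally have 1: "real U ^ 5 \<le> (real x)\<^sup>2" .
    have 2: "2 * real U ^ 4 \<le> real U ^ 5"
      using mult_right_mono[OF U2, of "real U ^ 4"] by (simp add: power_numeral_reduce)
    have "real U * real U \<ge> 2 * 2" using U2 by (intro mult_mono) auto
    then have "real U * real U + 1 \<le> 5 / 4 * (real U)\<^sup>2" by (simp add: power2_eq_square)
    then have "(real U * real U + 1)\<^sup>2 \<le> (5 / 4 * (real U)\<^sup>2)\<^sup>2" by (intro power_mono) auto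
    also have "\<dots> = 25 / 16 * real U ^ 4" by (simp add: power_mult_distrib power_divide)
    also have "\<dots> \<le> 2 * real U ^ 4" by (intro mult_right_mono) auto
    finally have "(real U * real U + 1)\<^sup>2 \<le> (real x)\<^sup>2" using 1 2 by linarith
    then have "real U * real U + 1 \<le> real x" by (rule power2_le_imp_le) auto
    then have "real (U * U + 1) \<le> real x" by simp
    then show ?thesis by (simp only: of_nat_le_iff)
  qed (use x in auto)
  have Ux: "U + 1 \<le> x"
  proof -
    have "U * 1 \<le> U * U" using U by (intro mult_left_mono) auto
    then show ?thesis using UUx by linarith
  qed
  have E0: "E \<ge> 0" by (simp add: E_def vino_nonneg)
  have r: "real r \<ge> 1" using r_pos by simp
  have sr: "sqrt (real r) \<ge> 1" using r by simp
  have xr: "real x / real r \<le> real x / sqrt (real r)"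
  proof (rule divide_left_mono)
    show "sqrt (real r) \<le> real r" using mult_right_mono[OF sr, of "sqrt (real r)"] r by simp
  qed (use r in auto)
  have rr: "real r \<le> sqrt (real x * real r)"
  proof (rule real_le_rsqrt)
    show "(real r)\<^sup>2 \<le> real x * real r" unfolding power2_eq_square using assms by (intro mult_right_mono) auto
  qed
  have e1: "real x / real r + real (U * U) + real r \<le> E"
    using xr rr UU by (simp add: E_def vino_def)
  have e2: "real x / real r + real U + real r \<le> E"
  proof -
    have "real U * 1 \<le> real U * real U" using U by (intro mult_left_mono) auto
    then show ?thesis using e1 by simp
  qed
  have e3: "\<xi> \<le> E"
  proof -
    have "\<xi> * 1 \<le> \<xi> * \<xi>" using \<xi> by (intro mult_left_mono) auto
    then show ?thesis unfolding \<xi>2 by (simp add: E_def vino_def add_increasing add_increasing2)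
  qed
  have H3: "H \<le> H ^ 3" "H\<^sup>2 \<le> H ^ 3" using H by (auto simp: power_increasing self_le_power)
  have piece0: "norm (\<Sum>l | l \<in> {1..y} \<and> l \<le> U. of_real (mangoldt l) * ee (real l * \<beta>)) \<le> H ^ 3 * E"
  proof -
    have "norm (\<Sum>l | l \<in> {1..y} \<and> l \<le> U. of_real (mangoldt l) * ee (real l * \<beta>)) \<le> (\<Sum>l | l \<in> {1..y} \<and> l \<le> U. H)"
    proof (intro order.trans[OF norm_sum] sum_mono)
      fix l assume l: "l \<in> {l. l \<in> {1..y} \<and> l \<le> U}"
      have "ln (real l) \<le> ln (real x)" using l assms by (subst ln_le_cancel_iff) auto
      then show "norm (of_real (mangoldt l) * ee (real l * \<beta>)) \<le> H"
        using mangoldt_le_ln[of l] l unfolding norm_mult norm_of_real norm_ee H_def abs_of_nonneg[OF mangoldt_nonneg]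
        by auto
    qed
    also have "\<dots> \<le> (\<Sum>l=1..U. H)" using H by (intro sum_mono2) auto
    also have "\<dots> = H * real U" by simp
    also have "\<dots> \<le> H ^ 3 * E" using H3 U e3 H by (intro mult_mono) auto
    finally show ?thesis .
  qed
  have HE: "H\<^sup>2 * E \<le> H ^ 3 * E" "H ^ 3 * E \<ge> 0" using H3 E0 H by (auto intro!: mult_right_mono)
  show ?thesis
  proof (cases "U \<le> y")
    case False
    then have "(\<Sum>l=1..y. of_real (mangoldt l) * ee (real l * \<beta>)) = (\<Sum>l | l \<in> {1..y} \<and> l \<le> U. of_real (mangoldt l) * ee (real l * \<beta>))"
      by (intro sum.cong) auto
    then have "norm (\<Sum>l=1..y. of_real (mangoldt l) * ee (real l * \<beta>)) \<le> H ^ 3 * E"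
      using piece0 by (simp only:)
    then show ?thesis using HE unfolding H_def[symmetric] E_def[symmetric] by linarith
  next
    case True
    have 1: "norm (\<Sum>m=1..U. of_int (moeb m) * (\<Sum>n=1..y div m. of_real (ln (real n)) * ee (real (m * n) * \<beta>))) \<le> 88 * (H ^ 3 * E)"
    proof -
      have "norm (\<Sum>m=1..U. of_int (moeb m) * (\<Sum>n=1..y div m. of_real (ln (real n)) * ee (real (m * n) * \<beta>))) \<le> 88 * H\<^sup>2 * (real x / real r + real U + real r)"
        unfolding H_def using assms Ux by (intro type_I_log_bound) auto
      also have "\<dots> \<le> 88 * H\<^sup>2 * E" using e2 by (intro mult_left_mono) auto
      finally show ?thesis using HE by linarith
    qed
    have 2: "norm (\<Sum>m=1..U. of_int (moeb m) * (\<Sum>n=1..y div m. of_real (\<Sum>c | c dvd n \<and> c \<le> U. mangoldt c) * ee (real (m * n) * \<beta>))) \<le> 44 * (H ^ 3 * E)"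
    proof -
      have "norm (\<Sum>m=1..U. of_int (moeb m) * (\<Sum>n=1..y div m. of_real (\<Sum>c | c dvd n \<and> c \<le> U. mangoldt c) * ee (real (m * n) * \<beta>))) \<le> 44 * H\<^sup>2 * (real x / real r + real (U * U) + real r)"
        unfolding H_def using assms UUx by (intro type_I_bound) auto
      also have "\<dots> \<le> 44 * H\<^sup>2 * E" using e1 by (intro mult_left_mono) auto
      finally show ?thesis using HE by linarith
    qed
    have 3: "norm (\<Sum>m=U+1..y. of_int (moeb m) * (\<Sum>n=1..y div m. of_real (mangoldt_gt U n) * ee (real (m * n) * \<beta>))) \<le> 8 * (H ^ 3 * E)"
    proof -
      have "norm (\<Sum>m=U+1..y. of_int (moeb m) * (\<Sum>n=1..y div m. of_real (mangoldt_gt U n) * ee (real (m * n) * \<beta>))) \<le> 8 * H ^ 3 * E"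
        unfolding H_def using assms U \<xi> E0 vino_square[OF x, of r]
        by (intro type_II_bound[where \<xi> = \<xi>]) (auto simp: E_def \<xi>_def)
      then show ?thesis by simp
    qed
    have tri: "norm (a + b - c + d) \<le> norm a + norm b + norm c + norm d" for a b c d :: complex
      by (smt (verit, best) norm_triangle_ineq norm_triangle_ineq4)
    show ?thesis
      unfolding vaughan_identity[OF True, of "\<lambda>l. ee (real l * \<beta>)" U] H_def[symmetric] E_def[symmetric]
      using 1 2 3 piece0 HE by (intro order.trans[OF tri]) linarith
  qed
qed

text \<open>Partial summation with the decreasing weights \<open>1 / ln l\<close> passes from the
  von Mangoldt function to primes. The constant is 3/2 times 141 + 2, rounded up: 2 comes from the
  proper prime powers, and 3/2 bounds \<open>1 / ln 2\<close>.\<close>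

theorem prime_exp_sum:
  fixes x :: nat
  assumes x: "x \<ge> 2"
  shows "norm (\<Sum>p | prime p \<and> p < x. ee (real p * \<beta>)) \<le> 215 * (1 + ln (real x)) ^ 3 * vino x r"
proof -
  define H where "H = 1 + ln (real x)"
  define E where "E = vino x r"
  have H: "H \<ge> 1" using x by (simp add: H_def)
  have E0: "E \<ge> 0" by (simp add: E_def vino_nonneg)
  have H3: "H\<^sup>2 \<le> H ^ 3" "1 \<le> H ^ 3" using H by (auto simp: power_increasing)
  show ?thesis
  proof (cases "r \<le> x")
    case False
    \<comment> \<open>For \<open>r > x\<close> the term \<open>sqrt (x * r)\<close> of
      \<open>vino\<close> exceeds the trivial bound.\<close>
    have "norm (\<Sum>p | prime p \<and> p < x. ee (real p * \<beta>)) \<le> (\<Sum>p | prime p \<and> p < x. 1)"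
      by (rule order.trans[OF norm_sum]) (auto intro!: sum_mono)
    also have "\<dots> \<le> (\<Sum>p<x. 1::real)" by (intro sum_mono2) auto
    also have "\<dots> = real x" by simp
    also have "\<dots> = sqrt (real x * real x)" by simp
    also have "\<dots> \<le> sqrt (real x * real r)" using False by (intro real_sqrt_le_mono mult_left_mono) auto
    also have "\<dots> \<le> E" by (simp add: E_def vino_def)
    also have "\<dots> \<le> H ^ 3 * E" using H3 E0 mult_right_mono[of 1 "H ^ 3" E] by simp
    finally have *: "norm (\<Sum>p | prime p \<and> p < x. ee (real p * \<beta>)) \<le> H ^ 3 * E" .
    then have "0 \<le> H ^ 3 * E" by (rule order.trans[OF norm_ge_zero])
    with * show ?thesis unfolding H_def[symmetric] E_def[symmetric] by linarith
  next
    case True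
    define a where "a = (\<lambda>l. if prime l then of_real (mangoldt l) * ee (real l * \<beta>) else 0)"
    have sx: "sqrt (real x) \<le> E"
    proof -
      have "sqrt (real x) = real x powr (1/2)" by (simp add: powr_half_sqrt)
      also have "\<dots> \<le> real x powr (4/5)" using x by (intro powr_mono) auto
      finally show ?thesis by (simp add: E_def vino_def add_increasing add_increasing2)
    qed
    have partial: "norm (\<Sum>l=1..y. a l) \<le> 143 * (H ^ 3 * E)" if y: "y \<le> x" for y
    proof -
      have "(\<Sum>l=1..y. of_real (mangoldt l) * ee (real l * \<beta>)) =
          (\<Sum>l=1..y. a l + (if \<not> prime l then of_real (mangoldt l) * ee (real l * \<beta>) else 0))"
        by (intro sum.cong) (auto simp: a_def)
      also have "\<dots> = (\<Sum>l=1..y. a l) + (\<Sum>l | l \<in> {1..y} \<and> \<not> prime l. of_real (mangoldt l) * ee (real l * \<beta>))"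
        by (simp only: sum.distrib sum.inter_filter[OF finite_atLeastAtMost])
      finally have eq: "(\<Sum>l=1..y. a l) = (\<Sum>l=1..y. of_real (mangoldt l) * ee (real l * \<beta>))
          - (\<Sum>l | l \<in> {1..y} \<and> \<not> prime l. of_real (mangoldt l) * ee (real l * \<beta>))" by (simp only: add_diff_cancel)
      have "norm (\<Sum>l | l \<in> {1..y} \<and> \<not> prime l. of_real (mangoldt l) * ee (real l * \<beta>)) \<le> (\<Sum>l | l \<in> {1..y} \<and> \<not> prime l. mangoldt l)"
        by (rule order.trans[OF norm_sum]) (auto intro!: sum_mono simp only: norm_mult norm_of_real norm_ee mult_1_right abs_of_nonneg[OF mangoldt_nonneg])
      also have "\<dots> \<le> (\<Sum>l | l \<in> {1..x} \<and> \<not> prime l. mangoldt l)"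
        using y by (intro sum_mono2) (auto intro: mangoldt_nonneg)
      also have "\<dots> \<le> 2 * H\<^sup>2 * sqrt (real x)" unfolding H_def by (rule nonprime_mangoldt_sum[OF x])
      also have "\<dots> \<le> 2 * H ^ 3 * E" using H3 sx H by (intro mult_mono) auto
      finally have 1: "norm (\<Sum>l | l \<in> {1..y} \<and> \<not> prime l. of_real (mangoldt l) * ee (real l * \<beta>)) \<le> 2 * (H ^ 3 * E)" by simp
      have 2: "norm (\<Sum>l=1..y. of_real (mangoldt l) * ee (real l * \<beta>)) \<le> 141 * (H ^ 3 * E)"
        using mangoldt_exp_sum[OF x True y] by (simp only: H_def E_def mult.assoc)
      show ?thesis unfolding eq using 1 2 by (intro order.trans[OF norm_triangle_ineq4]) linarith
    qed
    define w where "w = (\<lambda>i. 1 / ln (real (i + 2)))"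
    have "(\<Sum>p | prime p \<and> p < x. ee (real p * \<beta>)) = (\<Sum>l | l \<in> {2..<x} \<and> prime l. ee (real l * \<beta>))"
      by (intro sum.cong) (auto dest: prime_ge_2_nat)
    also have "\<dots> = (\<Sum>l\<in>{2..<x}. if prime l then ee (real l * \<beta>) else 0)"
      by (rule sum.inter_filter) auto
    also have "\<dots> = (\<Sum>l\<in>{2..<x}. of_real (1 / ln (real l)) * a l)"
    proof (intro sum.cong refl)
      fix l assume "l \<in> {2..<x}"
      then have "ln (real l) \<noteq> 0" by auto
      then show "(if prime l then ee (real l * \<beta>) else 0) = of_real (1 / ln (real l)) * a l"
        unfolding a_def by (simp flip: of_real_mult mult.assoc)
    qed
    also have "\<dots> = (\<Sum>i<x - 2. of_real (w i) * a (i + 2))"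
      by (rule sum.reindex_bij_witness[of _ "\<lambda>i. i + 2" "\<lambda>l. l - 2"]) (auto simp: w_def simp del: add_2_eq_Suc add_2_eq_Suc')
    also have "norm \<dots> \<le> w 0 * (143 * (H ^ 3 * E))"
    proof (rule abel_norm_le_decreasing)
      fix j assume j: "j \<le> x - 2"
      have "(\<Sum>i<j. a (i + 2)) = (\<Sum>l\<in>{2..<j+2}. a l)"
        by (rule sum.reindex_bij_witness[of _ "\<lambda>l. l - 2" "\<lambda>i. i + 2"]) auto
      also have "\<dots> = (\<Sum>l=1..j+1. a l)"
        by (intro sum.mono_neutral_left) (auto simp: a_def not_less_eq_eq numeral_2_eq_2 le_Suc_eq)
      finally show "norm (\<Sum>i<j. a (i + 2)) \<le> 143 * (H ^ 3 * E)"
        using partial[of "j + 1"] j x by simp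
    next
      show "0 \<le> w i" for i by (simp add: w_def)
      show "w (Suc i) \<le> w i" for i unfolding w_def by (intro divide_left_mono) auto
    qed
    also have "w 0 \<le> 3 / 2" using ln2_ge_two_thirds by (simp add: w_def field_simps)
    then have "w 0 * (143 * (H ^ 3 * E)) \<le> 3 / 2 * (143 * (H ^ 3 * E))"
      using E0 H by (intro mult_right_mono) auto
    also have "\<dots> \<le> 215 * H ^ 3 * E" using E0 H by simp
    finally show ?thesis by (simp add: H_def E_def)
  qed
qed

end

section \<open>The threshold for the base\<close>

lemma powr_fifth:
  assumes "g > 0"
  shows "(g powr (1/5)) ^ 5 = (g::real)" "g powr (1/5) > 0"
  using assms by (auto simp: powr_powr simp flip: powr_realpow)

lemma powr_fifth_le: "0 \<le> t \<Longrightarrow> 0 < g \<Longrightarrow> g \<le> t ^ 5 \<Longrightarrow> g powr (1/5) \<le> (t::real)"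
  using power_mono_iff[of "g powr (1/5)" t 5] powr_fifth[of g] by simp

lemma powr_fifth_ge: "0 \<le> t \<Longrightarrow> 0 < g \<Longrightarrow> t ^ 5 \<le> g \<Longrightarrow> t \<le> (g powr (1/5) :: real)"
  using power_mono_iff[of t "g powr (1/5)" 5] powr_fifth[of g] by simp

lemma ln_powr_fifth: "0 < g \<Longrightarrow> ln g = 5 * ln (g powr (1/5) :: real)"
  by (simp add: ln_powr)

section \<open>Numerical values that separate 31698 from 31699\<close>

lemma ln2_bounds: "ln (2::real) \<ge> 0.69314718" "ln (2::real) \<le> 0.6931471812"
  using ln_approx_bounds[of 2 9] by (simp_all add: eval_nat_numeral)

lemma ln_mantissa_lower: "ln (1.23166342::real) \<ge> 0.20836562"
  using ln_approx_bounds[of "1.23166342" 4] by (simp_all add: eval_nat_numeral)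

lemma ln_mantissa_upper: "ln (1.2317023::real) \<le> 0.20839721"
  using ln_approx_bounds[of "1.2317023" 4] by (simp_all add: eval_nat_numeral)

lemma two_over_pi: "2 / pi \<ge> 0.63661977" "2 / pi \<le> 0.63661978"
  using pi_approx by (simp_all add: field_simps)

text \<open>The margins are of order 10 ^ (-5): here 7.947065 has to beat the fifth root of 31698,
  at most 7.9470579, and in \<open>log_31699\<close> the value 7.947088 has to stay below the fifth
  root of 31699, at least 7.947107. Splitting off 2 ^ 14 leaves a mantissa near 1, for which the
  logarithm has sharp bounds.\<close>

lemma log_31698: "2 / pi * (ln (2 * 31698 / pi) + 1) + 1 \<ge> 7.947065"
proof -
  have "1.23166342 * 2 ^ 14 \<le> 2 * 31698 / pi"
    using pi_approx by (simp add: field_simps)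
  then have "ln (1.23166342 * 2 ^ 14) \<le> ln (2 * 31698 / pi)"
    by (subst ln_le_cancel_iff) auto
  moreover have "ln (1.23166342 * 2 ^ 14 :: real) = ln 1.23166342 + 14 * ln 2"
    using ln_realpow[of 2 14] by (subst ln_mult) auto
  ultimately have 1: "ln 1.23166342 + 14 * ln 2 \<le> ln (2 * 31698 / pi)" by linarith
  have "b + 1 \<ge> 10.912426" if "a + 14 * ln 2 \<le> b" "a \<ge> 0.20836562" for a b :: real
    using that ln2_bounds by simp
  from this[OF 1 ln_mantissa_lower] have "ln (2 * 31698 / pi) + 1 \<ge> 10.912426" .
  then have 2: "2 / pi * (ln (2 * 31698 / pi) + 1) \<ge> 0.63661977 * 10.912426"
    using two_over_pi by (intro mult_mono) auto
  have "z + 1 \<ge> 7.947065" if "z \<ge> 0.63661977 * 10.912426" for z :: real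
    using that by simp
  from this[OF 2] show ?thesis .
qed

lemma log_31699: "2 / pi * (ln (2 * 31699 / pi) + 1 + 1 / 10 ^ 8) + 1 \<le> 7.947088"
proof -
  have "1.2317023 * 2 ^ 14 \<ge> 2 * 31699 / pi"
    using pi_approx by (simp add: field_simps)
  then have "ln (2 * 31699 / pi) \<le> ln (1.2317023 * 2 ^ 14)"
    by (subst ln_le_cancel_iff) auto
  moreover have "ln (1.2317023 * 2 ^ 14 :: real) = ln 1.2317023 + 14 * ln 2"
    using ln_realpow[of 2 14] by (subst ln_mult) auto
  ultimately have 1: "ln (2 * 31699 / pi) \<le> ln 1.2317023 + 14 * ln 2" by linarith
  have "b + 1 + 1 / 10 ^ 8 \<le> 10.91245777" if "b \<le> a + 14 * ln 2" "a \<le> 0.20839721" for a b :: real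
    using that ln2_bounds by simp
  from this[OF 1 ln_mantissa_upper] have "ln (2 * 31699 / pi) + 1 + 1 / 10 ^ 8 \<le> 10.91245777" .
  moreover have "ln (2 * 31699 / pi) \<ge> 0" using pi_approx by (simp add: field_simps)
  ultimately have 2: "2 / pi * (ln (2 * 31699 / pi) + 1 + 1 / 10 ^ 8) \<le> 0.63661978 * 10.91245777"
    using two_over_pi by (intro mult_mono) auto
  have "z + 1 \<le> 7.947088" if "z \<le> 0.63661978 * 10.91245777" for z :: real
    using that by simp
  from this[OF 2] show ?thesis .
qed

lemma sin_lower:
  assumes "0 \<le> (y::real)"
  shows "sin y \<ge> y * (1 - y\<^sup>2 / 6)"
proof -
  have "\<bar>sin y - (\<Sum>m<3. sin_coeff m * y ^ m)\<bar> \<le> inverse (fact 3) * \<bar>y\<bar> ^ 3"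
    by (rule Maclaurin_sin_bound)
  then have "\<bar>sin y - y\<bar> \<le> y ^ 3 / 6"
    using assms by (simp add: eval_nat_numeral sin_coeff_def)
  moreover have "y * (1 - y\<^sup>2 / 6) = y - y ^ 3 / 6" by (simp add: power2_eq_square power3_eq_cube algebra_simps)
  ultimately show ?thesis by linarith
qed

lemma cos_lower: "cos y \<ge> 1 - (y::real)\<^sup>2 / 2"
proof -
  have "cos y = 1 - 2 * (sin (y / 2))\<^sup>2"
    using cos_double_sin[of "y / 2"] by simp
  moreover have "(sin (y / 2))\<^sup>2 \<le> (y / 2)\<^sup>2"
    using abs_sin_x_le_abs_x[of "y / 2"] by (metis abs_le_square_iff)
  ultimately show ?thesis by (simp add: power_divide)
qed

text \<open>With \<open>y = pi / (2 * g)\<close> both terms are governed by \<open>sin y\<close>,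
  which is \<open>y\<close> up to a relative error \<open>\<epsilon>\<close>. The logarithm and the
  reciprocal contribute \<open>2 * \<epsilon>\<close> each, and \<open>4 * \<epsilon>\<close> is the
  \<open>1 / 10 ^ 8\<close> of the statement.\<close>

lemma C_const_upper:
  assumes "g \<ge> 31699"
  shows "C_const g \<le> 2 / pi * (ln (2 * real g / pi) + 1 + 1 / 10 ^ 8) + 1"
proof -
  define y where "y = pi / (2 * real g)"
  have g: "real g \<ge> 31699" using assms by simp
  have y: "0 < y" "y \<le> 1 / 10 ^ 4"
    using g pi_approx by (auto simp: y_def field_simps)
  define \<epsilon> :: real where "\<epsilon> = 1 / (4 * 10 ^ 8)"
  have y2: "y\<^sup>2 / 6 \<le> \<epsilon>"
  proof -
    have "y\<^sup>2 \<le> (1 / 10 ^ 4)\<^sup>2" using y by (intro power_mono) auto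
    then show ?thesis by (simp add: \<epsilon>_def power_divide)
  qed
  have "y * (1 - \<epsilon>) \<le> y * (1 - y\<^sup>2 / 6)" using y y2 by (intro mult_left_mono) auto
  also have "\<dots> \<le> sin y" using y by (intro sin_lower) auto
  finally have sin: "sin y \<ge> y * (1 - \<epsilon>)" .
  have ye: "y * (1 - \<epsilon>) > 0" using y by (simp add: \<epsilon>_def)
  have sin0: "sin y > 0" using sin ye by linarith
  have inv: "1 / sin y \<le> (1 + 2 * \<epsilon>) / y"
  proof -
    have "1 / sin y \<le> 1 / (y * (1 - \<epsilon>))" using sin ye by (intro divide_left_mono) auto
    also have "\<dots> \<le> (1 + 2 * \<epsilon>) / y" using y by (simp add: \<epsilon>_def field_simps)
    finally show ?thesis .
  qed
  have cosp: "cos y > 0" using y pi_approx by (intro cos_gt_zero) auto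
  have "cot y \<le> 1 / sin y" unfolding cot_def using sin0 by (intro divide_right_mono) auto
  also note inv
  finally have "cot y \<le> (1 + 2 * \<epsilon>) / y" .
  moreover have "cot y > 0" using sin0 cosp by (simp add: cot_def)
  ultimately have "ln (cot y) \<le> ln ((1 + 2 * \<epsilon>) / y)"
    using y by (subst ln_le_cancel_iff) (auto simp: \<epsilon>_def)
  also have "\<dots> = ln (1 + 2 * \<epsilon>) + ln (1 / y)"
    using y ln_div[of "1 + 2 * \<epsilon>" y] ln_div[of 1 y] by (simp add: \<epsilon>_def)
  also have "ln (1 + 2 * \<epsilon>) \<le> 2 * \<epsilon>" by (rule ln_add_one_self_le_self) (simp add: \<epsilon>_def)
  finally have 1: "ln (cot y) \<le> ln (2 * real g / pi) + 2 * \<epsilon>" by (simp add: y_def)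
  have "1 / (real g * sin y) = 1 / sin y / real g" by simp
  also have "\<dots> \<le> (1 + 2 * \<epsilon>) / y / real g" using inv by (intro divide_right_mono) auto
  also have "\<dots> = 2 / pi * (1 + 2 * \<epsilon>)" using g by (simp add: y_def)
  finally have 2: "1 / (real g * sin y) \<le> 2 / pi * (1 + 2 * \<epsilon>)" .
  have "C_const g = 2 / pi * ln (cot y) + 1 / (real g * sin y) + 1" by (simp add: C_const_def y_def)
  also have "\<dots> \<le> 2 / pi * (ln (2 * real g / pi) + 2 * \<epsilon>) + 2 / pi * (1 + 2 * \<epsilon>) + 1"
    using 1 2 by (intro add_mono mult_left_mono) auto
  also have "\<dots> = 2 / pi * (ln (2 * real g / pi) + 1 + 4 * \<epsilon>) + 1" by (simp add: distrib_left)
  finally show ?thesis by (simp add: \<epsilon>_def)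
qed

text \<open>For both terms \<open>sin y \<le> y\<close> suffices; the cosine in the numerator of the
  cotangent goes the wrong way and stays as a correction, estimated in
  \<open>ln_cos_lower\<close>.\<close>

lemma C_const_lower:
  assumes "g \<ge> 2"
  shows "C_const g \<ge> 2 / pi * (ln (2 * real g / pi) + 1 + ln (cos (pi / (2 * real g)))) + 1"
proof -
  define y where "y = pi / (2 * real g)"
  have g: "real g \<ge> 2" using assms by simp
  have y: "0 < y" "y < pi / 2" using g by (auto simp: y_def field_simps)
  have cosp: "cos y > 0" using y by (intro cos_gt_zero) auto
  have sinp: "sin y > 0" using y by (intro sin_gt_zero) auto
  have le: "sin y \<le> y" using y by (intro sin_x_le_x) auto
  have "ln (2 * real g / pi) + ln (cos y) = ln (cos y / y)"
  proof -
    have "ln y = - ln (2 * real g / pi)" using g by (simp add: y_def ln_div ln_mult)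
    then show ?thesis using cosp y by (simp add: ln_div)
  qed
  also have "\<dots> \<le> ln (cot y)"
    unfolding cot_def using le sinp cosp y by (subst ln_le_cancel_iff) (auto intro!: divide_left_mono divide_pos_pos)
  finally have 1: "ln (2 * real g / pi) + ln (cos y) \<le> ln (cot y)" .
  have "2 / pi = 1 / (real g * y)" using g by (simp add: y_def)
  also have "\<dots> \<le> 1 / (real g * sin y)"
    using le sinp g y by (intro divide_left_mono mult_left_mono) auto
  finally have 2: "2 / pi \<le> 1 / (real g * sin y)" .
  have "2 / pi * (ln (2 * real g / pi) + 1 + ln (cos y)) + 1 = 2 / pi * (ln (2 * real g / pi) + ln (cos y)) + 2 / pi + 1"
    by (simp only: distrib_left)
  also have "\<dots> \<le> 2 / pi * ln (cot y) + 1 / (real g * sin y) + 1"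
    using 1 2 by (intro add_mono mult_left_mono) auto
  also have "\<dots> = C_const g" by (simp add: C_const_def y_def)
  finally show ?thesis by (simp add: y_def)
qed

lemma C_const_gt_1:
  assumes "g \<ge> 2"
  shows "C_const g > 1"
proof -
  define y where "y = pi / (2 * real g)"
  have g: "real g \<ge> 2" using assms by simp
  have y: "0 < y" "y \<le> pi / 4" using g by (auto simp: y_def field_simps)
  have sinp: "sin y > 0" using y by (intro sin_gt_zero) auto
  have "sin y \<le> sin (pi / 4)" using y by (intro sin_monotone_2pi_le) auto
  also have "\<dots> = cos (pi / 4)" by (simp add: sin_45 cos_45)
  also have "\<dots> \<le> cos y" using y by (intro cos_monotone_0_pi_le) auto
  finally have "cot y \<ge> 1" using sinp by (simp add: cot_def)
  then have "ln (cot y) \<ge> 0" by simp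
  then show ?thesis using sinp g by (simp add: C_const_def y_def add_nonneg_pos)
qed

text \<open>In the variable \<open>s\<close>, the fifth root of \<open>g\<close>, the upper bound
  grows like \<open>5 * A * ln s\<close>, whose slope \<open>5 * A / s0\<close> at the starting
  point is below 1. The tangent of the logarithm at \<open>s0\<close> therefore reduces all
  \<open>g\<close> to the value at 31699.\<close>

lemma C_const_less_fifth_root:
  assumes "g \<ge> 31699"
  shows "C_const g < real g powr (1/5)"
proof -
  define A where "A = 2 / pi"
  define s where "s = real g powr (1/5)"
  define s0 :: real where "s0 = 31699 powr (1/5)"
  have A: "0.63661977 \<le> A" "A \<le> 0.63661978" using two_over_pi by (auto simp: A_def)
  have s0: "s0 \<ge> 7.947107"
    unfolding s0_def by (rule powr_fifth_ge) (simp_all add: power_numeral_reduce)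
  have ss: "s0 \<le> s" unfolding s0_def s_def using assms by (intro powr_mono2) auto
  have "ln (2 * real g / pi) = ln (2 * 31699 / pi) + 5 * ln (s / s0)"
  proof -
    have "ln (2 * real g / pi) = ln (2 / pi) + ln (real g)" using assms by (simp add: ln_div ln_mult)
    also have "ln (real g) = 5 * ln s" unfolding s_def using assms by (intro ln_powr_fifth) auto
    also have "ln (2 / pi) = ln (2 * 31699 / pi) - ln 31699" using ln_mult[of "2 / pi" 31699] by simp
    also have "ln 31699 = 5 * ln s0" unfolding s0_def by (intro ln_powr_fifth) auto
    finally show ?thesis using s0 ss by (simp add: ln_div)
  qed
  also have "ln (s / s0) \<le> s / s0 - 1" using s0 ss by (intro ln_le_minus_one) auto
  finally have "ln (2 * real g / pi) \<le> ln (2 * 31699 / pi) + 5 * (s / s0 - 1)" by simp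
  then have "A * (ln (2 * real g / pi) + 1 + 1 / 10 ^ 8) \<le> A * ((ln (2 * 31699 / pi) + 1 + 1 / 10 ^ 8) + 5 * (s / s0 - 1))"
    using A by (intro mult_left_mono) auto
  also have "\<dots> = A * (ln (2 * 31699 / pi) + 1 + 1 / 10 ^ 8) + 5 * A / s0 * (s - s0)"
    using s0 by (simp add: field_simps)
  also have "5 * A / s0 * (s - s0) \<le> 1 * (s - s0)"
    using A s0 ss by (intro mult_right_mono) auto
  finally have "C_const g \<le> A * (ln (2 * 31699 / pi) + 1 + 1 / 10 ^ 8) + (s - s0) + 1"
    using C_const_upper[OF assms] by (simp add: A_def)
  also have "\<dots> < s"
  proof -
    define B where "B = A * (ln (2 * 31699 / pi) + 1 + 1 / 10 ^ 8)"
    have "B + 1 \<le> 7.947088" unfolding B_def A_def by (rule log_31699)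
    then show ?thesis unfolding B_def[symmetric] using s0 by simp
  qed
  finally show ?thesis by (simp add: s_def)
qed

text \<open>Through \<open>ln (1 - u) \<ge> - 2 * u\<close> with \<open>u = y\<^sup>2 / 2\<close>;
  the factor 2.5 exceeds the square of \<open>pi / 2\<close>.\<close>

lemma ln_cos_lower:
  assumes "g \<ge> n" "n \<ge> 2" "1 / (real n)\<^sup>2 \<le> \<epsilon>" 
  shows "ln (cos (pi / (2 * real g))) \<ge> - (2.5 * \<epsilon>)"
proof -
  define y where "y = pi / (2 * real g)"
  have g: "real g \<ge> real n" "real n \<ge> 2" using assms by auto
  have y: "0 < y" "y \<le> 1.5708 / real n"
  proof -
    have "y \<le> 1.5708 / real g" using pi_approx g by (simp add: y_def field_simps)
    also have "\<dots> \<le> 1.5708 / real n" using g by (intro divide_left_mono) auto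
    finally show "y \<le> 1.5708 / real n" .
  qed (use g in \<open>auto simp: y_def\<close>)
  have y2: "y\<^sup>2 \<le> 2.4675 * (1 / (real n)\<^sup>2)"
  proof -
    have "y\<^sup>2 \<le> (1.5708 / real n)\<^sup>2" using y by (intro power_mono) auto
    also have "\<dots> \<le> 2.4675 * (1 / (real n)\<^sup>2)" using g by (simp add: power_divide divide_simps)
    finally show ?thesis .
  qed
  have n4: "1 / (real n)\<^sup>2 \<le> 1 / 4"
  proof -
    have "(2::real)\<^sup>2 \<le> (real n)\<^sup>2" using g by (intro power_mono) auto
    then show ?thesis using divide_left_mono[of 4 "(real n)\<^sup>2" 1] g by simp
  qed
  define u where "u = y\<^sup>2 / 2"
  have u: "0 \<le> u" "u \<le> 0.32" using y2 n4 by (auto simp: u_def)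
  have "- (2.5 * \<epsilon>) \<le> - (2 * u)"
  proof -
    define v where "v = 1 / (real n)\<^sup>2"
    have "v \<ge> 0" by (simp add: v_def)
    then show ?thesis using y2 assms(3) unfolding v_def[symmetric] by (simp add: u_def)
  qed
  also have "- (2 * u) \<le> 1 - 1 / (1 - u)"
  proof -
    have "0 \<le> u * (1 - 2 * u)" using u by (intro mult_nonneg_nonneg) auto
    then show ?thesis using u by (simp add: field_simps)
  qed
  also have "\<dots> \<le> ln (1 - u)" using ln_inverse[of "1 - u"] ln_le_minus_one[of "1 / (1 - u)"] u
    by (simp add: ln_div)
  also have "\<dots> \<le> ln (cos y)"
  proof -
    have "1 - u \<le> cos y" using cos_lower[of y] by (simp add: u_def)
    then show ?thesis using u by (subst ln_le_cancel_iff) auto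
  qed
  finally show ?thesis by (simp add: y_def)
qed

text \<open>As a function of \<open>s\<close>, the fifth root of \<open>g\<close>, the lower bound
  minus \<open>s\<close> is concave apart from the cosine, and it turns at \<open>s = 5 * A\<close>,
  a little above \<open>g = 300\<close>. Below 400 it is therefore compared with its value at the
  left end 2, from 400 on with that at the right end 31698, where the margin is small.\<close>

lemma C_const_ge_fifth_root:
  assumes "g \<ge> 2" "g \<le> 31698"
  shows "C_const g \<ge> real g powr (1/5)"
proof -
  define A where "A = 2 / pi"
  define s where "s = real g powr (1/5)"
  define c where "c = ln (cos (pi / (2 * real g)))"
  have A: "0.63661977 \<le> A" "A \<le> 0.63661978" using two_over_pi by (auto simp: A_def)
  have g: "real g \<ge> 2" "real g \<le> 31698" using assms by auto
  have s_pos: "s > 0" using g by (simp add: s_def)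
  have lng: "ln (2 * real g / pi) = ln (2 / pi) + 5 * ln s"
  proof -
    have "ln (2 * real g / pi) = ln (2 / pi) + ln (real g)" using assms by (simp add: ln_div ln_mult)
    also have "ln (real g) = 5 * ln s" unfolding s_def using assms by (intro ln_powr_fifth) auto
    finally show ?thesis .
  qed
  have C: "C_const g \<ge> A * (ln (2 * real g / pi) + 1 + c) + 1"
    using C_const_lower[OF assms(1)] by (simp add: A_def c_def)
  have ln_ge: "ln z \<ge> 1 - 1 / z" if "z > 0" for z :: real
    using ln_le_minus_one[of "1 / z"] that by (simp add: ln_div)
  show ?thesis
  proof (cases "g < 400")
    case True
    define t :: real where "t = 2 powr (1/5)"
    have t: "t \<le> 1.15" "t > 0" unfolding t_def by (rule powr_fifth_le, simp_all add: power_numeral_reduce)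
    have s_le: "s \<le> 3.32" unfolding s_def using True g by (intro powr_fifth_le) (auto simp: power_numeral_reduce)
    have ts: "t \<le> s" unfolding t_def s_def using g by (intro powr_mono2) auto
    \<comment> \<open>0.625 is 2.5 / 4, the crude bound from \<open>g = 2\<close> on; together with
      \<open>ln (4 / pi) \<ge> 0.2146\<close> it leaves 1 + 0.2146 - 0.625 = 0.5896.\<close>
    have c: "c \<ge> - 0.625" unfolding c_def using ln_cos_lower[of 2 g "1/4"] assms by simp
    have "ln (2 / pi) = ln (4 / pi) - ln 2" using ln_realpow[of 2 2] by (simp add: ln_div)
    also have "ln (2::real) = 5 * ln t" unfolding t_def by (intro ln_powr_fifth) auto
    finally have "ln (2 * real g / pi) = ln (4 / pi) + 5 * ln (s / t)" using lng s_pos t by (simp add: ln_div)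
    moreover have "ln (4 / pi) \<ge> 0.2146" using ln_ge[of "4 / pi"] pi_approx by simp
    moreover have "ln (s / t) \<ge> 1 - t / s" using ln_ge[of "s / t"] s_pos t by simp
    ultimately have "ln (2 * real g / pi) + 1 + c \<ge> 0.5896 + 5 * (1 - t / s)" using c by simp
    then have "A * (ln (2 * real g / pi) + 1 + c) \<ge> A * (0.5896 + 5 * (1 - t / s))"
      using A by (intro mult_left_mono) auto
    moreover have "A * (0.5896 + 5 * (1 - t / s)) = A * 0.5896 + (s - t) * (5 * A / s)"
      using s_pos by (simp add: field_simps)
    ultimately have "C_const g \<ge> A * 0.5896 + (s - t) * (5 * A / s) + 1"
      using C by linarith
    moreover have "(s - t) * (5 * A / s) \<ge> (s - t) * 0.958"
    proof (intro mult_left_mono)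
      have "0.958 * s \<le> 5 * A" using s_le A by simp
      then show "0.958 \<le> 5 * A / s" using s_pos by (simp add: pos_le_divide_eq)
    qed (use ts in auto)
    ultimately show ?thesis using A t s_le by (simp add: s_def[symmetric])
  next
    case False
    define t :: real where "t = 31698 powr (1/5)"
    have t: "t \<le> 7.9470579" unfolding t_def
      by (rule powr_fifth_le) (simp_all add: power_numeral_reduce)
    have t': "t \<ge> 7.947" unfolding t_def
      by (rule powr_fifth_ge) (simp_all add: power_numeral_reduce)
    note t = t t'
    have ts: "s \<le> t" unfolding t_def s_def using g by (intro powr_mono2) auto
    have s_ge: "s \<ge> 3.3" unfolding s_def using False by (intro powr_fifth_ge) (auto simp: power_numeral_reduce)
    have "ln (2 / pi) = ln (2 * 31698 / pi) - ln 31698" using ln_mult[of "2 / pi" 31698] by simp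
    also have "ln (31698::real) = 5 * ln t" unfolding t_def by (intro ln_powr_fifth) auto
    finally have "ln (2 * real g / pi) = ln (2 * 31698 / pi) + 5 * ln (s / t)" using lng s_pos t by (simp add: ln_div)
    moreover have "ln (s / t) \<ge> 1 - t / s" using ln_ge[of "s / t"] s_pos t by simp
    ultimately have "ln (2 * real g / pi) + 1 + c \<ge> (ln (2 * 31698 / pi) + 1) + 5 * (1 - t / s) + c" by simp
    then have "A * (ln (2 * real g / pi) + 1 + c) \<ge> A * ((ln (2 * 31698 / pi) + 1) + 5 * (1 - t / s) + c)"
      using A by (intro mult_left_mono) auto
    also have "A * ((ln (2 * 31698 / pi) + 1) + 5 * (1 - t / s) + c) =
        A * (ln (2 * 31698 / pi) + 1) - (t - s) * (5 * A / s) + A * c"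
      using s_pos by (simp add: field_simps)
    finally have C2: "C_const g \<ge> 7.947065 - (t - s) * (5 * A / s) + A * c"
      using C log_31698 unfolding A_def[symmetric] by linarith
    have ratio: "(t - s) * (5 * A / s) \<le> (t - s) * 0.965"
    proof (intro mult_left_mono)
      have "5 * A \<le> 0.965 * s" using s_ge A by simp
      then show "5 * A / s \<le> 0.965" using s_pos by (simp add: pos_divide_le_eq)
    qed (use ts in auto)
    \<comment> \<open>At 31698 the margin is about 7 / 10 ^ 6, so the cosine correction must be tiny
      there. For \<open>g < 5000\<close> the distance \<open>t - s\<close> gives ample room, and the
      weaker correction from 400 on is enough.\<close>
    show ?thesis
    proof (cases "g < 5000")
      case True
      have "s \<le> 5.5" unfolding s_def using True g by (intro powr_fifth_le) (auto simp: power_numeral_reduce)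
      moreover have "c \<ge> - (2.5 * (1 / 160000))"
        unfolding c_def by (rule ln_cos_lower[of 400]) (use False in auto)
      then have "A * c \<ge> A * (- (2.5 * (1 / 160000)))" using A by (intro mult_left_mono) auto
      ultimately show ?thesis using C2 ratio A t by (simp add: s_def[symmetric])
    next
      case False
      have "c \<ge> - (2.5 * (1 / 25000000))"
        unfolding c_def by (rule ln_cos_lower[of 5000]) (use False in auto)
      then have "A * c \<ge> A * (- (2.5 * (1 / 25000000)))" using A by (intro mult_left_mono) auto
      then show ?thesis using C2 ratio A t ts by (simp add: s_def[symmetric])
    qed
  qed
qed

lemma alpha_const_less_iff:
  assumes "g \<ge> 2"
  shows "alpha_const g < 1 / 5 \<longleftrightarrow> g \<ge> 31699"
proof -
  have g: "ln (real g) > 0" using assms by simp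
  have C: "C_const g > 1" by (rule C_const_gt_1[OF assms])
  have "alpha_const g < 1 / 5 \<longleftrightarrow> ln (C_const g) < ln (real g powr (1/5))"
    using g by (simp add: alpha_const_def field_simps ln_powr)
  also have "\<dots> \<longleftrightarrow> C_const g < real g powr (1/5)"
    using C assms by (intro ln_less_cancel_iff) auto
  also have "\<dots> \<longleftrightarrow> g \<ge> 31699"
    using C_const_less_fifth_root[of g] C_const_ge_fifth_root[OF assms] by (cases "g \<ge> 31699") auto
  finally show ?thesis .
qed

section \<open>The Dirichlet kernel of the digits\<close>

definition dker :: "nat \<Rightarrow> real \<Rightarrow> real" where
  "dker g y = norm (\<Sum>d<g. ee (real d * y))"

lemma dker_nonneg [simp]: "dker g y \<ge> 0"
  by (simp add: dker_def)

lemma dker_le: "dker g y \<le> real g"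
  unfolding dker_def using sum_norm_le[of "{..<g}" "\<lambda>d. ee (real d * y)" "\<lambda>_. 1"] by simp

lemma dker_add_int [simp]: "dker g (y + of_int m) = dker g y"
proof -
  have "ee (real d * (y + of_int m)) = ee (real d * y)" for d
    using ee_of_int[of "int d * m"] by (simp add: distrib_left ee_add)
  then show ?thesis by (simp add: dker_def)
qed

lemma dker_minus [simp]: "dker g (- y) = dker g y"
proof -
  have "(\<Sum>d<g. ee (real d * (- y))) = cnj (\<Sum>d<g. ee (real d * y))"
    by (simp add: ee_minus)
  then show ?thesis unfolding dker_def by (simp only: complex_mod_cnj)
qed

section \<open>The cosecant as a convex majorant\<close>

definition csc_pi :: "real \<Rightarrow> real" where
  "csc_pi y = 1 / sin (pi * y)"

lemma sin_pi_pos: "0 < y \<Longrightarrow> y < 1 \<Longrightarrow> sin (pi * y) > 0"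
  by (rule sin_gt_zero) auto

lemma dker_le_csc: "0 < y \<Longrightarrow> y < 1 \<Longrightarrow> dker g y \<le> csc_pi y"
  using norm_geometric_sum_sin[of y g] sin_pi_pos[of y] by (simp add: dker_def csc_pi_def field_simps)

lemma csc_pi_reflect: "csc_pi (1 - y) = csc_pi y"
  by (simp add: csc_pi_def right_diff_distrib)

lemma csc_pi_mono_interval:
  assumes "0 < q" "q \<le> 1 / 2" "q \<le> y" "y \<le> 1 - q"
  shows "csc_pi y \<le> csc_pi q"
proof -
  have *: "csc_pi y \<le> csc_pi q" if "q \<le> y" "y \<le> 1 / 2" for y
  proof -
    have "sin (pi * q) \<le> sin (pi * y)"
      using that assms by (intro sin_monotone_2pi_le) (auto intro: order.trans[of _ 0])
    then show ?thesis using sin_pi_pos[of q] sin_pi_pos[of y] that assms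
      unfolding csc_pi_def by (intro divide_left_mono) auto
  qed
  show ?thesis
  proof (cases "y \<le> 1 / 2")
    case False
    then show ?thesis using *[of "1 - y"] assms by (simp add: csc_pi_reflect)
  qed (use * assms in auto)
qed

lemma csc_pi_deriv:
  assumes "0 < y" "y < 1"
  shows "(csc_pi has_real_derivative - (pi * cos (pi * y) / (sin (pi * y))\<^sup>2)) (at y)"
  unfolding csc_pi_def[abs_def] using sin_pi_pos[OF assms]
  by (auto intro!: derivative_eq_intros simp: power2_eq_square field_simps)

lemma csc_pi_deriv2:
  assumes "0 < y" "y < 1"
  shows "((\<lambda>y. - (pi * cos (pi * y) / (sin (pi * y))\<^sup>2)) has_real_derivative
    pi\<^sup>2 * ((sin (pi * y))\<^sup>2 + 2 * (cos (pi * y))\<^sup>2) / (sin (pi * y)) ^ 3) (at y)"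
  using sin_pi_pos[OF assms]
  by (auto intro!: derivative_eq_intros simp: power2_eq_square power3_eq_cube field_simps)

lemma convex_csc_pi: "convex_on {0<..<1} csc_pi"
proof (rule f''_ge0_imp_convex)
  show "0 \<le> pi\<^sup>2 * ((sin (pi * y))\<^sup>2 + 2 * (cos (pi * y))\<^sup>2) / (sin (pi * y)) ^ 3" if "y \<in> {0<..<1}" for y
    using sin_pi_pos[of y] that by auto
qed (auto intro!: csc_pi_deriv csc_pi_deriv2)

text \<open>A primitive of \<open>csc_pi\<close>, vanishing at 1/2 and odd about that point.\<close>

definition csc_int :: "real \<Rightarrow> real" where
  "csc_int y = ln (tan (pi * y / 2)) / pi"

lemma csc_int_deriv:
  assumes "0 < y" "y < 1"
  shows "(csc_int has_real_derivative csc_pi y) (at y)"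
proof -
  let ?z = "pi * y / 2"
  have s: "sin ?z > 0" using assms by (intro sin_gt_zero) auto
  have c: "cos ?z > 0" using assms by (intro cos_gt_zero) auto
  have t: "tan ?z > 0" using s c by (simp add: tan_def)
  have "(csc_int has_real_derivative inverse (tan ?z) * (inverse ((cos ?z)\<^sup>2) * (pi / 2)) / pi) (at y)"
    unfolding csc_int_def[abs_def] using t c by (auto intro!: derivative_eq_intros) (subst divide_inverse, rule mult.commute)
  moreover have "sin (pi * y) = 2 * sin ?z * cos ?z" using sin_double[of ?z] by simp
  then have "inverse (tan ?z) * (inverse ((cos ?z)\<^sup>2) * (pi / 2)) / pi = csc_pi y"
    using s c by (simp add: csc_pi_def tan_def field_simps power2_eq_square)
  ultimately show ?thesis by simp
qed

text \<open>The midpoint half of the Hermite-Hadamard inequality for the convex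
  \<open>csc_pi\<close>; the difference of the two sides is nondecreasing in the half-width
  \<open>s\<close>.\<close>

lemma csc_midpoint:
  assumes "0 < m - s" "m + s < 1" "0 \<le> s"
  shows "2 * s * csc_pi m \<le> csc_int (m + s) - csc_int (m - s)"
proof -
  define F where "F = (\<lambda>t. csc_int (m + t) - csc_int (m - t) - 2 * t * csc_pi m)"
  have "F 0 \<le> F s"
  proof (rule DERIV_nonneg_imp_nondecreasing[OF assms(3)])
    fix t assume t: "0 \<le> t" "t \<le> s"
    then have mt: "m + t \<in> {0<..<1}" "m - t \<in> {0<..<1}" using assms by auto
    have "(F has_real_derivative csc_pi (m + t) * 1 - csc_pi (m - t) * (- 1) - 2 * csc_pi m) (at t)"
      unfolding F_def using mt
      by (auto intro!: derivative_eq_intros DERIV_chain'[OF _ csc_int_deriv])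
    moreover have "csc_pi ((1 - 1/2) *\<^sub>R (m + t) + (1/2) *\<^sub>R (m - t)) \<le> (1 - 1/2) * csc_pi (m + t) + 1/2 * csc_pi (m - t)"
      by (rule convex_onD[OF convex_csc_pi]) (use mt in auto)
    ultimately show "\<exists>z. (F has_real_derivative z) (at t) \<and> 0 \<le> z"
      by (intro exI[of _ "csc_pi (m + t) * 1 - csc_pi (m - t) * (- 1) - 2 * csc_pi m"]) (simp add: field_simps)
  qed
  then show ?thesis by (simp add: F_def)
qed

context
  fixes g :: nat
  assumes g: "g \<ge> 2"
begin

text \<open>The argument is the midpoint of the cell from \<open>(j - 1) / g\<close> to
  \<open>j / g\<close>; the cell \<open>j = 1\<close> touches the pole at 0 and is left out.\<close>

lemma csc_cell:
  assumes "2 \<le> j" "j < g"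
  shows "csc_pi ((2 * real j - 1) / (2 * real g)) \<le> real g * (csc_int (real j / real g) - csc_int (real (j - 1) / real g))"
proof -
  have r: "real g > 0" "real j \<ge> 2" "real j < real g" using g assms by auto
  let ?m = "(2 * real j - 1) / (2 * real g)" and ?s = "1 / (2 * real g)"
  have 1: "?m + ?s = real j / real g" using r by (simp add: field_simps)
  have 2: "?m - ?s = real (j - 1) / real g" using r assms by (simp add: field_simps of_nat_diff)
  have "2 * ?s * csc_pi ?m \<le> csc_int (?m + ?s) - csc_int (?m - ?s)"
  proof (rule csc_midpoint)
    show "0 < ?m - ?s" unfolding 2 using r assms by simp
    show "?m + ?s < 1" unfolding 1 using r by simp
  qed (use r in auto)
  then show ?thesis unfolding 1 2 using r by (simp add: field_simps)
qed

lemma csc_cells: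
  assumes "1 \<le> n" "n < g"
  shows "(\<Sum>j=2..n. csc_pi ((2 * real j - 1) / (2 * real g))) \<le> real g * (csc_int (real n / real g) - csc_int (1 / real g))"
  using assms
proof (induction n rule: dec_induct)
  case (step n)
  have "(\<Sum>j=2..Suc n. csc_pi ((2 * real j - 1) / (2 * real g))) =
      (\<Sum>j=2..n. csc_pi ((2 * real j - 1) / (2 * real g))) + csc_pi ((2 * real (Suc n) - 1) / (2 * real g))"
    using step by simp
  also have "\<dots> \<le> real g * (csc_int (real n / real g) - csc_int (1 / real g)) +
      real g * (csc_int (real (Suc n) / real g) - csc_int (real (Suc n - 1) / real g))"
    using step by (intro add_mono csc_cell) auto
  finally show ?case by (simp add: algebra_simps)
qed auto

definition lncot :: real where
  "lncot = ln (cot (pi / (2 * real g)))"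

lemma csc_int_first: "csc_int (1 / real g) = - lncot / pi"
  by (simp add: csc_int_def lncot_def cot_altdef ln_inverse mult.commute)

lemma csc_int_last: "csc_int (real (g - 1) / real g) = lncot / pi"
proof -
  have "pi * (real (g - 1) / real g) / 2 = pi / 2 - pi / (2 * real g)"
    using g by (simp add: of_nat_diff field_simps)
  then have "tan (pi * (real (g - 1) / real g) / 2) = cot (pi / (2 * real g))"
    by (simp only: tan_def cot_def sin_diff cos_diff) simp
  then show ?thesis by (simp add: csc_int_def lncot_def)
qed

text \<open>The origin of \<open>C_const\<close>: the peak of the kernel gives \<open>g\<close>, the
  cell at the pole gives one cosecant value, and \<open>g\<close> times the integral over the other
  cells gives the rest.\<close>

lemma C_const_lncot: "real g * C_const g = real g + csc_pi (1 / (2 * real g)) + 2 * real g / pi * lncot"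
  using g by (simp add: C_const_def lncot_def csc_pi_def field_simps)

lemma csc_grid_sum:
  "(\<Sum>d=1..g-1. csc_pi ((2 * real d - 1) / (2 * real g))) \<le> csc_pi (1 / (2 * real g)) + 2 * real g / pi * lncot"
proof -
  have "(\<Sum>d=1..g-1. csc_pi ((2 * real d - 1) / (2 * real g))) =
      csc_pi (1 / (2 * real g)) + (\<Sum>d=2..g-1. csc_pi ((2 * real d - 1) / (2 * real g)))"
    using g by (subst sum.atLeast_Suc_atMost) (auto simp: numeral_2_eq_2)
  also have "(\<Sum>d=2..g-1. csc_pi ((2 * real d - 1) / (2 * real g))) \<le>
      real g * (csc_int (real (g - 1) / real g) - csc_int (1 / real g))"
    using g by (intro csc_cells) auto
  also have "\<dots> = 2 * real g / pi * lncot" unfolding csc_int_first csc_int_last by (simp add: field_simps)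
  finally show ?thesis by simp
qed

lemma dker_sum_shift1: "(\<Sum>d<g. dker g (u + 1 / real g + real d / real g)) = (\<Sum>d<g. dker g (u + real d / real g))"
proof -
  let ?F = "\<lambda>d. dker g (u + real d / real g)"
  have "(\<Sum>d<g. dker g (u + 1 / real g + real d / real g)) = (\<Sum>d<g. ?F (Suc d))"
    by (simp add: add_divide_distrib add_ac)
  also have "\<dots> = (\<Sum>d<Suc g. ?F d) - ?F 0" by (subst sum.lessThan_Suc_shift) simp
  also have "\<dots> = (\<Sum>d<g. ?F d) + ?F g - ?F 0" by simp
  also have "?F g = ?F 0" using g dker_add_int[of g u 1] by simp
  finally show ?thesis by simp
qed

lemma dker_sum_shift: "(\<Sum>d<g. dker g (u + of_int k / real g + real d / real g)) = (\<Sum>d<g. dker g (u + real d / real g))"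
proof -
  have nat: "(\<Sum>d<g. dker g (u + real n / real g + real d / real g)) = (\<Sum>d<g. dker g (u + real d / real g))" for u n
  proof (induction n arbitrary: u)
    case (Suc n)
    have eq: "u + real (Suc n) / real g = (u + real n / real g) + 1 / real g" by (simp add: add_divide_distrib)
    show ?case unfolding eq dker_sum_shift1 by (rule Suc)
  qed simp
  show ?thesis
  proof (cases "k \<ge> 0")
    case True
    then show ?thesis using nat[of u "nat k"] by simp
  next
    case False
    then show ?thesis using nat[of "u + of_int k / real g" "nat (- k)"] by simp
  qed
qed

text \<open>After a reflection and a shift by a multiple of \<open>1 / g\<close>, the offset
  \<open>v\<close> is at most half a step. Each point then divides the segment between its two
  neighbouring cell midpoints in the same ratio \<open>l\<close>, so convexity reduces the sum to
  two midpoint sums, and these agree under \<open>y\<close> to \<open>1 - y\<close>.\<close>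

lemma dker_sum_le: "(\<Sum>d<g. dker g (u - real d / real g)) \<le> real g * C_const g"
proof -
  define k where "k = round (real g * u)"
  define v where "v = - (u - of_int k / real g)"
  have gr: "real g > 0" using g by simp
  have v: "\<bar>v\<bar> \<le> 1 / (2 * real g)"
  proof -
    have "\<bar>real g * u - of_int k\<bar> \<le> 1 / 2" using of_int_round_abs_le[of "real g * u"] by (simp add: k_def abs_minus_commute)
    moreover have "real g * u - of_int k = - (real g * v)" using gr by (simp add: v_def field_simps)
    ultimately have "\<bar>real g * v\<bar> \<le> 1 / 2" by simp
    then show ?thesis using gr by (simp add: abs_mult field_simps)
  qed
  define l where "l = 1/2 + real g * v"
  have l: "0 \<le> l" "l \<le> 1" using v gr by (auto simp: l_def abs_le_iff field_simps)
  have "(\<Sum>d<g. dker g (u - real d / real g)) = (\<Sum>d<g. dker g (- u + real d / real g))"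
    by (intro sum.cong refl) (metis dker_minus minus_diff_eq uminus_add_conv_diff)
  also have "- u = v + of_int (- k) / real g" by (simp add: v_def)
  also have "(\<Sum>d<g. dker g (v + of_int (- k) / real g + real d / real g)) = (\<Sum>d<g. dker g (v + real d / real g))"
    by (rule dker_sum_shift)
  also have "\<dots> = dker g v + (\<Sum>d=1..g-1. dker g (v + real d / real g))"
  proof -
    have "{..<g} = insert 0 {1..g-1}" using g by auto
    then show ?thesis by simp
  qed
  also have "\<dots> \<le> real g + (\<Sum>d=1..g-1. (1 - l) * csc_pi ((2 * real d - 1) / (2 * real g)) + l * csc_pi ((2 * real d + 1) / (2 * real g)))"
  proof (intro add_mono dker_le sum_mono)
    fix d assume d: "d \<in> {1..g-1}"
    have dr: "real d \<ge> 1" "real d \<le> real g - 1" using d g by (auto simp: of_nat_diff le_diff_conv2)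
    define y1 where "y1 = (2 * real d - 1) / (2 * real g)"
    define y2 where "y2 = (2 * real d + 1) / (2 * real g)"
    have y: "y1 \<in> {0<..<1}" "y2 \<in> {0<..<1}" using dr gr by (auto simp: y1_def y2_def field_simps)
    have eq: "v + real d / real g = (1 - l) * y1 + l * y2" using gr by (simp add: y1_def y2_def l_def field_simps)
    have "v + real d / real g \<in> {0<..<1}"
    proof -
      have "0 < real d / real g - 1 / (2 * real g)" "real d / real g + 1 / (2 * real g) < 1" using dr gr by (auto simp: field_simps)
      then show ?thesis using v by (auto simp: abs_le_iff)
    qed
    then have "dker g (v + real d / real g) \<le> csc_pi (v + real d / real g)" by (intro dker_le_csc) auto
    also have "\<dots> \<le> (1 - l) * csc_pi y1 + l * csc_pi y2"
      unfolding eq using convex_onD[OF convex_csc_pi l y] by simp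
    finally show "dker g (v + real d / real g) \<le> (1 - l) * csc_pi ((2 * real d - 1) / (2 * real g)) + l * csc_pi ((2 * real d + 1) / (2 * real g))"
      by (simp add: y1_def y2_def)
  qed
  also have "(\<Sum>d=1..g-1. (1 - l) * csc_pi ((2 * real d - 1) / (2 * real g)) + l * csc_pi ((2 * real d + 1) / (2 * real g))) =
     (1 - l) * (\<Sum>d=1..g-1. csc_pi ((2 * real d - 1) / (2 * real g))) + l * (\<Sum>d=1..g-1. csc_pi ((2 * real d + 1) / (2 * real g)))"
    by (simp only: sum.distrib sum_distrib_left)
  also have "(\<Sum>d=1..g-1. csc_pi ((2 * real d + 1) / (2 * real g))) = (\<Sum>d=1..g-1. csc_pi ((2 * real d - 1) / (2 * real g)))"
  proof (rule sum.reindex_bij_witness[of _ "\<lambda>d. g - d" "\<lambda>d. g - d"], goal_cases)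
    case (5 d)
    then have "real (g - d) = real g - real d" by (intro of_nat_diff) auto
    then have "(2 * real (g - d) - 1) / (2 * real g) = 1 - (2 * real d + 1) / (2 * real g)"
      using gr by (simp add: field_simps)
    then show ?case by (simp only: csc_pi_reflect)
  qed (use g in auto)
  also have "(1 - l) * (\<Sum>d=1..g-1. csc_pi ((2 * real d - 1) / (2 * real g))) + l * (\<Sum>d=1..g-1. csc_pi ((2 * real d - 1) / (2 * real g))) =
     (\<Sum>d=1..g-1. csc_pi ((2 * real d - 1) / (2 * real g)))" by (simp add: algebra_simps)
  also have "\<dots> \<le> csc_pi (1 / (2 * real g)) + 2 * real g / pi * lncot" by (rule csc_grid_sum)
  finally show ?thesis unfolding C_const_lncot by simp
qed

lemma csc_half_grid_sum:
  assumes "2 * m \<le> g"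
  shows "(\<Sum>j=1..m. csc_pi (real j / real g)) \<le> real g / 2 + real g / pi * lncot"
proof (cases "m = 0")
  case True
  have "0 \<le> lncot"
  proof -
    have "tan (pi / (2 * real g)) \<le> tan (pi / 4)"
      using g by (intro tan_mono_le) (auto simp: field_simps intro: order.strict_trans[of _ 0])
    moreover have "tan (pi / (2 * real g)) > 0" using g by (intro tan_gt_zero) (auto simp: field_simps)
    ultimately show ?thesis unfolding lncot_def cot_altdef by (auto simp: tan_45 one_le_inverse)
  qed
  then show ?thesis using True by simp
next
  case False
  have gr: "real g \<ge> 2" using g by simp
  have 1: "(\<Sum>j=1..m. csc_pi (real j / real g)) = csc_pi (1 / real g) + (\<Sum>j=2..m. csc_pi (real j / real g))"
    using False by (subst sum.atLeast_Suc_atMost) (auto simp: numeral_2_eq_2)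
  have 2: "csc_pi (1 / real g) \<le> real g / 2"
  proof -
    have "sin (pi * (1 / real g)) \<ge> 2 * (1 / real g)" using gr by (intro sin_ge_linear) auto
    then have "csc_pi (1 / real g) \<le> 1 / (2 * (1 / real g))"
      unfolding csc_pi_def using gr by (intro divide_left_mono) (auto intro!: mult_pos_pos sin_gt_zero simp: field_simps)
    then show ?thesis by simp
  qed
  have "(\<Sum>j=2..m. csc_pi (real j / real g)) \<le> (\<Sum>j=2..m. csc_pi ((2 * real j - 1) / (2 * real g)))"
  proof (rule sum_mono)
    fix j assume j: "j \<in> {2..m}"
    have "real (2 * j) \<le> real g" using j assms by (simp only: of_nat_le_iff) auto
    then have jr: "real j \<ge> 2" "2 * real j \<le> real g" using j by auto
    show "csc_pi (real j / real g) \<le> csc_pi ((2 * real j - 1) / (2 * real g))"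
      using jr gr by (intro csc_pi_mono_interval) (auto simp: field_simps)
  qed
  also have "\<dots> \<le> real g * (csc_int (real m / real g) - csc_int (1 / real g))"
    using False assms g by (intro csc_cells) auto
  finally have 3: "(\<Sum>j=2..m. csc_pi (real j / real g)) \<le> real g * (csc_int (real m / real g) - csc_int (1 / real g))" .
  have "csc_int (real m / real g) \<le> 0"
  proof -
    have "real (2 * m) \<le> real g" using assms by (simp only: of_nat_le_iff)
    then have mr: "2 * real m \<le> real g" "real m \<ge> 1" using False by auto
    have "pi * (real m / real g) / 2 \<le> pi / 4" using mr gr by (simp add: field_simps)
    moreover have "pi * (real m / real g) / 2 > 0" using mr gr by simp
    moreover have "pi / 4 < pi / 2" by simp
    ultimately have "tan (pi * (real m / real g) / 2) \<le> tan (pi / 4)" "tan (pi * (real m / real g) / 2) > 0"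
      by (auto intro!: tan_mono_le tan_gt_zero intro: order.strict_trans[of _ 0])
    then show ?thesis by (simp add: csc_int_def tan_45 divide_nonpos_pos)
  qed
  then have "real g * (csc_int (real m / real g) - csc_int (1 / real g)) \<le> real g * (0 - csc_int (1 / real g))"
    using gr by (intro mult_left_mono) auto
  also have "\<dots> = real g / pi * lncot" unfolding csc_int_first by simp
  finally show ?thesis using 1 2 3 by linarith
qed

lemma dker_cell_bound:
  assumes "d \<le> g - 2" "real d / real g \<le> y" "y \<le> (real d + 2) / real g"
  shows "dker g y \<le> (let j = min d (g - 2 - d) in if j = 0 then real g else csc_pi (real j / real g))"
proof -
  define j where "j = min d (g - 2 - d)"
  have gr: "real g > 0" using g by simp
  show ?thesis
  proof (cases "j = 0")
    case True
    then show ?thesis unfolding Let_def j_def[symmetric] using dker_le[of g y] by simp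
  next
    case False
    have jr: "real j \<ge> 1" "real j \<le> real d" "real j \<le> real g - 2 - real d" "2 * real j \<le> real g"
      using False assms g by (auto simp: j_def of_nat_diff)
    have "real j / real g \<le> real d / real g" using jr gr by (intro divide_right_mono) auto
    then have 1: "real j / real g \<le> y" using assms by linarith
    have "y \<le> (real d + 2) / real g" by fact
    also have "\<dots> \<le> (real g - real j) / real g" using jr gr by (intro divide_right_mono) auto
    also have "\<dots> = 1 - real j / real g" using gr by (simp add: diff_divide_distrib)
    finally have 2: "y \<le> 1 - real j / real g" .
    have 3: "0 < real j / real g" "real j / real g \<le> 1 / 2" using jr gr by (auto simp: field_simps)
    have "dker g y \<le> csc_pi y" using 1 2 3 by (intro dker_le_csc) auto
    also have "\<dots> \<le> csc_pi (real j / real g)" using 1 2 3 by (intro csc_pi_mono_interval) auto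
    finally show ?thesis unfolding Let_def j_def[symmetric] using False by simp
  qed
qed

text \<open>Each \<open>d\<close> may choose its own displacement, so a point is known only up to a
  cell of length \<open>2 / g\<close>. Three cells can touch an integer and cost \<open>g\<close>
  each; the others pair off around 1/2 and are bounded by \<open>csc_half_grid_sum\<close>. In total
  this is at most \<open>3 * g\<close> above the bound of \<open>dker_sum_le\<close>.\<close>

lemma dker_sum_sup_le:
  assumes \<tau>: "\<And>d. d < g \<Longrightarrow> 0 \<le> \<tau> d \<and> \<tau> d \<le> 1"
  shows "(\<Sum>d<g. dker g (u - (real d + \<tau> d) / real g)) \<le> real g * (C_const g + 3)"
proof -
  define k where "k = \<lfloor>real g * (- u)\<rfloor>"
  define \<omega> where "\<omega> = real g * (- u) - of_int k"
  have gr: "real g \<ge> 2" using g by simp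
  have \<omega>: "0 \<le> \<omega>" "\<omega> < 1" unfolding \<omega>_def k_def by linarith+
  define \<sigma> where "\<sigma> = (\<lambda>d. nat ((k + int d) mod int g))"
  define hh where "hh = (\<lambda>j. if j = 0 then real g else csc_pi (real j / real g))"
  define B where "B = (\<lambda>d. if d = g - 1 then real g else hh (min d (g - 2 - d)))"
  have \<sigma>_less: "\<sigma> d < g" for d using g by (simp add: \<sigma>_def nat_less_iff)
  have inj: "inj_on \<sigma> {..<g}"
  proof (rule inj_onI)
    fix i j assume ij: "i \<in> {..<g}" "j \<in> {..<g}" "\<sigma> i = \<sigma> j"
    have "(k + int i) mod int g \<ge> 0" "(k + int j) mod int g \<ge> 0" using g by auto
    then have "[k + int i = k + int j] (mod int g)" using ij(3) unfolding cong_def \<sigma>_def by (simp only: eq_nat_nat_iff)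
    then have "[int i = int j] (mod int g)" by (simp add: cong_add_lcancel)
    then show "i = j" using ij by (simp add: cong_int_iff cong_def)
  qed
  then have bij: "bij_betw \<sigma> {..<g} {..<g}"
    unfolding bij_betw_def using \<sigma>_less by (intro conjI endo_inj_surj) auto
  have "(\<Sum>d<g. dker g (u - (real d + \<tau> d) / real g)) \<le> (\<Sum>d<g. B (\<sigma> d))"
  proof (rule sum_mono)
    fix d assume d: "d \<in> {..<g}"
    define q where "q = (k + int d) div int g"
    have dec: "k + int d = int (\<sigma> d) + int g * q" using g by (simp add: \<sigma>_def q_def)
    then have decr: "of_int k + real d = real (\<sigma> d) + real g * of_int q"
      by (metis of_int_add of_int_mult of_int_of_nat_eq)
    define y where "y = (real (\<sigma> d) + \<omega> + \<tau> d) / real g"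
    have "- (u - (real d + \<tau> d) / real g) = (of_int k + real d + \<omega> + \<tau> d) / real g"
      using gr by (simp add: \<omega>_def field_simps)
    also have "\<dots> = y + of_int q" unfolding decr using gr by (simp add: y_def field_simps)
    finally have "dker g (- (u - (real d + \<tau> d) / real g)) = dker g (y + of_int q)" by (rule arg_cong)
    then have eq: "dker g (u - (real d + \<tau> d) / real g) = dker g y"
      by (simp only: dker_add_int dker_minus)
    show "dker g (u - (real d + \<tau> d) / real g) \<le> B (\<sigma> d)"
    proof (cases "\<sigma> d = g - 1")
      case True
      then show ?thesis using dker_le by (simp add: B_def)
    next
      case False
      then have "\<sigma> d \<le> g - 2" using \<sigma>_less[of d] by linarith
      moreover have "real (\<sigma> d) / real g \<le> y" "y \<le> (real (\<sigma> d) + 2) / real g"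
        unfolding y_def using \<omega> \<tau>[of d] d gr by (auto intro!: divide_right_mono)
      ultimately have "dker g y \<le> hh (min (\<sigma> d) (g - 2 - \<sigma> d))"
        using dker_cell_bound[of "\<sigma> d" y] by (simp add: hh_def Let_def)
      then show ?thesis unfolding eq using False by (simp add: B_def)
    qed
  qed
  also have "\<dots> = (\<Sum>d<g. B d)" by (rule sum.reindex_bij_betw[OF bij])
  also have "\<dots> \<le> real g + 2 * (\<Sum>j\<le>(g - 2) div 2. hh j)"
  proof -
    define m where "m = (g - 2) div 2"
    have hh0: "hh j \<ge> 0" if "j \<le> m" for j
    proof (cases "j = 0")
      case False
      have "real j / real g < 1" using that g by (auto simp: m_def field_simps)
      then show ?thesis using False sin_pi_pos[of "real j / real g"] g by (auto simp: hh_def csc_pi_def)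
    qed (simp add: hh_def)
    have split: "{..<g} = {g - 1} \<union> ({d. d \<le> g - 2 \<and> d \<le> g - 2 - d} \<union> {d. d \<le> g - 2 \<and> g - 2 - d < d})"
      using g by auto
    have "(\<Sum>d<g. B d) = B (g - 1) + ((\<Sum>d | d \<le> g - 2 \<and> d \<le> g - 2 - d. B d) + (\<Sum>d | d \<le> g - 2 \<and> g - 2 - d < d. B d))"
    proof -
      let ?S1 = "{d. d \<le> g - 2 \<and> d \<le> g - 2 - d}" and ?S2 = "{d. d \<le> g - 2 \<and> g - 2 - d < d}"
      have "(\<Sum>d\<in>{g - 1} \<union> (?S1 \<union> ?S2). B d) = (\<Sum>d\<in>{g - 1}. B d) + (\<Sum>d\<in>?S1 \<union> ?S2. B d)"
        using g by (intro sum.union_disjoint) auto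
      moreover have "(\<Sum>d\<in>?S1 \<union> ?S2. B d) = (\<Sum>d\<in>?S1. B d) + (\<Sum>d\<in>?S2. B d)"
        by (intro sum.union_disjoint) auto
      ultimately show ?thesis unfolding split by (simp only: sum.insert_if sum.empty finite.emptyI empty_iff if_False add_0_right)
    qed
    moreover have "B (g - 1) = real g" by (simp add: B_def)
    moreover have "(\<Sum>d | d \<le> g - 2 \<and> d \<le> g - 2 - d. B d) \<le> (\<Sum>j\<le>m. hh j)"
    proof -
      have "(\<Sum>d | d \<le> g - 2 \<and> d \<le> g - 2 - d. B d) = (\<Sum>d | d \<le> g - 2 \<and> d \<le> g - 2 - d. hh d)"
      using g by (intro sum.cong) (auto simp: B_def min_def)
      also have "\<dots> \<le> (\<Sum>j\<le>m. hh j)" by (intro sum_mono2 hh0) (auto simp: m_def)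
      finally show ?thesis .
    qed
    moreover have "(\<Sum>d | d \<le> g - 2 \<and> g - 2 - d < d. B d) \<le> (\<Sum>j\<le>m. hh j)"
    proof -
      have "(\<Sum>d | d \<le> g - 2 \<and> g - 2 - d < d. B d) = (\<Sum>d | d \<le> g - 2 \<and> g - 2 - d < d. hh (g - 2 - d))"
      using g by (intro sum.cong) (auto simp: B_def min_def)
    also have "\<dots> = (\<Sum>j\<in>(\<lambda>d. g - 2 - d) ` {d. d \<le> g - 2 \<and> g - 2 - d < d}. hh j)"
      by (subst sum.reindex) (auto simp: inj_on_def)
      also have "\<dots> \<le> (\<Sum>j\<le>m. hh j)" by (intro sum_mono2 hh0) (auto simp: m_def)
      finally show ?thesis .
    qed
    ultimately show ?thesis unfolding m_def by linarith
  qed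
  finally have 1: "(\<Sum>d<g. dker g (u - (real d + \<tau> d) / real g)) \<le> real g + 2 * (\<Sum>j\<le>(g - 2) div 2. hh j)" .
  have 2: "(\<Sum>j\<le>(g - 2) div 2. hh j) = real g + (\<Sum>j=1..(g - 2) div 2. csc_pi (real j / real g))"
  proof -
    have "{..(g - 2) div 2} = insert 0 {1..(g - 2) div 2}" by auto
    then have "(\<Sum>j\<le>(g - 2) div 2. hh j) = hh 0 + (\<Sum>j=1..(g - 2) div 2. hh j)" by simp
    then show ?thesis by (simp add: hh_def)
  qed
  have 3: "(\<Sum>j=1..(g - 2) div 2. csc_pi (real j / real g)) \<le> real g / 2 + real g / pi * lncot"
    by (rule csc_half_grid_sum) auto
  have "z \<le> 4 * a + 2 * w" if "z \<le> a + 2 * s" "s = a + c" "c \<le> a / 2 + w" for z a s c w :: real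
    using that by simp
  from this[OF 1 2 3] have 4: "(\<Sum>d<g. dker g (u - (real d + \<tau> d) / real g)) \<le> 4 * real g + 2 * real g / pi * lncot"
    by simp
  have 5: "csc_pi (1 / (2 * real g)) \<ge> 0"
    unfolding csc_pi_def using gr sin_pi_pos[of "1 / (2 * real g)"] by simp
  have "z \<le> b + a * 3" if "z \<le> 4 * a + w" "b = a + c + w" "c \<ge> 0" for z a b c w :: real
    using that by simp
  from this[OF 4 C_const_lncot 5] show ?thesis by (simp only: distrib_left)
qed

section \<open>Norms of products of kernels, by induction on the number of digits\<close>

lemma power_digit_split:
  "(real (b1 * g + d) + t) * real g ^ i / real g ^ Suc J = (real b1 + (real d + t) / real g) * real g ^ i / real g ^ J"
proof -
  have "real (b1 * g + d) + t = real g * (real b1 + (real d + t) / real g)"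
    using g by (simp add: field_simps)
  then show ?thesis using g by (simp add: mult.assoc)
qed

lemma power_digit_split_top:
  "(real (b1 * g + d) + t) * real g ^ J / real g ^ Suc J = real b1 + (real d + t) / real g"
  unfolding power_digit_split using g by simp

lemma sum_digit_split:
  fixes F :: "nat \<Rightarrow> real"
  shows "(\<Sum>b<g ^ Suc J. F b) = (\<Sum>d<g. \<Sum>b1<g ^ J. F (b1 * g + d))"
proof -
  have "(\<Sum>b<g ^ Suc J. F b) = (\<Sum>b<g ^ J * g. F b)" by (simp add: mult.commute)
  also have "\<dots> = (\<Sum>b1<g ^ J. \<Sum>b\<in>{b1 * g..<b1 * g + g}. F b)" by (rule sum.nat_group[symmetric])
  also have "\<dots> = (\<Sum>b1<g ^ J. \<Sum>d<g. F (b1 * g + d))"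
  proof (rule sum.cong[OF refl])
    show "(\<Sum>b\<in>{b1 * g..<b1 * g + g}. F b) = (\<Sum>d<g. F (b1 * g + d))" for b1
      by (rule sum.reindex_bij_witness[of _ "\<lambda>d. b1 * g + d" "\<lambda>b. b - b1 * g"]) auto
  qed
  also have "\<dots> = (\<Sum>d<g. \<Sum>b1<g ^ J. F (b1 * g + d))" by (rule sum.swap)
  finally show ?thesis .
qed

text \<open>With \<open>b = b1 * g + d\<close> the last factor depends on \<open>d\<close> only,
  because \<open>b1\<close> contributes an integer, while in the other factors \<open>d\<close>
  merely shifts the phases. The arbitrary sequence \<open>\<theta>\<close> absorbs this shift in the
  induction.\<close>

theorem dker_prod_L1:
  "(\<Sum>b<g ^ J. \<Prod>i<J. dker g (\<theta> i - real b * real g ^ i / real g ^ J)) \<le> (real g * C_const g) ^ J"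
proof (induction J arbitrary: \<theta>)
  case (Suc J)
  have gr: "real g > 0" using g by simp
  have C0: "real g * C_const g \<ge> 0"
    by (rule order.trans[OF _ dker_sum_le[of 0]]) (auto intro!: sum_nonneg)
  have "(\<Sum>b<g ^ Suc J. \<Prod>i<Suc J. dker g (\<theta> i - real b * real g ^ i / real g ^ Suc J)) =
      (\<Sum>d<g. \<Sum>b1<g ^ J. \<Prod>i<Suc J. dker g (\<theta> i - real (b1 * g + d) * real g ^ i / real g ^ Suc J))"
    by (rule sum_digit_split)
  also have "\<dots> = (\<Sum>d<g. dker g (\<theta> J - real d / real g) *
      (\<Sum>b1<g ^ J. \<Prod>i<J. dker g ((\<theta> i - real d / real g * real g ^ i / real g ^ J) - real b1 * real g ^ i / real g ^ J)))"
    unfolding sum_distrib_left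
  proof (intro sum.cong refl)
    fix d b1
    have 1: "dker g (\<theta> J - real (b1 * g + d) * real g ^ J / real g ^ Suc J) = dker g (\<theta> J - real d / real g)"
    proof -
      have "\<theta> J - real (b1 * g + d) * real g ^ J / real g ^ Suc J = (\<theta> J - real d / real g) + of_int (- int b1)"
        using power_digit_split_top[of b1 d 0 J] by simp
      then show ?thesis by (simp only: dker_add_int)
    qed
    have 2: "\<theta> i - real (b1 * g + d) * real g ^ i / real g ^ Suc J =
        (\<theta> i - real d / real g * real g ^ i / real g ^ J) - real b1 * real g ^ i / real g ^ J" for i
      using power_digit_split[of b1 d 0 i J] by (simp only: add_0_right distrib_right add_divide_distrib)
    show "(\<Prod>i<Suc J. dker g (\<theta> i - real (b1 * g + d) * real g ^ i / real g ^ Suc J)) =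
        dker g (\<theta> J - real d / real g) *
        (\<Prod>i<J. dker g ((\<theta> i - real d / real g * real g ^ i / real g ^ J) - real b1 * real g ^ i / real g ^ J))"
      unfolding prod.lessThan_Suc 1 unfolding 2 by (rule mult.commute)
  qed
  also have "\<dots> \<le> (\<Sum>d<g. dker g (\<theta> J - real d / real g) * (real g * C_const g) ^ J)"
    by (intro sum_mono mult_left_mono Suc.IH) auto
  also have "\<dots> = (\<Sum>d<g. dker g (\<theta> J - real d / real g)) * (real g * C_const g) ^ J"
    by (simp only: sum_distrib_right)
  also have "\<dots> \<le> (real g * C_const g) * (real g * C_const g) ^ J"
    using C0 by (intro mult_right_mono dker_sum_le) auto
  finally show ?case by simp
qed auto

text \<open>Every \<open>b\<close> carries its own displacement \<open>T b\<close>. In the lower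
  factors \<open>(d + T b) / g\<close> becomes a new displacement of \<open>b1\<close>, again in
  [0, 1]; in the last factor the dependence on \<open>b1\<close> is removed by taking the worst
  displacement \<open>\<tau> d\<close>, which is why the one-digit bound has a free
  \<open>\<tau>\<close>.\<close>

theorem dker_prod_L1_sup:
  assumes "\<And>b. 0 \<le> T b \<and> T b \<le> 1"
  shows "(\<Sum>b<g ^ J. \<Prod>i<J. dker g (\<theta> i - (real b + T b) * real g ^ i / real g ^ J)) \<le> (real g * (C_const g + 3)) ^ J"
  using assms
proof (induction J arbitrary: T)
  case (Suc J)
  have gr: "real g > 0" using g by simp
  have C0: "real g * (C_const g + 3) \<ge> 0"
    by (rule order.trans[OF _ dker_sum_sup_le[of "\<lambda>_. 0" 0]]) (auto intro!: sum_nonneg)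
  have "\<exists>t. (0 \<le> t \<and> t \<le> 1) \<and> (\<forall>b1<g ^ J. dker g (\<theta> J - (real d + T (b1 * g + d)) / real g) \<le> dker g (\<theta> J - (real d + t) / real g))" for d
  proof -
    let ?S = "(\<lambda>b1. dker g (\<theta> J - (real d + T (b1 * g + d)) / real g)) ` {..<g ^ J}"
    have "0 \<in> {..<g ^ J}" using g by simp
    then have fin: "finite ?S" "?S \<noteq> {}" by blast+
    from Max_in[OF fin] obtain b1 where "b1 < g ^ J" "Max ?S = dker g (\<theta> J - (real d + T (b1 * g + d)) / real g)"
      by (elim imageE) simp
    then have "dker g (\<theta> J - (real d + T (b * g + d)) / real g) \<le> dker g (\<theta> J - (real d + T (b1 * g + d)) / real g)"
      if "b < g ^ J" for b
      using that Max_ge[OF fin(1), of "dker g (\<theta> J - (real d + T (b * g + d)) / real g)"] by auto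
    then show ?thesis using Suc.prems[of "b1 * g + d"] by blast
  qed
  then obtain \<tau> where \<tau>: "\<And>d. 0 \<le> \<tau> d \<and> \<tau> d \<le> 1"
    "\<And>d b1. b1 < g ^ J \<Longrightarrow> dker g (\<theta> J - (real d + T (b1 * g + d)) / real g) \<le> dker g (\<theta> J - (real d + \<tau> d) / real g)"
    by metis
  \<comment> \<open>The value 0 for \<open>d \<ge> g\<close> keeps \<open>T' d\<close> within [0, 1]
    for every \<open>d\<close>.\<close>
  define T' where "T' = (\<lambda>d b1. if d < g then (real d + T (b1 * g + d)) / real g else 0)"
  have T': "0 \<le> T' d b1 \<and> T' d b1 \<le> 1" for d b1
  proof (cases "d < g")
    case True
    then have "real d + 1 \<le> real g" by linarith
    then have "real d + T (b1 * g + d) \<le> real g" using Suc.prems[of "b1 * g + d"] by linarith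
    then show ?thesis using Suc.prems[of "b1 * g + d"] gr True by (simp add: T'_def)
  qed (simp add: T'_def)
  have "(\<Sum>b<g ^ Suc J. \<Prod>i<Suc J. dker g (\<theta> i - (real b + T b) * real g ^ i / real g ^ Suc J)) =
      (\<Sum>d<g. \<Sum>b1<g ^ J. \<Prod>i<Suc J. dker g (\<theta> i - (real (b1 * g + d) + T (b1 * g + d)) * real g ^ i / real g ^ Suc J))"
    by (rule sum_digit_split)
  also have "\<dots> \<le> (\<Sum>d<g. \<Sum>b1<g ^ J. dker g (\<theta> J - (real d + \<tau> d) / real g) *
      (\<Prod>i<J. dker g (\<theta> i - (real b1 + T' d b1) * real g ^ i / real g ^ J)))"
  proof (intro sum_mono)
    fix d b1 assume d: "d \<in> {..<g}" and b1: "b1 \<in> {..<g ^ J}"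
    have 1: "dker g (\<theta> J - (real (b1 * g + d) + T (b1 * g + d)) * real g ^ J / real g ^ Suc J) =
        dker g (\<theta> J - (real d + T (b1 * g + d)) / real g)"
    proof -
      have "\<theta> J - (real (b1 * g + d) + T (b1 * g + d)) * real g ^ J / real g ^ Suc J =
          (\<theta> J - (real d + T (b1 * g + d)) / real g) + of_int (- int b1)"
        unfolding power_digit_split_top by simp
      then show ?thesis by (simp only: dker_add_int)
    qed
    have 2: "\<theta> i - (real (b1 * g + d) + T (b1 * g + d)) * real g ^ i / real g ^ Suc J =
        \<theta> i - (real b1 + T' d b1) * real g ^ i / real g ^ J" for i
      unfolding power_digit_split using d by (simp add: T'_def)
    have "(\<Prod>i<Suc J. dker g (\<theta> i - (real (b1 * g + d) + T (b1 * g + d)) * real g ^ i / real g ^ Suc J)) =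
        dker g (\<theta> J - (real d + T (b1 * g + d)) / real g) *
        (\<Prod>i<J. dker g (\<theta> i - (real b1 + T' d b1) * real g ^ i / real g ^ J))"
      unfolding prod.lessThan_Suc 1 unfolding 2 by (rule mult.commute)
    also have "\<dots> \<le> dker g (\<theta> J - (real d + \<tau> d) / real g) *
        (\<Prod>i<J. dker g (\<theta> i - (real b1 + T' d b1) * real g ^ i / real g ^ J))"
      using \<tau>(2)[of b1 d] b1 by (intro mult_right_mono prod_nonneg) auto
    finally show "(\<Prod>i<Suc J. dker g (\<theta> i - (real (b1 * g + d) + T (b1 * g + d)) * real g ^ i / real g ^ Suc J)) \<le>
        dker g (\<theta> J - (real d + \<tau> d) / real g) *
        (\<Prod>i<J. dker g (\<theta> i - (real b1 + T' d b1) * real g ^ i / real g ^ J))" .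
  qed
  also have "\<dots> = (\<Sum>d<g. dker g (\<theta> J - (real d + \<tau> d) / real g) *
      (\<Sum>b1<g ^ J. \<Prod>i<J. dker g (\<theta> i - (real b1 + T' d b1) * real g ^ i / real g ^ J)))"
    by (simp only: sum_distrib_left)
  also have "\<dots> \<le> (\<Sum>d<g. dker g (\<theta> J - (real d + \<tau> d) / real g) * (real g * (C_const g + 3)) ^ J)"
    by (intro sum_mono mult_left_mono Suc.IH T') auto
  also have "\<dots> = (\<Sum>d<g. dker g (\<theta> J - (real d + \<tau> d) / real g)) * (real g * (C_const g + 3)) ^ J"
    by (simp only: sum_distrib_right)
  also have "\<dots> \<le> (real g * (C_const g + 3)) * (real g * (C_const g + 3)) ^ J"
    using C0 \<tau> by (intro mult_right_mono dker_sum_sup_le) auto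
  finally show ?case by simp
qed auto

end

section \<open>Reversal of digits and the Fourier transform\<close>

text \<open>Reversal in a window of fixed length \<open>N\<close>, leading zeros included. Each
  digit has a fixed weight, so the exponential factors over the digits; the weights in
  \<open>digit_reverse\<close> change with the length of the number.\<close>

definition rev_digits :: "nat \<Rightarrow> nat \<Rightarrow> nat \<Rightarrow> nat" where
  "rev_digits g N n = (\<Sum>i<N. digit g n i * g ^ (N - 1 - i))"

lemma digit_low:
  assumes "i < N"
  shows "digit g (d * g ^ N + m) i = digit g m i"
proof (cases "g = 0")
  case False
  have "N = (N - i - 1) + Suc i" using assms by simp
  then have "g ^ N = g ^ (N - i - 1) * g ^ Suc i" by (metis power_add)
  then have "d * g ^ N = (d * g ^ (N - i - 1) * g) * g ^ i" by (simp add: mult_ac)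
  then have "(d * g ^ N + m) div g ^ i = d * g ^ (N - i - 1) * g + m div g ^ i"
    using False by (simp only:) (rule div_mult_self3, simp)
  then show ?thesis by (simp add: digit_def)
qed (use assms in \<open>auto simp: digit_def zero_power\<close>)

lemma digit_top:
  assumes "m < g ^ N" "d < g"
  shows "digit g (d * g ^ N + m) N = d"
  using assms by (auto simp: digit_def)

lemma sum_digit_prod:
  fixes y :: "nat \<Rightarrow> real"
  shows "(\<Sum>n<g ^ N. \<Prod>i<N. ee (real (digit g n i) * y i)) = (\<Prod>i<N. \<Sum>d<g. ee (real d * y i))"
proof (induction N)
  case (Suc N)
  have "(\<Sum>n<g ^ Suc N. \<Prod>i<Suc N. ee (real (digit g n i) * y i)) =
      (\<Sum>d<g. \<Sum>n\<in>{d * g ^ N..<d * g ^ N + g ^ N}. \<Prod>i<Suc N. ee (real (digit g n i) * y i))"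
    using sum.nat_group[of "\<lambda>n. \<Prod>i<Suc N. ee (real (digit g n i) * y i)" "g ^ N" g] by simp
  also have "\<dots> = (\<Sum>d<g. \<Sum>m<g ^ N. (\<Prod>i<N. ee (real (digit g m i) * y i)) * ee (real d * y N))"
  proof (rule sum.cong[OF refl])
    fix d assume d: "d \<in> {..<g}"
    have "(\<Sum>n\<in>{d * g ^ N..<d * g ^ N + g ^ N}. \<Prod>i<Suc N. ee (real (digit g n i) * y i)) =
        (\<Sum>m<g ^ N. \<Prod>i<Suc N. ee (real (digit g (d * g ^ N + m) i) * y i))"
      by (rule sum.reindex_bij_witness[of _ "\<lambda>m. d * g ^ N + m" "\<lambda>n. n - d * g ^ N"]) auto
    also have "\<dots> = (\<Sum>m<g ^ N. (\<Prod>i<N. ee (real (digit g m i) * y i)) * ee (real d * y N))"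
      using d by (intro sum.cong refl) (simp add: digit_low digit_top)
    finally show "(\<Sum>n\<in>{d * g ^ N..<d * g ^ N + g ^ N}. \<Prod>i<Suc N. ee (real (digit g n i) * y i)) =
       (\<Sum>m<g ^ N. (\<Prod>i<N. ee (real (digit g m i) * y i)) * ee (real d * y N))" .
  qed
  also have "\<dots> = (\<Sum>d<g. (\<Prod>i<N. \<Sum>d<g. ee (real d * y i)) * ee (real d * y N))"
    by (simp only: sum_distrib_right[symmetric] Suc.IH)
  also have "\<dots> = (\<Prod>i<Suc N. \<Sum>d<g. ee (real d * y i))"
    by (simp add: sum_distrib_left[symmetric])
  finally show ?case .
qed simp

text \<open>The coefficient of digit \<open>i\<close> of \<open>n\<close> in the phase
  \<open>\<theta> * rev_digits g N n - n * b / g ^ N\<close>.\<close>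

definition frq :: "nat \<Rightarrow> nat \<Rightarrow> real \<Rightarrow> nat \<Rightarrow> nat \<Rightarrow> real" where
  "frq g N \<theta> b i = \<theta> * real g ^ (N - 1 - i) - real b * real g ^ i / real g ^ N"

lemma norm_fourier_rev:
  "norm (\<Sum>n<g ^ N. ee (\<theta> * real (rev_digits g N n)) * ee (- (real n * real b / real (g ^ N)))) = (\<Prod>i<N. dker g (frq g N \<theta> b i))"
proof -
  have "(\<Sum>n<g ^ N. ee (\<theta> * real (rev_digits g N n)) * ee (- (real n * real b / real (g ^ N)))) =
      (\<Sum>n<g ^ N. \<Prod>i<N. ee (real (digit g n i) * frq g N \<theta> b i))"
  proof (rule sum.cong[OF refl])
    fix n assume "n \<in> {..<g ^ N}"
    then have "n = (\<Sum>i<N. digit g n i * g ^ i)" by (simp add: digit_expansion_less_power)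
    then have n: "real n = (\<Sum>i<N. real (digit g n i) * real g ^ i)"
      by (metis (mono_tags, lifting) of_nat_mult of_nat_power of_nat_sum sum.cong)
    have "\<theta> * real (rev_digits g N n) + - (real n * real b / real (g ^ N)) = (\<Sum>i<N. real (digit g n i) * frq g N \<theta> b i)"
      unfolding n rev_digits_def frq_def
      by (simp add: sum_distrib_left sum_distrib_right sum_divide_distrib right_diff_distrib sum_subtractf mult_ac)
    then show "ee (\<theta> * real (rev_digits g N n)) * ee (- (real n * real b / real (g ^ N))) = (\<Prod>i<N. ee (real (digit g n i) * frq g N \<theta> b i))"
      by (simp only: ee_add[symmetric] ee_sum[symmetric])
  qed
  then show ?thesis by (simp add: sum_digit_prod dker_def prod_norm)
qed

section \<open>Orthogonality modulo \<open>x\<close>\<close>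

lemma dist_int_pos_fraction:
  fixes k :: int
  assumes "x > 0" "\<not> int x dvd k"
  shows "dist_int (of_int k / real x) \<ge> 1 / real x"
proof -
  define m where "m = round (of_int k / real x)"
  have "k - int x * m \<noteq> 0" using assms by auto
  then have "1 \<le> \<bar>k - int x * m\<bar>" by simp
  then have "1 \<le> \<bar>real_of_int (k - int x * m)\<bar>" by linarith
  then have "1 / real x \<le> \<bar>real_of_int (k - int x * m)\<bar> / real x" using assms by (intro divide_right_mono) auto
  also have "\<dots> = \<bar>real_of_int (k - int x * m) / real x\<bar>" by simp
  also have "real_of_int (k - int x * m) / real x = of_int k / real x - of_int m" using assms by (simp add: field_simps)
  finally show ?thesis by (simp add: dist_int_def m_def)
qed

lemma sum_ee_zero:
  fixes k :: int
  assumes "x > 0" "\<not> int x dvd k"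
  shows "(\<Sum>b<x. ee (of_int k * real b / real x)) = 0"
proof -
  define z where "z = ee (of_int k / real x)"
  have "norm (1 - z) > 0"
    unfolding z_def norm_one_minus_ee
    using abs_sin_pi_ge[of "of_int k / real x"] dist_int_pos_fraction[OF assms] assms by (smt (verit) divide_pos_pos of_nat_0_less_iff)
  then have "z \<noteq> 1" by auto
  have "(\<Sum>b<x. ee (of_int k * real b / real x)) = (\<Sum>b<x. z ^ b)"
    by (simp add: z_def ee_power mult_ac)
  moreover have "(1 - z) * (\<Sum>b<x. z ^ b) = 1 - z ^ x" by (rule one_diff_power_eq[symmetric])
  moreover have "z ^ x = 1" using assms by (simp add: z_def ee_power)
  ultimately show ?thesis using \<open>z \<noteq> 1\<close> by auto
qed

lemma sum_ee_full:
  fixes k :: int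
  assumes "x > 0"
  shows "(\<Sum>b<x. ee (of_int k * real b / real x)) = (if int x dvd k then of_nat x else 0)"
proof (cases "int x dvd k")
  case True
  then obtain m where "k = int x * m" by auto
  then have "ee (of_int k * real b / real x) = 1" for b
    using assms ee_of_int[of "m * int b"] by (simp add: mult_ac)
  then show ?thesis using True by simp
qed (use sum_ee_zero assms in auto)

text \<open>Below \<open>x\<close>, congruence modulo \<open>x\<close> is equality, so the transform
  inverts exactly; only the triangle inequality over \<open>b\<close> is lossy.\<close>

lemma fourier_inversion_norm:
  fixes c :: "nat \<Rightarrow> complex"
  assumes "x > 0" "P \<subseteq> {..<x}"
  shows "norm (\<Sum>p\<in>P. c p) \<le> (\<Sum>b<x. norm (\<Sum>n<x. c n * ee (- (real n * real b / real x))) * norm (\<Sum>p\<in>P. ee (real p * (real b / real x)))) / real x"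
proof -
  have fin: "finite P" using assms finite_subset by blast
  have "(\<Sum>b<x. (\<Sum>n<x. c n * ee (- (real n * real b / real x))) * (\<Sum>p\<in>P. ee (real p * (real b / real x)))) =
      (\<Sum>b<x. \<Sum>n<x. \<Sum>p\<in>P. c n * ee (of_int (int p - int n) * real b / real x))"
    unfolding sum_product
    by (intro sum.cong refl) (simp add: ee_add[symmetric] mult.assoc field_simps)
  also have "\<dots> = (\<Sum>n<x. \<Sum>b<x. \<Sum>p\<in>P. c n * ee (of_int (int p - int n) * real b / real x))"
    by (rule sum.swap)
  also have "\<dots> = (\<Sum>n<x. \<Sum>p\<in>P. \<Sum>b<x. c n * ee (of_int (int p - int n) * real b / real x))"
    by (intro sum.cong refl sum.swap)
  also have "\<dots> = (\<Sum>n<x. \<Sum>p\<in>P. c n * (if int x dvd (int p - int n) then of_nat x else 0))"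
    using assms by (simp only: sum_distrib_left[symmetric] sum_ee_full)
  also have "\<dots> = (\<Sum>n<x. \<Sum>p\<in>P. if p = n then c n * of_nat x else 0)"
  proof (intro sum.cong refl)
    fix n p assume "n \<in> {..<x}" "p \<in> P"
    then have "n < x" "p < x" using assms by auto
    then have "int x dvd (int p - int n) \<longleftrightarrow> p = n"
      by (metis mod_eq_dvd_iff mod_less of_nat_eq_iff zmod_int)
    then show "c n * (if int x dvd (int p - int n) then of_nat x else 0) = (if p = n then c n * of_nat x else 0)" by simp
  qed
  also have "\<dots> = (\<Sum>p\<in>P. \<Sum>n<x. if p = n then c n * of_nat x else 0)" by (rule sum.swap)
  also have "\<dots> = (\<Sum>p\<in>P. c p * of_nat x)"
    using assms by (intro sum.cong refl) (auto simp: sum.delta)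
  also have "\<dots> = (\<Sum>p\<in>P. c p) * of_nat x" by (simp only: sum_distrib_right)
  finally have eq: "(\<Sum>p\<in>P. c p) * of_nat x =
      (\<Sum>b<x. (\<Sum>n<x. c n * ee (- (real n * real b / real x))) * (\<Sum>p\<in>P. ee (real p * (real b / real x))))" by simp
  have "norm (\<Sum>p\<in>P. c p) * real x = norm ((\<Sum>p\<in>P. c p) * of_nat x)" by (simp add: norm_mult)
  also have "\<dots> \<le> (\<Sum>b<x. norm (\<Sum>n<x. c n * ee (- (real n * real b / real x))) * norm (\<Sum>p\<in>P. ee (real p * (real b / real x))))"
    unfolding eq by (rule order.trans[OF norm_sum]) (simp add: norm_mult)
  finally show ?thesis using assms by (simp add: field_simps)
qed

section \<open>Pointwise bounds for the Fourier transform\<close>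

text \<open>Cancellation is taken from the first two terms alone: \<open>1 + ee y\<close> has norm
  \<open>2 * \<bar>cos (pi * y)\<bar>\<close>, at most \<open>2 - 4 * t\<^sup>2\<close>. With
  \<open>t \<ge> 1 / (4 * g\<^sup>2)\<close> this saves \<open>1 / (4 * g ^ 4)\<close>.\<close>

lemma dker_saving:
  assumes g: "g \<ge> 2" and y: "dist_int y \<ge> 1 / (4 * (real g)\<^sup>2)"
  shows "dker g y \<le> real g * (1 - 1 / (4 * real g ^ 5))"
proof -
  have gr: "real g \<ge> 2" using g by simp
  define t where "t = dist_int y"
  have t: "t \<ge> 0" "t \<le> 1 / 2" using dist_int_le_half by (auto simp: t_def)
  have "norm (1 + ee y) = norm (1 - ee (y + 1 / 2))"
  proof -
    have "ee (1 / 2) = - 1" by (simp add: ee_def)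
    then show ?thesis by (simp add: ee_add)
  qed
  also have "\<dots> = 2 * \<bar>cos (pi * y)\<bar>"
    by (simp add: norm_one_minus_ee distrib_left sin_add)
  finally have n: "norm (1 + ee y) = 2 * \<bar>cos (pi * y)\<bar>" .
  have "(2 * t)\<^sup>2 \<le> \<bar>sin (pi * y)\<bar>\<^sup>2" using abs_sin_pi_ge[of y] t unfolding t_def by (intro power_mono) auto
  then have "(cos (pi * y))\<^sup>2 \<le> 1 - 4 * t\<^sup>2" by (simp add: power_mult_distrib cos_squared_eq)
  also have "\<dots> \<le> (1 - 2 * t\<^sup>2)\<^sup>2"
  proof -
    have "(1 - 2 * t\<^sup>2)\<^sup>2 = 1 - 4 * t\<^sup>2 + (2 * t\<^sup>2)\<^sup>2" by (simp add: power2_eq_square algebra_simps)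
    then show ?thesis by simp
  qed
  finally have c2: "\<bar>cos (pi * y)\<bar>\<^sup>2 \<le> (1 - 2 * t\<^sup>2)\<^sup>2" by simp
  have "t\<^sup>2 \<le> (1 / 2)\<^sup>2" using t by (intro power_mono) auto
  then have "0 \<le> 1 - 2 * t\<^sup>2" by (simp add: power_divide)
  then have "\<bar>cos (pi * y)\<bar> \<le> 1 - 2 * t\<^sup>2" by (rule power2_le_imp_le[OF c2])
  then have n2: "norm (1 + ee y) \<le> 2 - 4 * t\<^sup>2" using n by simp
  have split: "{..<g} = {0, 1} \<union> {2..<g}" using g by auto
  have "(\<Sum>d<g. ee (real d * y)) = (1 + ee y) + (\<Sum>d\<in>{2..<g}. ee (real d * y))"
    unfolding split by (subst sum.union_disjoint) auto
  then have "dker g y \<le> norm (1 + ee y) + norm (\<Sum>d\<in>{2..<g}. ee (real d * y))"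
    unfolding dker_def by (simp only: norm_triangle_ineq)
  also have "norm (\<Sum>d\<in>{2..<g}. ee (real d * y)) \<le> real g - 2"
    using sum_norm_le[of "{2..<g}" "\<lambda>d. ee (real d * y)" "\<lambda>_. 1"] g by (simp add: of_nat_diff)
  finally have "dker g y \<le> real g - 4 * t\<^sup>2" using n2 by linarith
  also have "4 * t\<^sup>2 \<ge> 1 / (4 * real g ^ 4)"
  proof -
    have "(1 / (4 * (real g)\<^sup>2))\<^sup>2 \<le> t\<^sup>2" using y unfolding t_def by (intro power_mono) auto
    then show ?thesis using gr by (simp add: power_divide power_mult_distrib field_simps)
  qed
  then have "real g - 4 * t\<^sup>2 \<le> real g - 1 / (4 * real g ^ 4)" by simp
  also have "\<dots> = real g * (1 - 1 / (4 * real g ^ 5))" using gr by (simp add: field_simps power_numeral_reduce)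
  finally show ?thesis .
qed

lemma dist_int_eq_abs: "\<bar>t\<bar> < 1 / 2 \<Longrightarrow> dist_int t = \<bar>t\<bar>"
  using round_unique'[of t 0] by (simp add: dist_int_def)

lemma dist_int_mult_small:
  assumes "real n * dist_int y < 1 / 2"
  shows "dist_int (real n * y) = real n * dist_int y"
proof -
  define u where "u = y - of_int (round y)"
  have "real n * y = real n * u + of_int (int n * round y)" by (simp add: u_def algebra_simps)
  then have "dist_int (real n * y) = dist_int (real n * u)" by (simp only: dist_int_add_int)
  also have "\<dots> = \<bar>real n * u\<bar>" using assms by (intro dist_int_eq_abs) (simp add: u_def dist_int_def abs_mult)
  finally show ?thesis by (simp add: u_def dist_int_def abs_mult)
qed

text \<open>As long as the multiples stay within \<open>1 / (2 * g)\<close> of an integer,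
  multiplication by \<open>g\<close> multiplies the distance exactly by \<open>g\<close>. From
  \<open>1 / q\<close> on, this cannot last for \<open>w\<close> steps when
  \<open>q \<le> g ^ w\<close>.\<close>

lemma large_multiple_in_window:
  assumes g: "g \<ge> 2" and d: "dist_int y > 0" "dist_int y \<ge> 1 / real q" and w: "q \<le> g ^ w" "w \<ge> 1" "q \<ge> 1"
  shows "\<exists>j<w. dist_int (real g ^ j * y) \<ge> 1 / (2 * real g)"
proof (rule ccontr)
  assume "\<not> ?thesis"
  then have small: "dist_int (real g ^ j * y) < 1 / (2 * real g)" if "j < w" for j using that by (meson not_le)
  have gr: "real g > 0" using g by simp
  have scale: "j < w \<Longrightarrow> dist_int (real g ^ j * y) = real g ^ j * dist_int y" for j
  proof (induction j)
    case (Suc j)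
    have "real g * dist_int (real g ^ j * y) < 1 / 2"
      using small[of j] Suc.prems gr by (simp add: field_simps)
    then have "dist_int (real g * (real g ^ j * y)) = real g * dist_int (real g ^ j * y)"
      by (rule dist_int_mult_small)
    then show ?case using Suc by (simp add: mult.assoc)
  qed simp
  have "real g ^ (w - 1) * dist_int y < 1 / (2 * real g)"
    using scale[of "w - 1"] small[of "w - 1"] w by simp
  then have "real g * real g ^ (w - 1) * dist_int y < 1 / 2" using gr by (simp add: field_simps)
  moreover have "real g * real g ^ (w - 1) = real (g ^ w)" using w by (cases w) auto
  ultimately have "real (g ^ w) * dist_int y < 1 / 2" by simp
  moreover have "real (g ^ w) * dist_int y \<ge> real q * (1 / real q)"
  proof (rule mult_mono)
    show "real q \<le> real (g ^ w)" using w(1) by (simp only: of_nat_le_iff)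
  qed (use d in auto)
  ultimately show False using w by simp
qed

section \<open>Savings from windows of digits\<close>

locale reversal =
  fixes g N q :: nat and \<theta> :: real
  assumes g: "g \<ge> 2" and q: "q \<ge> 1"
    and rational: "real q * \<theta> \<in> \<int>"
    and nonintegral: "real (g\<^sup>2 - 1) * real g ^ N * \<theta> \<notin> \<int>"
begin

text \<open>Were the value at \<open>k\<close> an integer, so would be the one at \<open>N\<close>,
  against \<open>nonintegral\<close>; and a fraction with denominator \<open>q\<close> that is no
  integer keeps a distance of at least \<open>1 / q\<close>.\<close>

lemma dist_int_theta:
  assumes "k \<le> N"
  shows "dist_int (real (g\<^sup>2 - 1) * \<theta> * real g ^ k) \<ge> 1 / real q" (is "dist_int ?y \<ge> _")
    "dist_int (real (g\<^sup>2 - 1) * \<theta> * real g ^ k) > 0"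
proof -
  obtain h where h: "real q * \<theta> = of_int h" using rational by (auto elim: Ints_cases)
  have qr: "real q > 0" using q by simp
  have th: "\<theta> = of_int h / real q" using h qr by (simp add: field_simps)
  let ?k = "int (g\<^sup>2 - 1) * h * int g ^ k"
  have y: "?y = of_int ?k / real q" by (simp add: th)
  have "\<not> int q dvd ?k"
  proof
    assume "int q dvd ?k"
    then obtain m where "?k = int q * m" by auto
    then have "?y = of_int m" unfolding y using qr by (simp only: of_int_mult of_int_of_nat_eq) simp
    then have "?y * real g ^ (N - k) = of_int (m * int g ^ (N - k))" by simp
    also have "?y * real g ^ (N - k) = real (g\<^sup>2 - 1) * real g ^ N * \<theta>"
      using assms by (simp add: mult_ac flip: power_add)
    finally show False using nonintegral by (metis Ints_of_int)
  qed
  then show "dist_int ?y \<ge> 1 / real q" unfolding y using q by (intro dist_int_pos_fraction) auto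
  then show "dist_int ?y > 0" using qr by (smt (verit) divide_pos_pos)
qed

text \<open>Multiplication by \<open>g\<close> moves the \<open>b\<close> part to the next index,
  where it cancels, so the right-hand side is independent of \<open>b\<close>. The
  \<open>\<theta>\<close> part runs through the powers of \<open>g\<close> in the opposite
  direction, which leaves the factor \<open>g\<^sup>2 - 1\<close>.\<close>

lemma frq_relation:
  assumes "i + 1 < N"
  shows "real g * frq g N \<theta> b i - frq g N \<theta> b (i + 1) = real (g\<^sup>2 - 1) * \<theta> * real g ^ (N - 2 - i)"
proof -
  have e: "N - 1 - i = Suc (N - 2 - i)" "N - 1 - (i + 1) = N - 2 - i" using assms by auto
  have "1 \<le> g\<^sup>2" using g by (simp add: Suc_le_eq)
  then show ?thesis unfolding frq_def e
    by (simp add: of_nat_diff power2_eq_square algebra_simps)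
qed

text \<open>\<open>w\<close> consecutive relations involve \<open>w + 1\<close> frequencies. If one
  right-hand side is at least \<open>1 / (2 * g)\<close> away from the integers, one of its two
  frequencies is at least \<open>1 / (4 * g\<^sup>2)\<close> away, and its factor is the one that
  saves.\<close>

lemma window_saving:
  assumes "q \<le> g ^ w" "w \<ge> 1" "a + w < N"
  shows "(\<Prod>i\<in>{a..<a + (w + 1)}. dker g (frq g N \<theta> b i)) \<le> real g ^ (w + 1) * (1 - 1 / (4 * real g ^ 5))"
proof -
  have gr: "real g > 0" using g by simp
  let ?y = "real (g\<^sup>2 - 1) * \<theta> * real g ^ (N - 1 - a - w)"
  have "dist_int ?y \<ge> 1 / real q" "dist_int ?y > 0" using dist_int_theta[of "N - 1 - a - w"] by auto
  then obtain j where j: "j < w" "dist_int (real g ^ j * ?y) \<ge> 1 / (2 * real g)"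
    using large_multiple_in_window[OF g _ _ assms(1,2) q] by blast
  \<comment> \<open>The relation at index \<open>i\<close> has the exponent
    \<open>N - 2 - i\<close>, which has to equal \<open>j + (N - 1 - a - w)\<close>.\<close>
  define i where "i = a + w - 1 - j"
  have i: "a \<le> i" "i + 1 < a + (w + 1)" "i + 1 < N" using j assms by (auto simp: i_def)
  have "N - 2 - i = j + (N - 1 - a - w)" using j assms by (auto simp: i_def)
  then have "real g ^ j * ?y = real (g\<^sup>2 - 1) * \<theta> * real g ^ (N - 2 - i)" by (simp add: power_add mult_ac)
  then have rel: "real g ^ j * ?y = real g * frq g N \<theta> b i + - frq g N \<theta> b (i + 1)" using frq_relation[of i b] i by simp
  have "1 / (2 * real g) \<le> dist_int (real g * frq g N \<theta> b i) + dist_int (frq g N \<theta> b (i + 1))"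
    using j(2) unfolding rel using dist_int_triangle[of "real g * frq g N \<theta> b i" "- frq g N \<theta> b (i + 1)"] by simp
  also have "\<dots> \<le> real g * dist_int (frq g N \<theta> b i) + dist_int (frq g N \<theta> b (i + 1))"
    using dist_int_nat_mult by (intro add_right_mono)
  finally have sum: "1 / (2 * real g) \<le> real g * dist_int (frq g N \<theta> b i) + dist_int (frq g N \<theta> b (i + 1))" .
  have "\<exists>l\<in>{a..<a + (w + 1)}. dist_int (frq g N \<theta> b l) \<ge> 1 / (4 * (real g)\<^sup>2)"
  proof (rule ccontr)
    assume "\<not> ?thesis"
    then have s: "dist_int (frq g N \<theta> b i) < 1 / (4 * (real g)\<^sup>2)" "dist_int (frq g N \<theta> b (i + 1)) < 1 / (4 * (real g)\<^sup>2)"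
      using i by (auto simp: not_le)
    have "real g * dist_int (frq g N \<theta> b i) < real g * (1 / (4 * (real g)\<^sup>2))" using s gr by (intro mult_strict_left_mono) auto
    moreover have "real g * (1 / (4 * (real g)\<^sup>2)) = 1 / (4 * real g)" using gr by (simp add: power2_eq_square)
    moreover have "1 / (4 * (real g)\<^sup>2) \<le> 1 / (4 * real g)" using g by (intro divide_left_mono) (auto simp: power2_eq_square)
    moreover have "1 / (2 * real g) = 1 / (4 * real g) + 1 / (4 * real g)" by simp
    ultimately show False using sum s(2) by linarith
  qed
  then obtain l where l: "l \<in> {a..<a + (w + 1)}" "dist_int (frq g N \<theta> b l) \<ge> 1 / (4 * (real g)\<^sup>2)" by auto
  have "(\<Prod>i\<in>{a..<a + (w + 1)}. dker g (frq g N \<theta> b i)) =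
      dker g (frq g N \<theta> b l) * (\<Prod>i\<in>{a..<a + (w + 1)} - {l}. dker g (frq g N \<theta> b i))"
    using l(1) by (intro prod.remove) auto
  also have "\<dots> \<le> (real g * (1 - 1 / (4 * real g ^ 5))) * (\<Prod>i\<in>{a..<a + (w + 1)} - {l}. real g)"
    using l by (intro mult_mono dker_saving prod_mono g) (auto intro!: dker_le prod_nonneg order.trans[OF dker_nonneg dker_saving[OF g l(2)]])
  also have "(\<Prod>i\<in>{a..<a + (w + 1)} - {l}. real g) = real g ^ w" using l(1) by simp
  finally show ?thesis by (simp add: mult_ac)
qed

lemma saving_nonneg: "1 - 1 / (4 * real g ^ 5) \<ge> 0"
proof -
  have "real g ^ 5 \<ge> 1" using g by (intro one_le_power) auto
  then show ?thesis by (simp add: divide_le_eq)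
qed

lemma prod_dker_le: "finite A \<Longrightarrow> (\<Prod>i\<in>A. dker g (f i)) \<le> real g ^ card A"
  using prod_mono[of A "\<lambda>i. dker g (f i)" "\<lambda>_. real g"] dker_le by simp

lemma windows_saving:
  assumes "q \<le> g ^ w" "w \<ge> 1" "a + k * (w + 1) \<le> N"
  shows "(\<Prod>i\<in>{a..<a + k * (w + 1)}. dker g (frq g N \<theta> b i)) \<le> real g ^ (k * (w + 1)) * (1 - 1 / (4 * real g ^ 5)) ^ k"
  using assms(3)
proof (induction k)
  case (Suc k)
  let ?a = "a + k * (w + 1)"
  have e: "a + Suc k * (w + 1) = ?a + (w + 1)" by simp
  have "(\<Prod>i\<in>{a..<a + Suc k * (w + 1)}. dker g (frq g N \<theta> b i)) =
      (\<Prod>i\<in>{a..<?a}. dker g (frq g N \<theta> b i)) * (\<Prod>i\<in>{?a..<?a + (w + 1)}. dker g (frq g N \<theta> b i))"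
    unfolding e by (rule prod.atLeastLessThan_concat[symmetric]) auto
  also have "\<dots> \<le> (real g ^ (k * (w + 1)) * (1 - 1 / (4 * real g ^ 5)) ^ k) * (real g ^ (w + 1) * (1 - 1 / (4 * real g ^ 5)))"
  proof (rule mult_mono)
    show "(\<Prod>i\<in>{a..<?a}. dker g (frq g N \<theta> b i)) \<le> real g ^ (k * (w + 1)) * (1 - 1 / (4 * real g ^ 5)) ^ k"
      using Suc by simp
    show "(\<Prod>i\<in>{?a..<?a + (w + 1)}. dker g (frq g N \<theta> b i)) \<le> real g ^ (w + 1) * (1 - 1 / (4 * real g ^ 5))"
      using Suc.prems assms by (intro window_saving) auto
    show "0 \<le> real g ^ (k * (w + 1)) * (1 - 1 / (4 * real g ^ 5)) ^ k"
      using saving_nonneg by (intro mult_nonneg_nonneg zero_le_power) auto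
    show "0 \<le> (\<Prod>i\<in>{?a..<?a + (w + 1)}. dker g (frq g N \<theta> b i))"
      by (intro prod_nonneg) simp
  qed
  also have "\<dots> = real g ^ (Suc k * (w + 1)) * (1 - 1 / (4 * real g ^ 5)) ^ Suc k"
    by (simp add: power_add mult_ac)
  finally show ?case .
qed simp

lemma block_saving:
  assumes "q \<le> g ^ w" "w \<ge> 1" "a + l \<le> N"
  shows "(\<Prod>i\<in>{a..<a + l}. dker g (frq g N \<theta> b i)) \<le> real g ^ l * (1 - 1 / (4 * real g ^ 5)) ^ (l div (w + 1))"
proof -
  define k where "k = l div (w + 1)"
  have k: "k * (w + 1) \<le> l" unfolding k_def by (rule div_times_less_eq_dividend)
  have "(\<Prod>i\<in>{a..<a + l}. dker g (frq g N \<theta> b i)) =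
     (\<Prod>i\<in>{a..<a + k * (w + 1)}. dker g (frq g N \<theta> b i)) * (\<Prod>i\<in>{a + k * (w + 1)..<a + l}. dker g (frq g N \<theta> b i))"
    using k by (intro prod.atLeastLessThan_concat[symmetric]) auto
  also have "\<dots> \<le> (real g ^ (k * (w + 1)) * (1 - 1 / (4 * real g ^ 5)) ^ k) * real g ^ (l - k * (w + 1))"
    using assms k saving_nonneg prod_dker_le[of "{a + k * (w + 1)..<a + l}" "frq g N \<theta> b"]
    by (intro mult_mono windows_saving) (auto intro!: prod_nonneg)
  also have "\<dots> = real g ^ l * (1 - 1 / (4 * real g ^ 5)) ^ k"
    using k by (simp add: mult_ac flip: power_add)
  finally show ?thesis by (simp add: k_def)
qed

end

section \<open>Prime exponential sums near rationals\<close>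

lemma sqrt_le_powr:
  assumes "x \<ge> (1::real)" "y \<le> 2 * x powr (8/5)"
  shows "sqrt y \<le> 3/2 * x powr (4/5)"
proof (rule real_le_lsqrt)
  have "(3/2 * x powr (4/5))\<^sup>2 = 9/4 * x powr (8/5)"
    by (simp add: power_mult_distrib power2_eq_square powr_add[symmetric])
  moreover have "x powr (8/5) \<ge> 0" by simp
  ultimately show "y \<le> (3/2 * x powr (4/5))\<^sup>2" using assms by linarith
qed auto

text \<open>Dirichlet's theorem with denominators up to about \<open>x powr (3/5)\<close> gives
  \<open>a / r\<close>. Within \<open>1 / x\<close> of it, \<open>prime_exp_sum\<close> at
  \<open>r\<close> is enough. At a larger distance \<open>\<delta>\<close>, a second approximation
  \<open>a' / r'\<close>, of a quality adapted to \<open>\<delta>\<close>, must differ from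
  \<open>a / r\<close>; then \<open>r'\<close> has order \<open>1 / (r * \<delta>)\<close>, and
  \<open>prime_exp_sum\<close> at \<open>r'\<close> yields the decay in \<open>\<delta>\<close> as
  well. The constant 540 is 215 times 5/2, rounded up.\<close>

lemma prime_exp_sum_near_rational:
  fixes x :: nat and \<beta> :: real
  assumes x: "x \<ge> 2"
  obtains a :: int and r :: nat where "r \<ge> 1" "coprime a (int r)"
    "real r * (real x * \<bar>\<beta> - of_int a / real r\<bar>) \<le> real x powr (2/5)"
    "norm (\<Sum>p | prime p \<and> p < x. ee (real p * \<beta>)) \<le>
       540 * (1 + ln (real x)) ^ 3 * (real x / sqrt (real r * max 1 (real x * \<bar>\<beta> - of_int a / real r\<bar>)) + real x powr (4/5))"
proof -
  define H where "H = 1 + ln (real x)"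
  have H0: "H ^ 3 \<ge> 0" using x by (simp add: H_def)
  have xr: "real x \<ge> 2" using x by simp
  define E where "E = real x powr (4/5)"
  have E0: "E \<ge> 0" by (simp add: E_def)
  define Q where "Q = nat \<lceil>real x powr (3/5)\<rceil>"
  have x35: "real x powr (3/5) \<ge> 1" using xr by (intro ge_one_powr_ge_zero) auto
  have Q1: "real Q \<ge> real x powr (3/5)" by (simp add: Q_def real_nat_ceiling_ge)
  have "real Q \<le> real x powr (3/5) + 1" unfolding Q_def using x35 by linarith
  then have Q2: "real Q \<le> 2 * real x powr (3/5)" using x35 by linarith
  have Qpos: "Q > 0" "real Q > 0" using Q1 x35 by auto
  obtain a k where ak: "coprime a k" "0 < k" "k \<le> int Q" "\<bar>of_int k * \<beta> - of_int a\<bar> < 1 / real Q"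
    using Dirichlet_approx_coprime[OF Qpos(1), of \<beta>] by metis
  define r where "r = nat k"
  have k: "k = int r" using ak by (simp add: r_def)
  have r1: "r \<ge> 1" "real r \<ge> 1" using ak k by auto
  have rQ: "real r \<le> real Q" using ak k by simp
  have cop: "coprime a (int r)" using ak k by simp
  define \<delta> where "\<delta> = \<bar>\<beta> - of_int a / real r\<bar>"
  have rd: "real r * \<delta> = \<bar>real r * \<beta> - of_int a\<bar>"
  proof -
    have "real r * \<beta> - of_int a = real r * (\<beta> - of_int a / real r)" using r1 by (simp add: field_simps)
    then show ?thesis by (simp add: \<delta>_def abs_mult)
  qed
  have rd1: "real r * \<delta> < 1 / real Q" unfolding rd using ak(4) k by simp
  have rx: "real r * (real x * \<delta>) \<le> real x powr (2/5)"
  proof -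
    have "real r * (real x * \<delta>) = real x * (real r * \<delta>)" by simp
    also have "\<dots> \<le> real x * (1 / real x powr (3/5))"
    proof (rule mult_left_mono)
      have "1 / real Q \<le> 1 / real x powr (3/5)" using Q1 x35 Qpos xr by (intro divide_left_mono mult_pos_pos) auto
      then show "real r * \<delta> \<le> 1 / real x powr (3/5)" using rd1 by linarith
    qed auto
    also have "\<dots> = real x powr 1 / real x powr (3/5)" using xr by simp
    also have "\<dots> = real x powr (2/5)" by (simp only: powr_diff[symmetric]) simp
    finally show ?thesis .
  qed
  have \<delta>0: "\<delta> \<ge> 0" by (simp add: \<delta>_def)
  have "norm (\<Sum>p | prime p \<and> p < x. ee (real p * \<beta>)) \<le> 540 * H ^ 3 * (real x / sqrt (real r * max 1 (real x * \<delta>)) + E)"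
  proof (cases "real x * \<delta> \<le> 1")
    case True
    have "\<delta> \<le> 1 / (real r)\<^sup>2"
    proof -
      have "real r * \<delta> \<le> 1 / real r" using rd1 divide_left_mono[OF rQ, of 1] r1 Qpos by auto
      then show ?thesis using r1 by (simp add: power2_eq_square field_simps)
    qed
    then interpret rational_approx \<beta> a r using r1 cop by unfold_locales (auto simp: \<delta>_def)
    have "sqrt (real x * real r) \<le> 3/2 * E" unfolding E_def
    proof (rule sqrt_le_powr)
      have "real x * real r \<le> real x powr 1 * (2 * real x powr (3/5))"
        using rQ Q2 xr by (intro mult_mono) auto
      also have "\<dots> = 2 * real x powr (8/5)" using powr_add[of "real x" 1 "3/5"] by simp
      finally show "real x * real r \<le> 2 * real x powr (8/5)" .
    qed (use xr in auto)
    then have v: "vino x r \<le> real x / sqrt (real r) + 5/2 * E" by (simp add: vino_def E_def)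
    have m: "max 1 (real x * \<delta>) = 1" using True by simp
    define Y where "Y = real x / sqrt (real r * max 1 (real x * \<delta>))"
    have Y: "Y \<ge> 0" "vino x r \<le> Y + 5/2 * E" using v unfolding Y_def m by auto
    have "norm (\<Sum>p | prime p \<and> p < x. ee (real p * \<beta>)) \<le> 215 * H ^ 3 * vino x r"
      unfolding H_def by (rule prime_exp_sum[OF x])
    also have "\<dots> \<le> 215 * H ^ 3 * (5/2 * (Y + E))" using H0 Y E0 by (intro mult_left_mono) auto
    also have "\<dots> = 537.5 * (H ^ 3 * (Y + E))" by simp
    also have "\<dots> \<le> 540 * (H ^ 3 * (Y + E))" using H0 Y E0 by (intro mult_right_mono) auto
    finally show ?thesis by (simp add: Y_def mult.assoc)
  next
    case False
    define \<kappa> where "\<kappa> = real x * \<delta>"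
    have \<kappa>: "\<kappa> > 1" using False by (simp add: \<kappa>_def)
    have \<delta>p: "\<delta> > 0" using False \<delta>0 by (cases "\<delta> = 0") auto
    have rdp: "real r * \<delta> > 0" using \<delta>p r1 by simp
    \<comment> \<open>The factor 2 makes the new approximation closer than
      \<open>r * \<delta> / 2\<close>, so that the two fractions cannot coincide; rounding up costs
      at most one more \<open>1 / (r * \<delta>)\<close>.\<close>
    define Q' where "Q' = nat \<lceil>2 / (real r * \<delta>)\<rceil>"
    have q1: "real Q' \<ge> 2 / (real r * \<delta>)" by (simp add: Q'_def real_nat_ceiling_ge)
    have q3: "real Q' \<le> 2 / (real r * \<delta>) + 1" unfolding Q'_def using rdp by (smt (verit) ceiling_correct divide_pos_pos of_nat_nat zero_less_ceiling)
    have "1 \<le> 1 / (real r * \<delta>)"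
    proof -
      have "1 / real Q \<le> 1" using Qpos by simp
      then show ?thesis using rd1 rdp by simp
    qed
    then have "2 / (real r * \<delta>) + 1 \<le> 2 / (real r * \<delta>) + 1 / (real r * \<delta>)" by (rule add_left_mono)
    also have "\<dots> = 3 / (real r * \<delta>)" by (simp add: add_divide_distrib[symmetric])
    finally have q2: "real Q' \<le> 3 / (real r * \<delta>)" by (rule order.trans[OF q3])
    have q0: "real Q' > 0" using q1 rdp by (smt (verit) divide_pos_pos)
    then have q0': "Q' > 0" by simp
    obtain a' k' where ak': "coprime a' k'" "0 < k'" "k' \<le> int Q'" "\<bar>of_int k' * \<beta> - of_int a'\<bar> < 1 / real Q'"
      using Dirichlet_approx_coprime[OF q0', of \<beta>] by metis
    define r' where "r' = nat k'"
    have k': "k' = int r'" using ak' by (simp add: r'_def)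
    have r1': "r' \<ge> 1" "real r' \<ge> 1" using ak' k' by auto
    have rQ': "real r' \<le> real Q'" using ak' k' by simp
    have cop': "coprime a' (int r')" using ak' k' by simp
    have inv: "1 / real Q' \<le> real r * \<delta> / 2"
    proof -
      have "1 / real Q' \<le> 1 / (2 / (real r * \<delta>))" using q1 rdp q0 by (intro divide_left_mono) auto
      then show ?thesis by simp
    qed
    have s': "\<bar>real r' * \<beta> - of_int a'\<bar> < real r * \<delta> / 2" using ak'(4) inv k' by simp
    have ne: "a * int r' \<noteq> a' * int r"
    proof
      assume eq: "a * int r' = a' * int r"
      then have "int r dvd a * int r'" by simp
      then have "int r dvd int r'" using cop by (simp add: coprime_commute coprime_dvd_mult_right_iff)
      then have le: "real r \<le> real r'" using r1' by (simp add: dvd_imp_le)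
      have "real_of_int a' * real r = real_of_int a * real r'"
        using arg_cong[OF eq, of real_of_int] by simp
      then have "real_of_int a' = real r' * (of_int a / real r)" using r1 by (simp add: field_simps)
      then have "real r' * \<beta> - of_int a' = real r' * (\<beta> - of_int a / real r)" by (simp add: right_diff_distrib)
      then have "\<bar>real r' * \<beta> - of_int a'\<bar> = real r' * \<delta>" by (simp add: abs_mult \<delta>_def)
      then have "real r' * \<delta> < real r * \<delta> / 2" using s' by simp
      moreover have "real r * \<delta> \<le> real r' * \<delta>" using le \<delta>0 by (intro mult_right_mono)
      ultimately show False using rdp by linarith
    qed
    \<comment> \<open>The nonzero integer determinant of the two fractions is the source of the
      lower bound for \<open>r'\<close>.\<close>
    have "1 \<le> \<bar>a * int r' - a' * int r\<bar>" using ne by linarith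
    then have "1 \<le> \<bar>real_of_int (a * int r' - a' * int r)\<bar>" by linarith
    also have "real_of_int (a * int r' - a' * int r) = real r * (real r' * \<beta> - of_int a') - real r' * (real r * \<beta> - of_int a)"
      by (simp add: algebra_simps)
    also have "\<bar>real r * (real r' * \<beta> - of_int a') - real r' * (real r * \<beta> - of_int a)\<bar> \<le>
        real r * \<bar>real r' * \<beta> - of_int a'\<bar> + real r' * \<bar>real r * \<beta> - of_int a\<bar>"
      by (rule order.trans[OF abs_triangle_ineq4]) (simp add: abs_mult)
    also have "\<dots> \<le> real r * (real r * \<delta> / 2) + real r' * (real r * \<delta>)"
      using s' rd by (intro add_mono mult_left_mono) auto
    finally have 1: "1 \<le> real r * (real r * \<delta> / 2) + real r' * (real r * \<delta>)" .
    have "real r * (real r * \<delta>) \<le> real Q * (1 / real Q)" using rQ rd1 rdp by (intro mult_mono) auto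
    then have "real r * (real r * \<delta>) \<le> 1" using Qpos by simp
    with 1 have 2: "1 \<le> 2 * (real r' * (real r * \<delta>))" by simp
    have \<kappa>\<delta>: "\<delta> = \<kappa> / real x" using xr by (simp add: \<kappa>_def)
    have \<kappa>r: "\<kappa> * real r > 0" using \<kappa> r1 by simp
    have r'_low: "real x / real r' \<le> 2 * (\<kappa> * real r)"
      using 2 r1' xr unfolding \<kappa>\<delta> by (simp add: field_simps)
    have r'_up: "real r' \<le> 3 * (real x / (\<kappa> * real r))"
    proof -
      have "3 / (real r * \<delta>) = 3 * (real x / (\<kappa> * real r))" unfolding \<kappa>\<delta> using xr \<kappa>r by (simp add: field_simps)
      then show ?thesis using order.trans[OF rQ' q2] by (simp only:)
    qed
    have "\<bar>\<beta> - of_int a' / real r'\<bar> \<le> 1 / (real r')\<^sup>2"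
    proof -
      have "real r' * (\<beta> - of_int a' / real r') = real r' * \<beta> - of_int a'" using r1' by (simp add: field_simps)
      then have "real r' * \<bar>\<beta> - of_int a' / real r'\<bar> = \<bar>real r' * \<beta> - of_int a'\<bar>"
        by (metis abs_mult abs_of_nat)
      then have "real r' * \<bar>\<beta> - of_int a' / real r'\<bar> \<le> 1 / real Q'" using ak'(4) k' by simp
      also have "\<dots> \<le> 1 / real r'" using rQ' r1' q0 by (intro divide_left_mono) auto
      finally show ?thesis using r1' by (simp add: power2_eq_square field_simps)
    qed
    then interpret rational_approx \<beta> a' r' using r1' cop' by unfold_locales auto
    define Y where "Y = real x / sqrt (real r * max 1 (real x * \<delta>))"
    have Y0: "Y \<ge> 0" by (simp add: Y_def)
    have mx: "max 1 (real x * \<delta>) = \<kappa>" using \<kappa> by (simp add: \<kappa>_def)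
    have e1: "real x / sqrt (real r') \<le> 3/2 * E"
    proof -
      have "real x / sqrt (real r') = sqrt (real x * (real x / real r'))"
        by (simp add: real_sqrt_mult real_sqrt_divide)
      also have "\<dots> \<le> 3/2 * E" unfolding E_def
      proof (rule sqrt_le_powr)
        have "real x * (real x / real r') \<le> real x * (2 * (\<kappa> * real r))" using r'_low by (intro mult_left_mono) auto
        also have "\<kappa> * real r \<le> real x powr (2/5)" using rx by (simp add: \<kappa>_def mult_ac)
        then have "real x * (2 * (\<kappa> * real r)) \<le> real x powr 1 * (2 * real x powr (2/5))" using xr by simp
        also have "\<dots> = 2 * real x powr (7/5)" using powr_add[of "real x" 1 "2/5"] by simp
        also have "\<dots> \<le> 2 * real x powr (8/5)" using xr by (intro mult_left_mono powr_mono) auto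
        finally show "real x * (real x / real r') \<le> 2 * real x powr (8/5)" .
      qed (use xr in auto)
      finally show ?thesis .
    qed
    have e2: "sqrt (real x * real r') \<le> 2 * Y"
    proof (rule real_le_lsqrt)
      have "(2 * Y)\<^sup>2 = 4 * (real x * (real x / (\<kappa> * real r)))"
        unfolding Y_def mx using \<kappa> by (simp add: power_mult_distrib power_divide real_sqrt_mult power2_eq_square mult_ac)
      moreover have "real x * real r' \<le> real x * (3 * (real x / (\<kappa> * real r)))" using r'_up by (intro mult_left_mono) auto
      moreover have "real x * (real x / (\<kappa> * real r)) \<ge> 0" using \<kappa>r by simp
      ultimately show "real x * real r' \<le> (2 * Y)\<^sup>2" by simp
    qed (use Y0 in auto)
    have v: "vino x r' \<le> 5/2 * (Y + E)" using e1 e2 Y0 by (simp add: vino_def E_def)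
    have "norm (\<Sum>p | prime p \<and> p < x. ee (real p * \<beta>)) \<le> 215 * H ^ 3 * vino x r'"
      unfolding H_def by (rule prime_exp_sum[OF x])
    also have "\<dots> \<le> 215 * H ^ 3 * (5/2 * (Y + E))" using H0 v by (intro mult_left_mono) auto
    also have "\<dots> = 537.5 * (H ^ 3 * (Y + E))" by simp
    also have "\<dots> \<le> 540 * (H ^ 3 * (Y + E))" using H0 Y0 E0 by (intro mult_right_mono) auto
    finally show ?thesis by (simp add: Y_def mult.assoc)
  qed
  then show ?thesis using that[of r a] r1 cop rx unfolding H_def E_def \<delta>_def by blast
qed

section \<open>The Fourier transform near rationals\<close>

text \<open>The leading part \<open>c\<close> of \<open>b\<close> leaves three cells of width
  \<open>g ^ (- J)\<close> for the fraction \<open>a / r\<close>, and two fractions with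
  denominators below \<open>g ^ (j + 1)\<close> in one cell are equal, since
  \<open>J = 2 * (j + 1)\<close>. Given the fraction, \<open>b\<close> lies in one of two pieces of
  length \<open>g ^ J'\<close>, each with at most one element of residue \<open>\<rho>\<close>.
  Hence 3 times 2.\<close>

lemma major_arc_multiplicity:
  fixes a :: "nat \<Rightarrow> int" and r :: "nat \<Rightarrow> nat" and g N j k c \<rho> :: nat
  defines "J \<equiv> 2 * (j + 1)" and "J' \<equiv> k + 1"
  assumes g: "g \<ge> 2" and JN: "J + J' \<le> N"
    and B: "\<And>b. b \<in> B \<Longrightarrow> 1 \<le> r b \<and> r b < g ^ (j + 1) \<and> \<bar>real b - of_int (a b) * real g ^ N / real (r b)\<bar> < real g ^ J'"
  shows "card {b \<in> B. b div g ^ (N - J) = c \<and> b mod g ^ J' = \<rho>} \<le> 6"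
proof -
  define A where "A = {b \<in> B. b div g ^ (N - J) = c \<and> b mod g ^ J' = \<rho>}"
  have gr: "real g > 0" using g by simp
  define u where "u = (\<lambda>b. of_int (a b) / real (r b))"
  define m where "m = (\<lambda>b. (\<lfloor>u b * real g ^ J\<rfloor>, \<lfloor>(real b - u b * real g ^ N) / real g ^ J'\<rfloor>))"
  have J'N: "real g ^ J' \<le> real g ^ (N - J)" using g JN by (intro power_increasing) auto
  have NJ: "real g ^ N = real g ^ (N - J) * real g ^ J" using JN by (simp flip: power_add)
  have near: "\<bar>real b - u b * real g ^ N\<bar> < real g ^ J'" if "b \<in> A" for b
    using B[of b] that by (auto simp: A_def u_def)
  have "m ` A \<subseteq> {int c - 1..int c + 1} \<times> {-1..0}"
  proof
    fix z assume "z \<in> m ` A"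
    then obtain b where b: "b \<in> A" "z = m b" by auto
    define G where "G = real g ^ (N - J)"
    have G: "G > 0" using gr by (simp add: G_def)
    have "real b < (real c + 1) * G" "real c * G \<le> real b"
    proof -
      have c: "b div g ^ (N - J) = c" using b by (simp add: A_def)
      have "c * g ^ (N - J) \<le> b" unfolding c[symmetric] by (rule div_times_less_eq_dividend)
      then have "real (c * g ^ (N - J)) \<le> real b" by (simp only: of_nat_le_iff)
      then show "real c * G \<le> real b" by (simp add: G_def)
      have "b < g ^ (N - J) + c * g ^ (N - J)" unfolding c[symmetric] using g by (intro dividend_less_div_times) auto
      then have "real b < real (g ^ (N - J) + c * g ^ (N - J))" by (simp only: of_nat_less_iff)
      then show "real b < (real c + 1) * G" by (simp add: G_def algebra_simps)
    qed
    moreover have "\<bar>real b - u b * real g ^ J * G\<bar> < G" using near[OF b(1)] J'N by (simp add: NJ G_def mult_ac)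
    ultimately have "u b * real g ^ J * G < (real c + 2) * G" "(real c - 1) * G < u b * real g ^ J * G"
      by (auto simp: abs_less_iff algebra_simps)
    then have "u b * real g ^ J < real c + 2" "real c - 1 < u b * real g ^ J" using G by auto
    then have 1: "\<lfloor>u b * real g ^ J\<rfloor> \<in> {int c - 1..int c + 1}" by (auto simp: le_floor_iff floor_le_iff)
    have "\<bar>(real b - u b * real g ^ N) / real g ^ J'\<bar> < 1" using near[OF b(1)] gr by simp
    moreover have "\<lfloor>t\<rfloor> \<in> {-1..0}" if "\<bar>t\<bar> < 1" for t :: real
      using that by (auto simp: le_floor_iff floor_le_iff)
    ultimately have "\<lfloor>(real b - u b * real g ^ N) / real g ^ J'\<rfloor> \<in> {-1..0}" by blast
    with 1 show "z \<in> {int c - 1..int c + 1} \<times> {-1..0}" using b by (simp add: m_def)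
  qed
  moreover have "inj_on m A"
  proof (rule inj_onI)
    fix b b' assume b: "b \<in> A" and b': "b' \<in> A" and eq: "m b = m b'"
    have rb: "r b \<ge> 1" "r b < g ^ (j + 1)" "r b' \<ge> 1" "r b' < g ^ (j + 1)"
      using B[of b] B[of b'] b b' by (auto simp: A_def)
    have floor_eq: "\<bar>s - t\<bar> < 1" if "\<lfloor>s\<rfloor> = \<lfloor>t\<rfloor>" for s t :: real using that by linarith
    have u_eq: "u b = u b'"
    proof (rule ccontr)
      assume ne: "u b \<noteq> u b'"
      have "\<bar>u b * real g ^ J - u b' * real g ^ J\<bar> < 1" using eq by (intro floor_eq) (simp add: m_def)
      then have 1: "\<bar>u b - u b'\<bar> * real g ^ J < 1" using gr by (simp add: abs_mult flip: left_diff_distrib)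
      have "real (r b) * real (r b') * (u b - u b') = of_int (a b * int (r b') - a b' * int (r b))"
        using rb by (simp add: u_def field_simps)
      moreover have "a b * int (r b') - a b' * int (r b) \<noteq> 0"
      proof
        assume "a b * int (r b') - a b' * int (r b) = 0"
        then have "real (r b) * real (r b') * (u b - u b') = 0" using calculation by simp
        then show False using ne rb by simp
      qed
      then have "1 \<le> \<bar>a b * int (r b') - a b' * int (r b)\<bar>" by linarith
      then have "1 \<le> \<bar>real_of_int (a b * int (r b') - a b' * int (r b))\<bar>" by linarith
      ultimately have "1 \<le> \<bar>real (r b) * real (r b') * (u b - u b')\<bar>" by simp
      also have "\<dots> = real (r b) * real (r b') * \<bar>u b - u b'\<bar>" by (simp add: abs_mult)
      also have "\<dots> \<le> real g ^ (j + 1) * real g ^ (j + 1) * \<bar>u b - u b'\<bar>"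
        using rb gr by (intro mult_right_mono mult_mono) (auto simp flip: of_nat_power of_nat_mult simp del: power_Suc power_add)
      also have "real g ^ (j + 1) * real g ^ (j + 1) = real g ^ J"
        by (simp only: J_def mult_2 power_add)
      finally show False using 1 by (simp add: mult.commute)
    qed
    have "\<bar>(real b - u b * real g ^ N) / real g ^ J' - (real b' - u b' * real g ^ N) / real g ^ J'\<bar> < 1"
      using eq by (intro floor_eq) (simp add: m_def)
    then have "\<bar>(real b - real b') / real g ^ J'\<bar> < 1" unfolding u_eq by (simp flip: diff_divide_distrib)
    then have "\<bar>real b - real b'\<bar> < real (g ^ J')" using gr by simp
    then have lt: "\<bar>int b - int b'\<bar> < int (g ^ J')" by linarith
    have "b mod g ^ J' = b' mod g ^ J'" using b b' by (simp add: A_def)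
    then have "int (g ^ J') dvd int b - int b'" by (metis mod_eq_dvd_iff zmod_int)
    then have "int b - int b' = 0" using lt dvd_imp_le_int[of "int b - int b'" "int (g ^ J')"] by fastforce
    then show "b = b'" by simp
  qed
  ultimately have "card A \<le> card ({int c - 1..int c + 1} \<times> {-1..0::int})"
    by (intro card_inj_on_le) auto
  then show ?thesis by (simp add: A_def)
qed

section \<open>Low, middle and high digits of the transform\<close>

context reversal
begin

text \<open>One saving for each full window of \<open>w + 1\<close> digits among \<open>l\<close>
  consecutive ones.\<close>

definition sv :: "nat \<Rightarrow> nat \<Rightarrow> real" where
  "sv w l = (1 - 1 / (4 * real g ^ 5)) ^ (l div (w + 1))"

lemma sv_nonneg: "sv w l \<ge> 0"
  using saving_nonneg by (simp add: sv_def)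

lemma sv_antimono: "l' \<le> l \<Longrightarrow> sv w l \<le> sv w l'"
  unfolding sv_def using saving_nonneg by (intro power_decreasing div_le_mono) auto

abbreviation P :: "nat \<Rightarrow> real" where
  "P b \<equiv> (\<Prod>i<N. dker g (frq g N \<theta> b i))"

text \<open>The factors \<open>i < J\<close> depend on \<open>b / g ^ (N - J)\<close>, including its
  fractional part. Taking the worst fractional part for each integer part \<open>c\<close> gives a
  function of \<open>c\<close> alone; this is where \<open>dker_prod_L1_sup\<close> is
  needed.\<close>

lemma low_digits:
  assumes "J \<le> N"
  obtains L :: "nat \<Rightarrow> real" where "\<And>b. (\<Prod>i<J. dker g (frq g N \<theta> b i)) \<le> L (b div g ^ (N - J))"
    "(\<Sum>c<g ^ J. L c) \<le> (real g * (C_const g + 3)) ^ J" "\<And>c. L c \<ge> 0"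
proof -
  define G where "G = g ^ (N - J)"
  define LOW where "LOW = (\<lambda>c t. \<Prod>i<J. dker g (\<theta> * real g ^ (N - 1 - i) - (real c + t) * real g ^ i / real g ^ J))"
  have G: "G > 0" using g by (simp add: G_def)
  have low: "(\<Prod>i<J. dker g (frq g N \<theta> b i)) = LOW (b div G) (real (b mod G) / real G)" for b
  proof -
    have "real b = real (b div G) * real G + real (b mod G)"
      by (metis div_mult_mod_eq of_nat_add of_nat_mult)
    then have bG: "real b = real G * (real (b div G) + real (b mod G) / real G)" using G by (simp add: field_simps)
    have gN: "real g ^ N = real G * real g ^ J" using assms by (simp add: G_def flip: power_add)
    have "real b * real g ^ i / real g ^ N = (real (b div G) + real (b mod G) / real G) * real g ^ i / real g ^ J" for i
      unfolding gN by (subst bG) (use G in \<open>simp add: mult.assoc\<close>)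
    then show ?thesis unfolding LOW_def frq_def by (simp only:)
  qed
  have "\<exists>t. (0 \<le> t \<and> t \<le> 1) \<and> (\<forall>e<G. LOW c (real e / real G) \<le> LOW c t)" for c
  proof -
    let ?S = "(\<lambda>e. LOW c (real e / real G)) ` {..<G}"
    have "0 \<in> {..<G}" using G by simp
    then have fin: "finite ?S" "?S \<noteq> {}" by blast+
    from Max_in[OF fin] obtain e where e: "e < G" "Max ?S = LOW c (real e / real G)" by (elim imageE) simp
    then have "LOW c (real e' / real G) \<le> LOW c (real e / real G)" if "e' < G" for e'
      using that Max_ge[OF fin(1), of "LOW c (real e' / real G)"] by auto
    then show ?thesis using e(1) by (intro exI[of _ "real e / real G"]) auto
  qed
  then obtain T where T: "\<And>c. 0 \<le> T c \<and> T c \<le> 1" "\<And>c e. e < G \<Longrightarrow> LOW c (real e / real G) \<le> LOW c (T c)"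
    by metis
  show ?thesis
  proof (rule that[of "\<lambda>c. LOW c (T c)"])
    show "(\<Prod>i<J. dker g (frq g N \<theta> b i)) \<le> LOW (b div g ^ (N - J)) (T (b div g ^ (N - J)))" for b
      using T(2)[of "b mod G" "b div G"] G unfolding low by (simp add: G_def)
    show "(\<Sum>c<g ^ J. LOW c (T c)) \<le> (real g * (C_const g + 3)) ^ J"
      unfolding LOW_def by (rule dker_prod_L1_sup[OF g T(1)])
    show "LOW c (T c) \<ge> 0" for c by (auto simp: LOW_def intro!: prod_nonneg)
  qed
qed

text \<open>For \<open>i \<ge> N - J'\<close> the quotient \<open>b * g ^ i / g ^ N\<close> changes
  by an integer when \<open>b\<close> changes by \<open>g ^ J'\<close>. These factors are therefore
  functions of a residue, and \<open>dker_prod_L1\<close> applies without a supremum.\<close>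

lemma high_digits:
  assumes "J' \<le> N"
  obtains U :: "nat \<Rightarrow> real" where "\<And>b. (\<Prod>i\<in>{N - J'..<N}. dker g (frq g N \<theta> b i)) = U (b mod g ^ J')"
    "(\<Sum>\<rho><g ^ J'. U \<rho>) \<le> (real g * C_const g) ^ J'" "\<And>\<rho>. U \<rho> \<ge> 0"
proof -
  define U where "U = (\<lambda>\<rho>. \<Prod>i<J'. dker g (\<theta> * real g ^ (N - 1 - (N - J' + i)) - real \<rho> * real g ^ i / real g ^ J'))"
  show ?thesis
  proof (rule that[of U])
    fix b
    define \<rho> where "\<rho> = b mod g ^ J'"
    define s where "s = b div g ^ J'"
    have b: "real b = real s * real g ^ J' + real \<rho>"
      unfolding s_def \<rho>_def by (metis div_mult_mod_eq of_nat_add of_nat_mult of_nat_power)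
    have gr: "real g > 0" using g by simp
    have "(\<Prod>i\<in>{N - J'..<N}. dker g (frq g N \<theta> b i)) = (\<Prod>i<J'. dker g (frq g N \<theta> b (N - J' + i)))"
      using assms by (intro prod.reindex_bij_witness[of _ "\<lambda>i. N - J' + i" "\<lambda>i. i - (N - J')"]) auto
    also have "\<dots> = U \<rho>" unfolding U_def
    proof (rule prod.cong[OF refl])
      fix i
      have gN: "real g ^ N = real g ^ (N - J') * real g ^ J'" using assms by (simp flip: power_add)
      have "real b * real g ^ (N - J' + i) / real g ^ N = real b * real g ^ i / real g ^ J'"
        unfolding gN power_add using gr by simp
      also have "\<dots> = real \<rho> * real g ^ i / real g ^ J' + of_int (int s * int g ^ i)"
        unfolding b using gr by (simp add: field_simps)
      finally have "frq g N \<theta> b (N - J' + i) =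
          (\<theta> * real g ^ (N - 1 - (N - J' + i)) - real \<rho> * real g ^ i / real g ^ J') + of_int (- (int s * int g ^ i))"
        unfolding frq_def by simp
      then show "dker g (frq g N \<theta> b (N - J' + i)) =
          dker g (\<theta> * real g ^ (N - 1 - (N - J' + i)) - real \<rho> * real g ^ i / real g ^ J')"
        by (simp only: dker_add_int)
    qed
    finally show "(\<Prod>i\<in>{N - J'..<N}. dker g (frq g N \<theta> b i)) = U (b mod g ^ J')" by (simp add: \<rho>_def)
  next
    show "(\<Sum>\<rho><g ^ J'. U \<rho>) \<le> (real g * C_const g) ^ J'"
      unfolding U_def by (rule dker_prod_L1[OF g])
    show "U \<rho> \<ge> 0" for \<rho> by (auto simp: U_def intro!: prod_nonneg)
  qed
qed

lemma C_const_nonneg: "C_const g \<ge> 0"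
proof -
  have "0 \<le> (\<Sum>d<g. dker g (0 - real d / real g))" by (intro sum_nonneg) auto
  also have "\<dots> \<le> real g * C_const g" by (rule dker_sum_le[OF g])
  finally show ?thesis using g by (simp add: zero_le_mult_iff)
qed

text \<open>A bound for the number of \<open>b\<close> with given leading and trailing parts turns
  the sum over \<open>b\<close> into a product of two separate sums; the middle digits contribute
  the saving, uniformly in \<open>b\<close>.\<close>

lemma arc_sum:
  assumes w: "q \<le> g ^ w" "w \<ge> 1" and JN: "J + J' \<le> N" and B: "B \<subseteq> {..<g ^ N}"
    and mult: "\<And>c \<rho>. card {b \<in> B. b div g ^ (N - J) = c \<and> b mod g ^ J' = \<rho>} \<le> M"
  shows "(\<Sum>b\<in>B. P b) \<le> real M * (real g ^ N * (C_const g + 3) ^ (J + J') * sv w (N - (J + J')))"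
proof -
  define D where "D = C_const g + 3"
  define l where "l = N - (J + J')"
  have fin: "finite B" using B finite_subset by blast
  have D0: "real g * D \<ge> 0" using C_const_nonneg by (simp add: D_def)
  obtain L where L: "\<And>b. (\<Prod>i<J. dker g (frq g N \<theta> b i)) \<le> L (b div g ^ (N - J))"
    "(\<Sum>c<g ^ J. L c) \<le> (real g * D) ^ J" "\<And>c. L c \<ge> 0"
    using low_digits[of J] JN unfolding D_def by (metis add_leD1)
  obtain U where U: "\<And>b. (\<Prod>i\<in>{N - J'..<N}. dker g (frq g N \<theta> b i)) = U (b mod g ^ J')"
    "(\<Sum>\<rho><g ^ J'. U \<rho>) \<le> (real g * C_const g) ^ J'" "\<And>\<rho>. U \<rho> \<ge> 0"
    using high_digits[of J'] JN by (metis add_leD2)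
  define mid where "mid = real g ^ l * sv w l"
  have mid0: "mid \<ge> 0" by (simp add: mid_def sv_nonneg)
  have P_le: "P b \<le> mid * (L (b div g ^ (N - J)) * U (b mod g ^ J'))" for b
  proof -
    let ?f = "\<lambda>i. dker g (frq g N \<theta> b i)"
    have NJ: "N - J' = J + l" using JN by (simp add: l_def)
    have "(\<Prod>i<N. ?f i) = (\<Prod>i\<in>{0..<N}. ?f i)" by (simp add: atLeast0LessThan)
    also have "\<dots> = (\<Prod>i\<in>{0..<N - J'}. ?f i) * (\<Prod>i\<in>{N - J'..<N}. ?f i)"
      by (rule prod.atLeastLessThan_concat[symmetric]) auto
    also have "(\<Prod>i\<in>{0..<N - J'}. ?f i) = (\<Prod>i\<in>{0..<J}. ?f i) * (\<Prod>i\<in>{J..<J + l}. ?f i)"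
      unfolding NJ by (rule prod.atLeastLessThan_concat[symmetric]) auto
    finally have split: "(\<Prod>i<N. ?f i) = (\<Prod>i<J. ?f i) * (\<Prod>i\<in>{J..<J + l}. ?f i) * U (b mod g ^ J')"
      by (simp only: U atLeast0LessThan)
    have "(\<Prod>i\<in>{J..<J + l}. ?f i) \<le> mid"
      unfolding mid_def sv_def using w JN by (intro block_saving) (auto simp: l_def)
    then have "(\<Prod>i<J. ?f i) * (\<Prod>i\<in>{J..<J + l}. ?f i) * U (b mod g ^ J') \<le> L (b div g ^ (N - J)) * mid * U (b mod g ^ J')"
      using L U by (intro mult_right_mono mult_mono) (auto intro!: prod_nonneg)
    then show ?thesis unfolding split by (simp add: mult_ac)
  qed
  have "(\<Sum>b\<in>B. P b) \<le> (\<Sum>b\<in>B. mid * (L (b div g ^ (N - J)) * U (b mod g ^ J')))"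
    by (rule sum_mono) (rule P_le)
  also have "\<dots> = mid * (\<Sum>b\<in>B. (\<lambda>(c, \<rho>). L c * U \<rho>) (b div g ^ (N - J), b mod g ^ J'))"
    by (simp add: sum_distrib_left)
  also have "(\<Sum>b\<in>B. (\<lambda>(c, \<rho>). L c * U \<rho>) (b div g ^ (N - J), b mod g ^ J')) =
      (\<Sum>z\<in>{..<g ^ J} \<times> {..<g ^ J'}. of_nat (card {b \<in> B. (b div g ^ (N - J), b mod g ^ J') = z}) * (\<lambda>(c, \<rho>). L c * U \<rho>) z)"
  proof (rule sum_fun_comp[OF fin])
    show "(\<lambda>b. (b div g ^ (N - J), b mod g ^ J')) ` B \<subseteq> {..<g ^ J} \<times> {..<g ^ J'}"
    proof -
      have "b div g ^ (N - J) < g ^ J" if "b \<in> B" for b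
      proof -
        have "b < g ^ N" using that B by auto
        also have "g ^ N = g ^ J * g ^ (N - J)" using JN by (simp flip: power_add)
        finally show ?thesis by (rule less_mult_imp_div_less)
      qed
      then show ?thesis using g by auto
    qed
  qed auto
  also have "\<dots> \<le> (\<Sum>z\<in>{..<g ^ J} \<times> {..<g ^ J'}. real M * (\<lambda>(c, \<rho>). L c * U \<rho>) z)"
  proof (rule sum_mono)
    fix z assume "z \<in> {..<g ^ J} \<times> {..<g ^ J'}"
    obtain c \<rho> where z: "z = (c, \<rho>)" by (cases z)
    have "card {b \<in> B. (b div g ^ (N - J), b mod g ^ J') = z} \<le> M" using mult[of c \<rho>] by (simp add: z)
    then show "of_nat (card {b \<in> B. (b div g ^ (N - J), b mod g ^ J') = z}) * (\<lambda>(c, \<rho>). L c * U \<rho>) z \<le> real M * (\<lambda>(c, \<rho>). L c * U \<rho>) z"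
      using L(3) U(3) by (intro mult_right_mono) (auto simp: z)
  qed
  also have "\<dots> = real M * ((\<Sum>c<g ^ J. L c) * (\<Sum>\<rho><g ^ J'. U \<rho>))"
  proof -
    have "(\<Sum>c<g ^ J. L c) * (\<Sum>\<rho><g ^ J'. U \<rho>) = (\<Sum>z\<in>{..<g ^ J} \<times> {..<g ^ J'}. (\<lambda>(c, \<rho>). L c * U \<rho>) z)"
      by (simp only: sum_product sum.cartesian_product)
    then show ?thesis by (simp only: sum_distrib_left)
  qed
  also have "\<dots> \<le> real M * ((real g * D) ^ J * (real g * D) ^ J')"
  proof (intro mult_left_mono mult_mono)
    show "(\<Sum>\<rho><g ^ J'. U \<rho>) \<le> (real g * D) ^ J'"
      using C_const_nonneg by (intro order.trans[OF U(2)] power_mono mult_left_mono) (auto simp: D_def)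
  qed (use L U D0 in \<open>auto intro!: sum_nonneg\<close>)
  finally have "(\<Sum>b\<in>B. P b) \<le> mid * (real M * ((real g * D) ^ J * (real g * D) ^ J'))"
    using mid0 by (simp add: mult_left_mono)
  also have "\<dots> = real M * (real g ^ l * real g ^ (J + J') * D ^ (J + J') * sv w l)"
    by (simp add: mid_def power_mult_distrib power_add mult_ac)
  also have "real g ^ l * real g ^ (J + J') = real g ^ N" using JN by (simp add: l_def flip: power_add)
  finally show ?thesis by (simp add: D_def l_def)
qed

lemma total_L1: "(\<Sum>b<g ^ N. P b) \<le> (real g * C_const g) ^ N"
  unfolding frq_def by (rule dker_prod_L1[OF g])

end

section \<open>Summation over all frequencies\<close>

lemma power_bracket:
  fixes y :: real and g :: nat
  assumes "1 \<le> y" "y < real g ^ (N + 1)"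
  shows "\<exists>j\<le>N. real g ^ j \<le> y \<and> y < real g ^ (j + 1)"
  using assms(2)
proof (induction N)
  case (Suc N)
  then show ?case using assms(1) by (cases "y < real g ^ (N + 1)") (auto intro: le_SucI)
qed (use assms(1) in auto)

context reversal
begin

text \<open>The first term pays the full L1 norm of the transform for the part
  \<open>x powr (4/5)\<close> of the bound for \<open>S\<close>. The second sums at most
  \<open>(N + 1)\<^sup>2\<close> classes of major arcs, in each of which the decay of
  \<open>S\<close> pays for the digits that resolve the class.\<close>

theorem reversed_prime_sum:
  assumes N: "N \<ge> 30" and w: "q \<le> g ^ w" "w \<ge> 1" and D4: "(C_const g + 3) ^ 4 \<le> real g"
  defines "H \<equiv> 1 + ln (real g ^ N)"
  shows "norm (\<Sum>p | prime p \<and> p < g ^ N. ee (\<theta> * real (rev_digits g N p))) \<le>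
    540 * H ^ 3 * (2 * (real g ^ N) powr (4/5) * C_const g ^ N + 6 * (real N + 1)\<^sup>2 * real g * real g ^ N * sv w (N div 10))"
proof -
  define x where "x = g ^ N"
  define X where "X = real x"
  have gr: "real g \<ge> 2" using g by simp
  have Xg: "X = real g ^ N" by (simp add: X_def x_def)
  have x2: "x \<ge> 2"
  proof -
    have "g ^ 1 \<le> g ^ N" using g N by (intro power_increasing) auto
    then show ?thesis using g by (simp add: x_def)
  qed
  have X2: "X \<ge> 2" using x2 by (simp add: X_def)
  have H: "H = 1 + ln (real x)" by (simp add: H_def x_def)
  have H0: "H ^ 3 \<ge> 0" using x2 by (simp add: H)
  define D where "D = C_const g + 3"
  have D3: "D \<ge> 1" using C_const_nonneg by (simp add: D_def)
  define E where "E = X powr (4/5)"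
  define \<kappa> where "\<kappa> = (\<lambda>(a::int) (r::nat) b. X * \<bar>real b / X - of_int a / real r\<bar>)"
  define S where "S = (\<lambda>b. norm (\<Sum>p | prime p \<and> p < x. ee (real p * (real b / X))))"
  have "\<exists>a r. r \<ge> 1 \<and> real r * \<kappa> a r b \<le> X powr (2/5) \<and>
      S b \<le> 540 * H ^ 3 * (X / sqrt (real r * max 1 (\<kappa> a r b)) + E)" for b
    by (rule prime_exp_sum_near_rational[OF x2, of "real b / X"])
       (unfold \<kappa>_def S_def E_def H X_def, blast)
  then obtain a r where ar: "\<And>b. r b \<ge> (1::nat)" "\<And>b. real (r b) * \<kappa> (a b) (r b) b \<le> X powr (2/5)"
     "\<And>b. S b \<le> 540 * H ^ 3 * (X / sqrt (real (r b) * max 1 (\<kappa> (a b) (r b) b)) + E)"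
    by metis
  define k where "k = (\<lambda>b. max 1 (\<kappa> (a b) (r b) b))"
  define Y where "Y = (\<lambda>b. X / sqrt (real (r b) * k b))"
  have k1: "k b \<ge> 1" for b by (simp add: k_def)
  have r1: "real (r b) \<ge> 1" for b using ar(1)[of b] by simp
  have Y0: "Y b \<ge> 0" for b using X2 by (auto simp: Y_def k_def)
  have SY: "S b \<le> 540 * H ^ 3 * (Y b + E)" for b using ar(3)[of b] by (simp add: Y_def k_def)
  \<comment> \<open>Off \<open>maj\<close> the denominator exceeds \<open>x powr (2/5)\<close>, so
    its square root alone brings \<open>Y\<close> below \<open>E\<close>; on \<open>maj\<close> the
    product \<open>r * k\<close> is at most \<open>x powr (2/5)\<close>.\<close>
  define maj where "maj = {b. b < x \<and> real (r b) \<le> X powr (2/5)}"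
  have P0: "P b \<ge> 0" for b by (auto intro!: prod_nonneg)
  have minor: "Y b \<le> E" if "b < x" "b \<notin> maj" for b
  proof -
    have "X powr (2/5) * 1 \<le> real (r b) * k b" using that k1[of b] by (intro mult_mono) (auto simp: maj_def)
    then have "sqrt (X powr (2/5)) \<le> sqrt (real (r b) * k b)" by (intro real_sqrt_le_mono) simp
    moreover have "sqrt (X powr (2/5)) = X powr (1/5)"
      using X2 by (simp add: powr_half_sqrt[symmetric] powr_powr)
    ultimately have "X powr (1/5) \<le> sqrt (real (r b) * k b)" by simp
    then have "Y b \<le> X / X powr (1/5)"
      unfolding Y_def using X2 k1[of b] r1[of b] by (intro divide_left_mono mult_pos_pos) (auto intro: less_le_trans[of 0 1])
    also have "\<dots> = X powr 1 / X powr (1/5)" using X2 by simp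
    also have "\<dots> = E" by (simp only: E_def powr_diff[symmetric]) simp
    finally show ?thesis .
  qed
  have X25: "X powr (2/5) \<le> X" using X2 powr_mono[of "2/5" 1 X] by simp
  have maj_size: "real (r b) * k b \<le> X powr (2/5)" if "b \<in> maj" for b
    using that ar(2)[of b] by (auto simp: k_def maj_def max_def)
  have Xlt: "X < real g ^ (N + 1)" using gr by (simp add: Xg)
  have "\<exists>j\<le>N. real g ^ j \<le> real (r b) \<and> real (r b) < real g ^ (j + 1)" if "b \<in> maj" for b
    using that r1[of b] X25 Xlt by (intro power_bracket) (auto simp: maj_def)
  then obtain jj where jj: "\<And>b. b \<in> maj \<Longrightarrow> jj b \<le> N \<and> real g ^ jj b \<le> real (r b) \<and> real (r b) < real g ^ (jj b + 1)"
    by metis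
  have "\<exists>j\<le>N. real g ^ j \<le> k b \<and> k b < real g ^ (j + 1)" if "b \<in> maj" for b
  proof (rule power_bracket)
    have "1 * k b \<le> real (r b) * k b" using r1[of b] k1[of b] by (intro mult_right_mono) auto
    then show "k b < real g ^ (N + 1)" using maj_size[OF that] X25 Xlt by linarith
  qed (rule k1)
  then obtain kk where kk: "\<And>b. b \<in> maj \<Longrightarrow> kk b \<le> N \<and> real g ^ kk b \<le> k b \<and> k b < real g ^ (kk b + 1)"
    by metis
  have cls: "(\<Sum>b | b \<in> maj \<and> (jj b, kk b) = z. P b * Y b) \<le> 6 * X\<^sup>2 * real g * sv w (N div 10)" for z
  proof -
    obtain j m where z: "z = (j, m)" by (cases z)
    define B where "B = {b. b \<in> maj \<and> (jj b, kk b) = z}"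
    have B: "b \<in> maj" "real g ^ j \<le> real (r b)" "real (r b) < real g ^ (j + 1)" "real g ^ m \<le> k b" "k b < real g ^ (m + 1)"
      if "b \<in> B" for b using that jj[of b] kk[of b] by (auto simp: B_def z)
    show ?thesis
    proof (cases "B = {}")
      case True
      then have "(\<Sum>b\<in>B. P b * Y b) = 0" by simp
      then show ?thesis unfolding B_def using sv_nonneg X2 by simp
    next
      case False
      then obtain b0 where b0: "b0 \<in> B" by blast
      \<comment> \<open>From \<open>r \<le> x powr (2/5)\<close> and
        \<open>r * k \<le> x powr (2/5)\<close>: a fifth of the digits remains, of which a tenth of
        \<open>N\<close> is kept for the saving and the rest, by \<open>N \<ge> 30\<close>, covers
        the additional 3 digits.\<close>
      have "real g ^ (2 * j + m) = real g ^ j * (real g ^ j * real g ^ m)" by (simp add: power_add mult_2)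
      also have "\<dots> \<le> real (r b0) * (real (r b0) * k b0)" using B[OF b0] gr by (intro mult_mono) auto
      also have "\<dots> \<le> X powr (2/5) * X powr (2/5)"
        using B(1)[OF b0] maj_size[of b0] k1[of b0] by (intro mult_mono) (auto simp: maj_def)
      also have "\<dots> = real g powr (real N * (4/5))"
        using gr by (simp add: Xg powr_add[symmetric] powr_realpow[symmetric] powr_powr mult.commute)
      also have "real g ^ (2 * j + m) = real g powr real (2 * j + m)" using gr by (intro powr_realpow[symmetric]) auto
      finally have "real g powr real (2 * j + m) \<le> real g powr (real N * (4/5))" .
      then have "real (2 * j + m) \<le> real N * (4/5)" using gr by (subst (asm) powr_le_cancel_iff) auto
      then have "real (5 * (2 * j + m)) \<le> real (4 * N)" by simp
      then have "5 * (2 * j + m) \<le> 4 * N" by (simp only: of_nat_le_iff)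
      then have "t + (2 * (j + 1) + (m + 1)) \<le> N" if "10 * t \<le> N" for t using that N by simp
      then have "N div 10 + (2 * (j + 1) + (m + 1)) \<le> N" by simp
      then have size: "2 * (j + 1) + (m + 1) \<le> N" "N div 10 \<le> N - (2 * (j + 1) + (m + 1))" by linarith+
      have "(\<Sum>b\<in>B. P b) \<le> real 6 * (real g ^ N * (C_const g + 3) ^ (2 * (j + 1) + (m + 1)) * sv w (N - (2 * (j + 1) + (m + 1))))"
      proof (rule arc_sum[OF w size(1)])
        show "B \<subseteq> {..<g ^ N}" by (auto simp: B_def maj_def x_def)
        show "card {b \<in> B. b div g ^ (N - 2 * (j + 1)) = c \<and> b mod g ^ (m + 1) = \<rho>} \<le> 6" for c \<rho>
        proof (rule major_arc_multiplicity[OF g size(1)])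
          fix b assume b: "b \<in> B"
          have "X * (real b / X - of_int (a b) / real (r b)) = real b - of_int (a b) * real g ^ N / real (r b)"
          proof -
            have "X * (real b / X - v) = real b - v * X" for v using X2 by (simp add: field_simps)
            then show ?thesis by (simp add: Xg)
          qed
          then have "\<kappa> (a b) (r b) b = \<bar>real b - of_int (a b) * real g ^ N / real (r b)\<bar>"
            using X2 by (metis \<kappa>_def abs_mult abs_of_nonneg order.trans zero_le_numeral)
          then have "\<bar>real b - of_int (a b) * real g ^ N / real (r b)\<bar> < real g ^ (m + 1)"
            using B(5)[OF b] by (simp add: k_def)
          moreover have "r b < g ^ (j + 1)" using B(3)[OF b] by (metis of_nat_less_iff of_nat_power)
          ultimately show "1 \<le> r b \<and> r b < g ^ (j + 1) \<and> \<bar>real b - of_int (a b) * real g ^ N / real (r b)\<bar> < real g ^ (m + 1)"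
            using ar(1)[of b] by simp
        qed
      qed
      also have "\<dots> \<le> 6 * (X * D ^ (2 * (j + 1) + (m + 1)) * sv w (N div 10))"
        unfolding D_def[symmetric] Xg of_nat_numeral using D3 gr sv_antimono[OF size(2), of w]
        by (intro mult_left_mono) (auto intro!: mult_nonneg_nonneg)
      also have "\<dots> \<le> 6 * (X * (real g * sqrt (real g) ^ (j + m)) * sv w (N div 10))"
      proof (intro mult_left_mono mult_right_mono sv_nonneg)
        \<comment> \<open>Four powers of \<open>D\<close> are worth \<open>g\<close>, so
          \<open>D ^ (2 * j + m + 3)\<close> is at most \<open>g * sqrt g ^ (j + m)\<close>, which
          the decay of \<open>Y\<close> cancels up to the factor \<open>g\<close>.\<close>
        have "D\<^sup>2 \<le> sqrt (real g)"
          using D4 by (intro real_le_rsqrt) (simp add: D_def flip: power_mult)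
        then have "(D\<^sup>2) ^ (j + m + 2) \<le> sqrt (real g) ^ (j + m + 2)" by (intro power_mono) auto
        moreover have "D ^ (2 * (j + 1) + (m + 1)) \<le> D ^ (2 * (j + m + 2))" using D3 by (intro power_increasing) auto
        moreover have "D ^ (2 * (j + m + 2)) = (D\<^sup>2) ^ (j + m + 2)" by (rule power_mult)
        moreover have "sqrt (real g) ^ (j + m + 2) = real g * sqrt (real g) ^ (j + m)"
          using gr by (simp add: power_add)
        ultimately show "D ^ (2 * (j + 1) + (m + 1)) \<le> real g * sqrt (real g) ^ (j + m)" by linarith
      qed (use X2 in auto)
      finally have sumP: "(\<Sum>b\<in>B. P b) \<le> 6 * (X * (real g * sqrt (real g) ^ (j + m)) * sv w (N div 10))" .
      define G where "G = sqrt (real g) ^ (j + m)"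
      have G: "G > 0" using gr by (simp add: G_def)
      have Yle: "Y b \<le> X / G" if "b \<in> B" for b
      proof -
        have "G = sqrt (real g ^ j * real g ^ m)" by (simp add: G_def real_sqrt_power real_sqrt_mult power_add)
        also have "\<dots> \<le> sqrt (real (r b) * k b)" using B[OF that] gr by (intro real_sqrt_le_mono mult_mono) auto
        finally have "G \<le> sqrt (real (r b) * k b)" .
        moreover have "0 < real (r b) * k b" using k1[of b] r1[of b] by (intro mult_pos_pos) linarith+
        ultimately show ?thesis unfolding Y_def using X2 G by (intro divide_left_mono mult_pos_pos) auto
      qed
      have "(\<Sum>b\<in>B. P b * Y b) \<le> (\<Sum>b\<in>B. P b * (X / G))"
        using Yle P0 by (intro sum_mono mult_left_mono) auto
      also have "\<dots> = (\<Sum>b\<in>B. P b) * (X / G)" by (simp only: sum_distrib_right)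
      also have "\<dots> \<le> (6 * (X * (real g * G) * sv w (N div 10))) * (X / G)"
        using sumP X2 G by (intro mult_right_mono) (auto simp: G_def)
      also have "\<dots> = 6 * X\<^sup>2 * real g * sv w (N div 10)" using G by (simp add: power2_eq_square)
      finally show ?thesis by (simp only: B_def)
    qed
  qed
  have finmaj: "finite maj" by (simp add: maj_def)
  have "(\<Sum>b\<in>maj. P b * Y b) = (\<Sum>z\<in>{..N} \<times> {..N}. \<Sum>b | b \<in> maj \<and> (jj b, kk b) = z. P b * Y b)"
    by (rule sum.group[symmetric]) (use finmaj jj kk in auto)
  also have "\<dots> \<le> (\<Sum>z\<in>{..N} \<times> {..N}. 6 * X\<^sup>2 * real g * sv w (N div 10))"
    by (rule sum_mono) (rule cls)
  also have "\<dots> = (real N + 1)\<^sup>2 * (6 * X\<^sup>2 * real g * sv w (N div 10))"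
    by (simp add: power2_eq_square algebra_simps)
  finally have major: "(\<Sum>b\<in>maj. P b * Y b) \<le> (real N + 1)\<^sup>2 * (6 * X\<^sup>2 * real g * sv w (N div 10))" .
  have "(\<Sum>b<x. P b * (Y b + E)) \<le> (\<Sum>b<x. P b * (2 * E) + (if b \<in> maj then P b * Y b else 0))"
  proof (rule sum_mono)
    fix b assume b: "b \<in> {..<x}"
    show "P b * (Y b + E) \<le> P b * (2 * E) + (if b \<in> maj then P b * Y b else 0)"
    proof (cases "b \<in> maj")
      case True
      have "P b * E \<ge> 0" using P0 by (simp add: E_def)
      moreover have "P b * (Y b + E) = P b * Y b + P b * E" "P b * (2 * E) = P b * E + P b * E"
        by (simp_all add: algebra_simps)
      ultimately show ?thesis using True by (simp only: if_True)
    next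
      case False
      then have "P b * (Y b + E) \<le> P b * (2 * E)" using minor[of b] b P0 by (intro mult_left_mono) auto
      then show ?thesis using False by simp
    qed
  qed
  also have "\<dots> = (\<Sum>b<x. P b) * (2 * E) + (\<Sum>b\<in>maj. P b * Y b)"
  proof -
    have "{b. b \<in> {..<x} \<and> b \<in> maj} = maj" by (auto simp: maj_def)
    then show ?thesis
      by (simp only: sum.distrib sum_distrib_right[symmetric] sum.inter_filter[OF finite_lessThan, symmetric])
  qed
  also have "\<dots> \<le> (real g * C_const g) ^ N * (2 * E) + (real N + 1)\<^sup>2 * (6 * X\<^sup>2 * real g * sv w (N div 10))"
    using total_L1 major unfolding x_def by (intro add_mono mult_right_mono) (auto simp: E_def)
  finally have main: "(\<Sum>b<x. P b * (Y b + E)) \<le> (real g * C_const g) ^ N * (2 * E) + (real N + 1)\<^sup>2 * (6 * X\<^sup>2 * real g * sv w (N div 10))" .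
  have "norm (\<Sum>p | prime p \<and> p < g ^ N. ee (\<theta> * real (rev_digits g N p))) \<le> (\<Sum>b<x. P b * S b) / X"
  proof -
    have "norm (\<Sum>p\<in>{p. prime p \<and> p < x}. ee (\<theta> * real (rev_digits g N p))) \<le>
      (\<Sum>b<x. norm (\<Sum>n<x. ee (\<theta> * real (rev_digits g N n)) * ee (- (real n * real b / real x))) *
        norm (\<Sum>p\<in>{p. prime p \<and> p < x}. ee (real p * (real b / real x)))) / real x"
      using x2 by (intro fourier_inversion_norm) auto
    then show ?thesis unfolding x_def norm_fourier_rev S_def X_def .
  qed
  also have "\<dots> \<le> (\<Sum>b<x. P b * (540 * H ^ 3 * (Y b + E))) / X"
    using SY P0 X2 by (intro divide_right_mono sum_mono mult_left_mono) auto
  also have "(\<Sum>b<x. P b * (540 * H ^ 3 * (Y b + E))) = 540 * H ^ 3 * (\<Sum>b<x. P b * (Y b + E))"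
    unfolding sum_distrib_left by (intro sum.cong) (simp_all add: mult_ac)
  also have "\<dots> / X \<le> 540 * H ^ 3 * ((real g * C_const g) ^ N * (2 * E) + (real N + 1)\<^sup>2 * (6 * X\<^sup>2 * real g * sv w (N div 10))) / X"
    using main H0 X2 by (intro divide_right_mono mult_left_mono) auto
  also have "\<dots> = 540 * H ^ 3 * (2 * E * C_const g ^ N + 6 * (real N + 1)\<^sup>2 * real g * X * sv w (N div 10))"
    using X2 by (simp add: power_mult_distrib Xg[symmetric] power2_eq_square[of X] field_simps)
  finally show ?thesis by (simp only: E_def Xg)
qed

end

section \<open>Computability of powers of two\<close>

lemma evaluates_Comp1: "evaluates h xs y \<Longrightarrow> evaluates f [y] z \<Longrightarrow> evaluates (Comp f [h]) xs z"
  by (rule evaluates_Comp[of "[y]"]) auto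

lemma evaluates_funpow_Comp:
  assumes "\<And>y. evaluates f [y] (F y)" "evaluates h xs y"
  shows "evaluates (((\<lambda>h. Comp f [h]) ^^ n) h) xs ((F ^^ n) y)"
  by (induction n) (auto intro!: evaluates_Comp1 assms)

definition rec_succs :: "nat \<Rightarrow> recfun \<Rightarrow> recfun" where
  "rec_succs n = (\<lambda>h. Comp Succ [h]) ^^ n"

lemma evaluates_succs: "evaluates h xs y \<Longrightarrow> z = y + n \<Longrightarrow> evaluates (rec_succs n h) xs z"
  using evaluates_funpow_Comp[of Succ Suc h xs y n] evaluates_Succ by (simp add: rec_succs_def add.commute)

definition rec_pred :: recfun where
  "rec_pred = Prec Zero (Proj 0)"

lemma evaluates_pred: "evaluates rec_pred [y] (y - 1)"
proof (induction y)
  case 0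
  show ?case unfolding rec_pred_def by (auto intro!: evaluates_Prec_0 evaluates_Zero)
next
  case (Suc y)
  have "evaluates (Proj 0) [y, y - 1] ([y, y - 1] ! 0)" by (rule evaluates_Proj) simp
  then show ?case using Suc unfolding rec_pred_def by (auto intro: evaluates_Prec_Suc)
qed

definition rec_preds :: "nat \<Rightarrow> recfun \<Rightarrow> recfun" where
  "rec_preds n = (\<lambda>h. Comp rec_pred [h]) ^^ n"

lemma evaluates_preds: "evaluates h xs y \<Longrightarrow> z = y - n \<Longrightarrow> evaluates (rec_preds n h) xs z"
proof -
  assume *: "evaluates h xs y" "z = y - n"
  have "((\<lambda>y. y - 1) ^^ n) y = y - n" by (induction n) auto
  then show ?thesis using evaluates_funpow_Comp[of rec_pred "\<lambda>y. y - 1" h xs y n] evaluates_pred *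
    by (simp add: rec_preds_def)
qed

lemma evaluates_Proj': "i < length xs \<Longrightarrow> z = xs ! i \<Longrightarrow> evaluates (Proj i) xs z"
  by (simp add: evaluates_Proj)

definition rec_double :: recfun where
  "rec_double = Prec Zero (rec_succs 2 (Proj 1))"

lemma evaluates_double: "evaluates rec_double [y] (2 * y)"
proof (induction y)
  case 0
  show ?case unfolding rec_double_def by (auto intro!: evaluates_Prec_0 evaluates_Zero)
next
  case (Suc y)
  have "evaluates (rec_succs 2 (Proj 1)) [y, 2 * y] (2 * Suc y)"
    by (rule evaluates_succs[OF evaluates_Proj'[OF _ refl]]) auto
  then show ?case using Suc unfolding rec_double_def by (rule evaluates_Prec_Suc[rotated])
qed

definition rec_pow2 :: recfun where
  "rec_pow2 = Prec (rec_succs 1 Zero) (Comp rec_double [Proj 1])"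

lemma evaluates_pow2: "evaluates rec_pow2 [y] (2 ^ y)"
proof (induction y)
  case 0
  show ?case unfolding rec_pow2_def
    by (auto intro!: evaluates_Prec_0 evaluates_succs[OF evaluates_Zero])
next
  case (Suc y)
  have "evaluates (Comp rec_double [Proj 1]) [y, 2 ^ y] (2 * 2 ^ y)"
    by (rule evaluates_Comp1[OF evaluates_Proj'[OF _ refl]]) (auto intro: evaluates_double)
  then show ?case using Suc unfolding rec_pow2_def by (auto intro: evaluates_Prec_Suc)
qed

text \<open>The recursion runs on \<open>n\<close>, with \<open>k\<close> as a parameter;
  \<open>m\<close> and \<open>s\<close> are built into the program as iterated successors.\<close>

lemma evaluates_linear_up:
  "evaluates (Prec (rec_succs m (Proj 0)) (rec_succs s (Proj 1))) [n, k] (k + (m + s * n))"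
proof (induction n)
  case 0
  show ?case by (rule evaluates_Prec_0, rule evaluates_succs[OF evaluates_Proj'[OF _ refl]]) auto
next
  case (Suc n)
  have "evaluates (rec_succs s (Proj 1)) (n # (k + (m + s * n)) # [k]) (k + (m + s * Suc n))"
    by (rule evaluates_succs[OF evaluates_Proj'[OF _ refl]]) auto
  then show ?case using Suc by (rule evaluates_Prec_Suc[rotated])
qed

lemma evaluates_linear_down:
  "evaluates (Prec (rec_preds m (Proj 0)) (rec_preds s (Proj 1))) [n, k] (k - (m + s * n))"
proof (induction n)
  case 0
  show ?case by (rule evaluates_Prec_0, rule evaluates_preds[OF evaluates_Proj'[OF _ refl]]) auto
next
  case (Suc n)
  have "evaluates (rec_preds s (Proj 1)) (n # (k - (m + s * n)) # [k]) (k - (m + s * Suc n))"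
    by (rule evaluates_preds[OF evaluates_Proj'[OF _ refl]]) auto
  then show ?case using Suc by (rule evaluates_Prec_Suc[rotated])
qed

lemma recursive2_zero: "recursive2 (\<lambda>_ _. 0)"
  unfolding recursive2_def by (auto intro!: exI[of _ Zero] evaluates_Zero)

lemma effectively_computable_power: "effectively_computable (\<lambda>n. 2 ^ (m + s * n))"
proof -
  have "recursive2 (\<lambda>n k. 2 ^ (k + (m + s * n)))"
    unfolding recursive2_def by (blast intro: evaluates_Comp1 evaluates_linear_up evaluates_pow2)
  moreover have "\<bar>2 ^ (m + s * n) - (real (2 ^ (k + (m + s * n))) - real 0) / 2 ^ k\<bar> \<le> 1 / 2 ^ k" for n k
    by (simp add: power_add)
  ultimately show ?thesis unfolding effectively_computable_def using recursive2_zero by blast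
qed

text \<open>With truncated subtraction, \<open>2 ^ (k - t) / 2 ^ k\<close> is \<open>2 ^ -t\<close> for \<open>t \<le> k\<close> and \<open>2 ^ -k\<close>
  otherwise, which is still close enough.\<close>

lemma effectively_computable_inverse_power: "effectively_computable (\<lambda>n. 1 / 2 ^ (m + s * n))"
proof -
  have "recursive2 (\<lambda>n k. 2 ^ (k - (m + s * n)))"
    unfolding recursive2_def by (blast intro: evaluates_Comp1 evaluates_linear_down evaluates_pow2)
  moreover have "\<bar>1 / 2 ^ (m + s * n) - (real (2 ^ (k - (m + s * n))) - real 0) / 2 ^ k\<bar> \<le> 1 / 2 ^ k" for n k
  proof (cases "m + s * n \<le> k")
    case True
    then have "(2::real) ^ k = 2 ^ (k - (m + s * n)) * 2 ^ (m + s * n)" by (simp flip: power_add)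
    then show ?thesis by simp
  next
    case False
    have "(1::real) / 2 ^ (m + s * n) \<le> 1 / 2 ^ k" using False by (intro divide_left_mono power_increasing) auto
    then show ?thesis using False by simp
  qed
  ultimately show ?thesis unfolding effectively_computable_def using recursive2_zero by blast
qed

section \<open>Uniformity in the base\<close>

lemma C_const_le_ln:
  assumes "g \<ge> 31699"
  shows "C_const g \<le> ln (real g) + 3"
proof -
  have "2 / pi * (ln (2 * real g / pi) + 1 + 1 / 10 ^ 8) \<le> 1 * (ln (real g) + 1 + 1 / 10 ^ 8)"
  proof (rule mult_mono)
    have "ln (2 * real g / pi) \<le> ln (real g)"
      using assms pi_gt3 by (subst ln_le_cancel_iff) (auto simp: field_simps)
    then show "ln (2 * real g / pi) + 1 + 1 / 10 ^ 8 \<le> ln (real g) + 1 + 1 / 10 ^ 8" by simp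
    have "ln (2 * real g / pi) \<ge> 0" using assms pi_less_4 by (intro ln_ge_zero) (auto simp: field_simps)
    then show "0 \<le> ln (2 * real g / pi) + 1 + 1 / 10 ^ 8" by simp
  qed (use pi_gt3 in auto)
  then show ?thesis using C_const_upper[OF assms] by simp
qed

text \<open>The exponent tends to 0 with growing \<open>g\<close>, so it is below 1/10 beyond some
  \<open>G\<close>, and the finitely many other bases have a largest exponent below 1/5. A single
  \<open>\<epsilon>\<close> for all \<open>g\<close> makes the final constants simple functions of
  \<open>g\<close>, without computing \<open>alpha_const\<close>.\<close>

lemma uniform_alpha:
  obtains \<epsilon> :: real where "\<epsilon> > 0" "\<And>g. g \<ge> 31699 \<Longrightarrow> C_const g \<le> real g powr (1/5 - \<epsilon>)"
proof -
  have lim: "((\<lambda>n::nat. ln (ln (real n) + 3) / ln (real n)) \<longlongrightarrow> 0) at_top" by real_asymp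
  then have "eventually (\<lambda>n::nat. ln (ln (real n) + 3) / ln (real n) < 1 / 10) at_top"
    by (rule order_tendstoD) simp
  then obtain G where G: "\<And>n. n \<ge> G \<Longrightarrow> ln (ln (real n) + 3) / ln (real n) < 1 / 10"
    by (auto simp: eventually_at_top_linorder)
  define A where "A = alpha_const ` {31699..max 31699 G}"
  have A: "finite A" "A \<noteq> {}" by (auto simp: A_def)
  have "Max A < 1 / 5" using A alpha_const_less_iff by (subst Max_less_iff) (auto simp: A_def)
  define \<epsilon> where "\<epsilon> = min (1/10) (1/5 - Max A)"
  show ?thesis
  proof (rule that[of \<epsilon>])
    show "\<epsilon> > 0" using \<open>Max A < 1 / 5\<close> by (simp add: \<epsilon>_def)
    fix g :: nat assume g: "g \<ge> 31699"
    have lng: "ln (real g) > 0" using g by simp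
    have C1: "C_const g > 1" using g by (intro C_const_gt_1) auto
    have "alpha_const g \<le> 1/5 - \<epsilon>"
    proof (cases "g \<le> G")
      case True
      then have "alpha_const g \<le> Max A" using A g by (intro Max_ge) (auto simp: A_def)
      then show ?thesis by (simp add: \<epsilon>_def)
    next
      case False
      have "ln (C_const g) \<le> ln (ln (real g) + 3)" using C1 lng C_const_le_ln[OF g] by (subst ln_le_cancel_iff) auto
      then have "alpha_const g \<le> ln (ln (real g) + 3) / ln (real g)"
        unfolding alpha_const_def using lng by (intro divide_right_mono) auto
      also have "\<dots> < 1 / 10" using False by (intro G) auto
      finally show ?thesis by (simp add: \<epsilon>_def)
    qed
    then have "real g powr alpha_const g \<le> real g powr (1/5 - \<epsilon>)" using g by (intro powr_mono) auto
    moreover have "real g powr alpha_const g = C_const g"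
      using lng C1 g by (simp add: alpha_const_def powr_def)
    ultimately show "C_const g \<le> real g powr (1/5 - \<epsilon>)" by simp
  qed
qed

text \<open>With \<open>s\<close> the twentieth root of \<open>g\<close> this reduces to
  \<open>s ^ 4 + 3 \<le> s ^ 5\<close>, true for \<open>s \<ge> 1.6\<close>; 1.6 ^ 20 is about
  12089.\<close>

lemma C_const_fourth_power:
  assumes "g \<ge> 31699"
  shows "(C_const g + 3) ^ 4 \<le> real g"
proof -
  define s where "s = real g powr (1/20)"
  have g: "real g \<ge> 31699" using assms by simp
  have s0: "s > 0" using g by (simp add: s_def)
  have spow: "s ^ n = real g powr (real n / 20)" for n
    using g by (simp add: s_def powr_powr flip: powr_realpow)
  have s20: "s ^ 20 = real g" using g by (simp add: spow)
  have s4: "s ^ 4 = real g powr (1/5)" by (simp add: spow)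
  have s16: "s \<ge> 1.6"
  proof -
    have "(1.6::real) ^ 20 \<le> s ^ 20" unfolding s20 using g by (rule order.trans[rotated]) (simp add: power_divide)
    then show ?thesis using s0 by (subst (asm) power_mono_iff) auto
  qed
  have "(1.6::real) ^ 4 \<le> s ^ 4" using s16 by (intro power_mono) auto
  then have "1.6 ^ 4 * 0.6 \<le> s ^ 4 * (s - 1)" using s16 by (intro mult_mono) auto
  then have "s ^ 4 + 3 \<le> s ^ 5" by (simp add: power_divide algebra_simps power_numeral_reduce)
  then have "C_const g + 3 \<le> s ^ 5" using C_const_less_fifth_root[OF assms] s4 by linarith
  moreover have "C_const g > 1" using assms by (intro C_const_gt_1) auto
  ultimately have "(C_const g + 3) ^ 4 \<le> (s ^ 5) ^ 4" by (intro power_mono) auto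
  also have "\<dots> = real g" by (simp add: s20 flip: power_mult)
  finally show ?thesis .
qed

lemma cube_exp_bound:
  assumes "\<epsilon> > 0" "y \<ge> 0"
  shows "(1 + y) ^ 3 \<le> (1 + 6 / \<epsilon>) ^ 3 * exp (\<epsilon> / 2 * (y::real))"
proof -
  have "1 + y \<le> (1 + 6 / \<epsilon>) * (1 + \<epsilon> * y / 6)" using assms by (simp add: field_simps)
  also have "\<dots> \<le> (1 + 6 / \<epsilon>) * exp (\<epsilon> * y / 6)"
    using assms by (intro mult_left_mono exp_ge_add_one_self) auto
  finally have "(1 + y) ^ 3 \<le> ((1 + 6 / \<epsilon>) * exp (\<epsilon> * y / 6)) ^ 3" using assms by (intro power_mono) auto
  also have "\<dots> = (1 + 6 / \<epsilon>) ^ 3 * exp (\<epsilon> * y / 6) ^ 3" by (rule power_mult_distrib)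
  also have "exp (\<epsilon> * y / 6) ^ 3 = exp (\<epsilon> / 2 * y)" by (simp flip: exp_of_nat_mult)
  finally show ?thesis .
qed

text \<open>\<open>w\<close> is the logarithm of \<open>q\<close> to base \<open>g\<close>, rounded
  up, and \<open>w + 1 \<le> 4 * ln q\<close> because \<open>ln q \<ge> 2/3\<close>. With a tenth of
  the digits and the saving \<open>1 / (4 * g ^ 5)\<close> per window this gives 4 * 10 * 4 = 160;
  the factor 3 covers the rounding of the number of windows, as
  \<open>exp \<delta> \<le> 3\<close>.\<close>

lemma (in reversal) sv_exp_bound:
  assumes "q \<ge> 2" "g \<ge> 3"
  obtains w where "q \<le> g ^ w" "w \<ge> 1" "\<And>N'. sv w (N' div 10) \<le> 3 * exp (- (1 / (160 * real g ^ 5) * (real N' / ln (real q))))"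
proof -
  define \<delta> where "\<delta> = 1 / (4 * real g ^ 5)"
  have gr: "real g \<ge> 3" using assms by simp
  have g5: "real g ^ 5 \<ge> 1" using gr by (intro one_le_power) auto
  have "4 * real g ^ 5 \<ge> 1" using g5 by linarith
  then have \<delta>: "0 < \<delta>" "\<delta> \<le> 1" using gr by (auto simp: \<delta>_def)
  have lq: "ln (real q) \<ge> 2 / 3"
  proof -
    have "ln 2 \<le> ln (real q)" using assms by (subst ln_le_cancel_iff) auto
    then show ?thesis using ln2_ge_two_thirds by linarith
  qed
  have lg: "ln (real g) \<ge> 1"
  proof -
    have "exp 1 \<le> real g" using exp_le gr by linarith
    then show ?thesis using gr by (subst ln_ge_iff) auto
  qed
  define w where "w = nat \<lceil>ln (real q) / ln (real g)\<rceil>"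
  have pos: "ln (real q) / ln (real g) > 0" using lq lg by simp
  have w1: "w \<ge> 1" using pos by (simp add: w_def Suc_le_eq)
  have wle: "real w \<le> ln (real q) / ln (real g) + 1" using pos unfolding w_def by linarith
  have "ln (real q) / ln (real g) \<le> real w" by (simp add: w_def real_nat_ceiling_ge)
  then have "ln (real q) \<le> real w * ln (real g)" using lg by (simp add: pos_divide_le_eq)
  also have "\<dots> = ln (real g ^ w)" using gr by (simp add: ln_realpow)
  finally have "real q \<le> real g ^ w" using assms gr by (subst (asm) ln_le_cancel_iff) auto
  then have qw: "q \<le> g ^ w" by (metis of_nat_le_iff of_nat_power)
  have "ln (real q) / ln (real g) \<le> ln (real q)" using lq lg by (simp add: divide_le_eq)
  then have w4: "real (w + 1) \<le> 4 * ln (real q)" using wle lq by simp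
  have "sv w (N' div 10) \<le> 3 * exp (- (1 / (160 * real g ^ 5) * (real N' / ln (real q))))" for N'
  proof -
    define k where "k = N' div 10 div (w + 1)"
    have k: "k = N' div (10 * (w + 1))" unfolding k_def by (simp only: div_mult2_eq)
    have "real N' < (real k + 1) * (10 * real (w + 1))"
    proof -
      have "N' < 10 * (w + 1) + N' div (10 * (w + 1)) * (10 * (w + 1))"
        by (rule dividend_less_div_times) simp
      then have "real N' < real (10 * (w + 1) + k * (10 * (w + 1)))" unfolding k by (simp only: of_nat_less_iff)
      then show ?thesis by (simp add: algebra_simps)
    qed
    also have "\<dots> \<le> (real k + 1) * (10 * (4 * ln (real q)))" using w4 by (intro mult_left_mono) auto
    finally have "real N' / (40 * ln (real q)) \<le> real k + 1" using lq by (simp add: field_simps)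
    then have "\<delta> * (real N' / (40 * ln (real q)) - 1) \<le> \<delta> * real k" using \<delta> by (intro mult_left_mono) auto
    then have kk: "- (\<delta> * real k) \<le> \<delta> - \<delta> * (real N' / (40 * ln (real q)))" by (simp add: algebra_simps)
    have "sv w (N' div 10) = (1 - \<delta>) ^ k" by (simp add: sv_def \<delta>_def k_def)
    also have "\<dots> \<le> exp (- \<delta>) ^ k" using \<delta> exp_ge_add_one_self[of "- \<delta>"] by (intro power_mono) auto
    also have "\<dots> = exp (- (\<delta> * real k))" by (simp add: mult.commute flip: exp_of_nat_mult)
    also have "\<dots> \<le> exp (\<delta> - \<delta> * (real N' / (40 * ln (real q))))" using kk by simp
    also have "\<dots> = exp \<delta> * exp (- (\<delta> * (real N' / (40 * ln (real q)))))" by (simp add: exp_diff exp_minus field_simps)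
    also have "\<dots> \<le> 3 * exp (- (\<delta> * (real N' / (40 * ln (real q)))))"
    proof (rule mult_right_mono)
      have "exp \<delta> \<le> exp 1" using \<delta> by simp
      then show "exp \<delta> \<le> 3" using exp_le by linarith
    qed auto
    also have "\<delta> * (real N' / (40 * ln (real q))) = 1 / (160 * real g ^ 5) * (real N' / ln (real q))"
      by (simp add: \<delta>_def)
    finally show ?thesis .
  qed
  then show ?thesis using that qw w1 by blast
qed

text \<open>1080 is 540 * 2, and 9720 is 540 * 6 * 3 with the 3 of \<open>sv_exp_bound\<close>. The
  cube is the price for absorbing the logarithms in the first term; \<open>g ^ 4\<close> is
  \<open>g ^ 3\<close> from \<open>H ^ 3\<close> times the factor \<open>g\<close> of the major
  arcs.\<close>

definition K_const :: "real \<Rightarrow> nat \<Rightarrow> real" where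
  "K_const \<epsilon> g = 1080 * (1 + 6 / \<epsilon>) ^ 3 + 9720 * real g ^ 4"

text \<open>The hypothesis on \<open>q\<close> reads \<open>ln N \<le> c * Z\<close> with
  \<open>Z = N / ln q\<close>, so powers of \<open>N\<close> are at most exponentials in
  \<open>c * Z\<close>. As \<open>H ^ 3 * (N + 1)\<^sup>2\<close> is at most
  \<open>N ^ 10 * g ^ 3\<close>, ten \<open>c\<close> pay for \<open>N ^ 10\<close> and one is left
  over, whence 1760 = 11 * 160. The condition \<open>c \<le> \<epsilon> / 3\<close> lets the
  remaining half of the power saving dominate \<open>exp (- (c * Z))\<close>, as
  \<open>Z \<le> 3 / 2 * N\<close>.\<close>

lemma reversed_prime_sum_exp:
  assumes rv: "reversal g N q \<theta>" and g31: "g \<ge> 31699" and N: "N \<ge> 30" and q2: "q \<ge> 2"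
    and \<epsilon>: "\<epsilon> > 0" "C_const g \<le> real g powr (1/5 - \<epsilon>)"
    and c: "0 < c" "c \<le> \<epsilon> / 3" "c \<le> 1 / (1760 * real g ^ 5)"
    and qN: "ln (real q) \<le> c * (real N / ln (real N))"
  shows "norm (\<Sum>p | prime p \<and> p < g ^ N. ee (\<theta> * real (rev_digits g N p))) \<le>
    K_const \<epsilon> g * real g ^ N * exp (- (c * (real N / ln (real q))))"
proof -
  interpret reversal g N q \<theta> by (rule rv)
  have gr: "real g \<ge> 31699" using g31 by simp
  have Nr: "real N \<ge> 30" using N by simp
  obtain w where w: "q \<le> g ^ w" "w \<ge> 1"
      "\<And>N'. sv w (N' div 10) \<le> 3 * exp (- (1 / (160 * real g ^ 5) * (real N' / ln (real q))))"
    using sv_exp_bound[OF q2] g31 by auto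
  define c1 where "c1 = 1 / (160 * real g ^ 5)"
  define Z where "Z = real N / ln (real q)"
  define y where "y = real N * ln (real g)"
  define H where "H = 1 + ln (real g ^ N)"
  have Hy: "H = 1 + y" using gr by (simp add: H_def y_def ln_realpow)
  have lq: "ln (real q) \<ge> 2 / 3"
  proof -
    have "ln 2 \<le> ln (real q)" using q2 by (subst ln_le_cancel_iff) auto
    then show ?thesis using ln2_ge_two_thirds by linarith
  qed
  have Z0: "Z \<ge> 0" using lq by (simp add: Z_def)
  have lg: "ln (real g) \<ge> 1"
  proof -
    have "exp 1 \<le> real g" using exp_le gr by linarith
    then show ?thesis using gr by (subst ln_ge_iff) auto
  qed
  have y0: "y \<ge> 0" "y \<ge> real N" using lg mult_left_mono[OF lg, of "real N"] by (auto simp: y_def)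
  have lN: "ln (real N) > 0" using Nr by simp
  have Zc: "ln (real N) \<le> c * Z"
    using qN lN lq by (simp add: Z_def field_simps)
  have gN0: "real g ^ N > 0" using gr by simp
  have "norm (\<Sum>p | prime p \<and> p < g ^ N. ee (\<theta> * real (rev_digits g N p))) \<le>
     540 * H ^ 3 * (2 * (real g ^ N) powr (4/5) * C_const g ^ N + 6 * (real N + 1)\<^sup>2 * real g * real g ^ N * sv w (N div 10))"
    unfolding H_def by (rule reversed_prime_sum[OF N w(1,2) C_const_fourth_power[OF g31]])
  also have "\<dots> = 1080 * (H ^ 3 * ((real g ^ N) powr (4/5) * C_const g ^ N)) + 3240 * (H ^ 3 * ((real N + 1)\<^sup>2 * real g * real g ^ N * sv w (N div 10)))"
    by (simp add: algebra_simps)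
  also have "\<dots> \<le> 1080 * ((1 + 6 / \<epsilon>) ^ 3 * (real g ^ N * exp (- (c * Z)))) + 3240 * (3 * real g ^ 4 * (real g ^ N * exp (- (c * Z))))"
  proof (intro add_mono mult_left_mono)
    have "C_const g ^ N \<le> (real g powr (1/5 - \<epsilon>)) ^ N" using \<epsilon> C_const_nonneg by (intro power_mono) auto
    also have "\<dots> = real g powr ((1/5 - \<epsilon>) * real N)" using gr by (simp add: powr_powr flip: powr_realpow)
    finally have "(real g ^ N) powr (4/5) * C_const g ^ N \<le> (real g ^ N) powr (4/5) * real g powr ((1/5 - \<epsilon>) * real N)"
      by (intro mult_left_mono) auto
    also have "\<dots> = real g powr (real N * (4/5)) * real g powr ((1/5 - \<epsilon>) * real N)"
      using gr by (simp add: powr_powr flip: powr_realpow)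
    also have "\<dots> = real g powr (real N * (4/5) + (1/5 - \<epsilon>) * real N)" by (rule powr_add[symmetric])
    also have "real N * (4/5) + (1/5 - \<epsilon>) * real N = real N - \<epsilon> * real N" by (simp add: algebra_simps)
    also have "real g powr (real N - \<epsilon> * real N) = real g ^ N * exp (- (\<epsilon> * y))"
    proof -
      have "real g powr (\<epsilon> * real N) = exp (\<epsilon> * y)" using gr by (simp add: powr_def y_def mult_ac)
      moreover have "real g powr real N = real g ^ N" using gr by (simp add: powr_realpow)
      ultimately show ?thesis unfolding powr_diff by (simp add: exp_minus divide_inverse)
    qed
    finally have 1: "(real g ^ N) powr (4/5) * C_const g ^ N \<le> real g ^ N * exp (- (\<epsilon> * y))" .
    have "H ^ 3 * ((real g ^ N) powr (4/5) * C_const g ^ N) \<le> ((1 + 6 / \<epsilon>) ^ 3 * exp (\<epsilon> / 2 * y)) * (real g ^ N * exp (- (\<epsilon> * y)))"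
      unfolding Hy by (rule mult_mono[OF cube_exp_bound 1]) (use \<epsilon> y0 C_const_nonneg in auto)
    also have "\<dots> = (1 + 6 / \<epsilon>) ^ 3 * (real g ^ N * (exp (\<epsilon> / 2 * y) * exp (- (\<epsilon> * y))))" by (simp add: mult_ac)
    also have "exp (\<epsilon> / 2 * y) * exp (- (\<epsilon> * y)) = exp (- (\<epsilon> / 2 * y))" by (simp flip: exp_add)
    also have "(1 + 6 / \<epsilon>) ^ 3 * (real g ^ N * exp (- (\<epsilon> / 2 * y))) \<le> (1 + 6 / \<epsilon>) ^ 3 * (real g ^ N * exp (- (c * Z)))"
    proof (intro mult_left_mono)
      have "Z \<le> 3 / 2 * real N"
      proof -
        have "real N / ln (real q) \<le> real N / (2 / 3)" using lq by (intro divide_left_mono) auto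
        then show ?thesis by (simp add: Z_def)
      qed
      then have "c * Z \<le> \<epsilon> / 3 * (3 / 2 * real N)" using c Z0 by (intro mult_mono) auto
      also have "\<dots> = \<epsilon> / 2 * real N" by simp
      also have "\<dots> \<le> \<epsilon> / 2 * y" using y0 \<epsilon> by (intro mult_left_mono) auto
      finally show "exp (- (\<epsilon> / 2 * y)) \<le> exp (- (c * Z))" by simp
    qed (use \<epsilon> gN0 in auto)
    finally show "H ^ 3 * ((real g ^ N) powr (4/5) * C_const g ^ N) \<le> (1 + 6 / \<epsilon>) ^ 3 * (real g ^ N * exp (- (c * Z)))" .
  next
    have "H \<le> (real N + 1) * real g"
    proof -
      have "ln (real g) \<le> real g - 1" using gr by (intro ln_le_minus_one) auto
      then have "real N * ln (real g) \<le> real N * (real g - 1)" by (intro mult_left_mono) auto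
      then show ?thesis using gr Nr by (simp add: Hy y_def algebra_simps)
    qed
    then have "H ^ 3 \<le> ((real N + 1) * real g) ^ 3" using y0 by (intro power_mono) (auto simp: Hy)
    then have "H ^ 3 * (real N + 1)\<^sup>2 \<le> ((real N + 1) * real g) ^ 3 * (real N + 1)\<^sup>2" by (intro mult_right_mono) auto
    also have "\<dots> = (real N + 1) ^ 5 * real g ^ 3" by (simp add: power_mult_distrib mult_ac flip: power_add)
    also have "\<dots> \<le> (real N ^ 2) ^ 5 * real g ^ 3"
    proof (intro mult_right_mono power_mono)
      have "real N * 2 \<le> real N * real N" using Nr by (intro mult_left_mono) auto
      then show "real N + 1 \<le> real N ^ 2" unfolding power2_eq_square using Nr by linarith
    qed auto
    also have "(real N ^ 2) ^ 5 = exp (10 * ln (real N))"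
    proof -
      have "exp (10 * ln (real N)) = exp (ln (real N)) ^ 10" using exp_of_nat_mult[of 10 "ln (real N)"] by simp
      then show ?thesis using Nr by (simp flip: power_mult)
    qed
    also have "exp (10 * ln (real N)) * real g ^ 3 \<le> exp (10 * (c * Z)) * real g ^ 3"
      using Zc by (intro mult_right_mono) auto
    finally have 1: "H ^ 3 * (real N + 1)\<^sup>2 \<le> exp (10 * (c * Z)) * real g ^ 3" .
    have 2: "sv w (N div 10) \<le> 3 * exp (- (c1 * Z))" using w(3)[of N] by (simp add: c1_def Z_def)
    have "H ^ 3 * ((real N + 1)\<^sup>2 * real g * real g ^ N * sv w (N div 10)) =
        (H ^ 3 * (real N + 1)\<^sup>2) * (sv w (N div 10) * (real g * real g ^ N))" by (simp add: mult_ac)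
    also have "\<dots> \<le> (exp (10 * (c * Z)) * real g ^ 3) * (3 * exp (- (c1 * Z)) * (real g * real g ^ N))"
      by (rule mult_mono[OF 1 mult_right_mono[OF 2]]) (use sv_nonneg in auto)
    also have "\<dots> = 3 * real g ^ 4 * (real g ^ N * (exp (10 * (c * Z)) * exp (- (c1 * Z))))"
      by (simp add: power_numeral_reduce mult_ac)
    also have "\<dots> \<le> 3 * real g ^ 4 * (real g ^ N * exp (- (c * Z)))"
    proof (intro mult_left_mono)
      have "11 * c \<le> c1" using c(3) by (simp add: c1_def)
      then have "11 * c * Z \<le> c1 * Z" using Z0 by (intro mult_right_mono)
      then show "exp (10 * (c * Z)) * exp (- (c1 * Z)) \<le> exp (- (c * Z))" by (simp add: mult_ac flip: exp_add)
    qed (use gr in auto)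
    finally show "H ^ 3 * ((real N + 1)\<^sup>2 * real g * real g ^ N * sv w (N div 10)) \<le> 3 * real g ^ 4 * (real g ^ N * exp (- (c * Z)))" .
  qed auto
  also have "\<dots> = K_const \<epsilon> g * real g ^ N * exp (- (c * Z))" by (simp add: K_const_def algebra_simps)
  finally show ?thesis by (simp add: Z_def)
qed

section \<open>Reversed primes in residue classes\<close>

text \<open>The additional leading zero becomes a trailing zero after reversal.\<close>

lemma rev_digits_extend:
  assumes "p < g ^ N"
  shows "rev_digits g (Suc N) p = g * rev_digits g N p"
proof -
  have "rev_digits g (Suc N) p = (\<Sum>i<N. digit g p i * g ^ (N - i)) + digit g p N"
    by (simp add: rev_digits_def)
  also have "digit g p N = 0" using assms by (simp add: digit_def)
  also have "(\<Sum>i<N. digit g p i * g ^ (N - i)) = (\<Sum>i<N. g * (digit g p i * g ^ (N - 1 - i)))"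
  proof (rule sum.cong[OF refl])
    fix i assume "i \<in> {..<N}"
    then have "N - i = Suc (N - 1 - i)" by auto
    then show "digit g p i * g ^ (N - i) = g * (digit g p i * g ^ (N - 1 - i))" by (simp only: power_Suc mult_ac)
  qed
  finally show ?thesis by (simp add: rev_digits_def sum_distrib_left)
qed

lemma floorlog_unique:
  assumes "g \<ge> 2" "N \<ge> 1" "g ^ (N - 1) \<le> p" "p < g ^ N"
  shows "floorlog g p = N"
proof -
  have p: "p > 0" using assms by (metis gr0I le_zero_eq not_numeral_le_zero power_eq_0_iff)
  have b: "g ^ (floorlog g p - 1) \<le> p" "p < g ^ floorlog g p" using floorlog_bounds[OF p, of g] assms by auto
  have "g ^ (N - 1) < g ^ floorlog g p" "g ^ (floorlog g p - 1) < g ^ N" using b assms by linarith+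
  then have "N - 1 < floorlog g p" "floorlog g p - 1 < N" using assms by (auto dest: power_less_imp_less_exp[rotated])
  then show ?thesis using assms by linarith
qed

lemma digit_reverse_eq_rev_digits:
  assumes "g \<ge> 2" "N \<ge> 1" "p \<in> G_set g N"
  shows "digit_reverse g p = rev_digits g N p"
proof -
  have "floorlog g p = N" using assms by (intro floorlog_unique) (auto simp: G_set_def)
  moreover have "N - i - 1 = N - 1 - i" for i by simp
  ultimately show ?thesis by (simp only: digit_reverse_def rev_digits_def)
qed

text \<open>The only prime that \<open>g\<close> can divide is \<open>g\<close> itself, which has
  two digits; \<open>N \<ge> 3\<close> keeps it out.\<close>

lemma G_set_primes:
  assumes "g \<ge> 2" "N \<ge> 3"
  shows "{p \<in> G_set g N. prime p} = {p. prime p \<and> p < g ^ N} - {p. prime p \<and> p < g ^ (N - 1)}"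
proof -
  have "\<not> [p = 0] (mod g)" if "prime p" "g ^ (N - 1) \<le> p" for p
  proof
    assume "[p = 0] (mod g)"
    then have "g dvd p" by (simp add: cong_0_iff)
    then have "g = p" using that(1) assms by (auto simp: prime_nat_iff)
    moreover have "g ^ 1 < g ^ (N - 1)" using assms by (intro power_strict_increasing) auto
    ultimately show False using that(2) by simp
  qed
  then show ?thesis by (auto simp: G_set_def not_less)
qed

text \<open>Primes with exactly \<open>N\<close> digits are those below \<open>g ^ N\<close> minus
  those below \<open>g ^ (N - 1)\<close>. On the latter the window reversal is \<open>g\<close>
  times the one of length \<open>N - 1\<close>, so \<open>\<theta>\<close> turns into
  \<open>g * \<theta>\<close>, which satisfies the hypotheses of \<open>reversal\<close> at
  \<open>N - 1\<close>. As \<open>N \<le> 2 * (N - 1)\<close>, the constant \<open>2 * c\<close>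
  serves both lengths.\<close>

lemma reversed_prime_twisted_sum:
  assumes rv: "reversal g N q \<theta>" and g: "g \<ge> 31699" and N: "N \<ge> 31" and q: "q \<ge> 2"
    and \<epsilon>: "\<epsilon> > 0" "C_const g \<le> real g powr (1/5 - \<epsilon>)"
    and c: "0 < c" "2 * c \<le> \<epsilon> / 3" "2 * c \<le> 1 / (1760 * real g ^ 5)"
    and qN: "ln (real q) \<le> c * (real N / ln (real N))"
  shows "norm (\<Sum>p | p \<in> G_set g N \<and> prime p. ee (\<theta> * real (digit_reverse g p))) \<le>
    2 * K_const \<epsilon> g * real g ^ N * exp (- (c * (real N / ln (real q))))"
proof -
  define Z where "Z = real N / ln (real q)"
  have K0: "K_const \<epsilon> g \<ge> 0" using \<epsilon> by (simp add: K_const_def)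
  have lq: "ln (real q) > 0" using q by simp
  have lN: "ln (real N) > 0" "ln (real (N - 1)) > 0" using N by auto
  have rv1: "reversal g (N - 1) q (real g * \<theta>)"
  proof -
    interpret reversal g N q \<theta> by (rule rv)
    have "real q * (real g * \<theta>) = of_nat g * (real q * \<theta>)" by simp
    then have 1: "real q * (real g * \<theta>) \<in> \<int>" using rational by (metis Ints_mult Ints_of_nat)
    have "real g ^ N = real g ^ (N - 1) * real g" using N by (cases N) auto
    then have 2: "real (g\<^sup>2 - 1) * real g ^ (N - 1) * (real g * \<theta>) \<notin> \<int>" using nonintegral by (simp only: mult_ac not_False_eq_True)
    show ?thesis using 1 2 reversal.g[OF rv] reversal.q[OF rv] by unfold_locales
  qed
  have "ln (real q) \<le> 2 * c * (real N / ln (real N))"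
  proof -
    have "c * (real N / ln (real N)) \<ge> 0" using c lN by simp
    then show ?thesis using qN by (simp only: mult.assoc)
  qed
  then have "norm (\<Sum>p | prime p \<and> p < g ^ N. ee (\<theta> * real (rev_digits g N p))) \<le>
      K_const \<epsilon> g * real g ^ N * exp (- (2 * c * (real N / ln (real q))))"
    using rv g N q \<epsilon> c by (intro reversed_prime_sum_exp) auto
  also have "\<dots> \<le> K_const \<epsilon> g * real g ^ N * exp (- (c * Z))"
  proof (intro mult_left_mono)
    have "c * Z \<ge> 0" using c lq by (simp add: Z_def)
    then show "exp (- (2 * c * (real N / ln (real q)))) \<le> exp (- (c * Z))" unfolding Z_def[symmetric] by (simp add: mult_ac)
  qed (use K0 in auto)
  finally have 1: "norm (\<Sum>p | prime p \<and> p < g ^ N. ee (\<theta> * real (rev_digits g N p))) \<le> K_const \<epsilon> g * real g ^ N * exp (- (c * Z))" .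
  have half: "real N \<le> 2 * real (N - 1)" using N by (simp add: of_nat_diff)
  have "ln (real q) \<le> 2 * c * (real (N - 1) / ln (real (N - 1)))"
  proof -
    have "real N / ln (real N) \<le> (2 * real (N - 1)) / ln (real (N - 1))"
      using half lN N by (intro frac_le) (auto simp: ln_le_cancel_iff)
    then have "c * (real N / ln (real N)) \<le> c * ((2 * real (N - 1)) / ln (real (N - 1)))" using c by (intro mult_left_mono) auto
    also have "\<dots> = 2 * c * (real (N - 1) / ln (real (N - 1)))" by (simp only: times_divide_eq_right mult_ac)
    finally show ?thesis by (rule order.trans[OF qN])
  qed
  then have "norm (\<Sum>p | prime p \<and> p < g ^ (N - 1). ee ((real g * \<theta>) * real (rev_digits g (N - 1) p))) \<le>
      K_const \<epsilon> g * real g ^ (N - 1) * exp (- (2 * c * (real (N - 1) / ln (real q))))"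
    using rv1 g N q \<epsilon> c by (intro reversed_prime_sum_exp) auto
  also have "\<dots> \<le> K_const \<epsilon> g * real g ^ N * exp (- (c * Z))"
  proof (intro mult_mono)
    show "real g ^ (N - 1) \<le> real g ^ N" using g by (intro power_increasing) auto
    have "c * Z \<le> c * ((2 * real (N - 1)) / ln (real q))"
      unfolding Z_def using half lq c by (intro mult_left_mono divide_right_mono) auto
    also have "\<dots> = 2 * c * (real (N - 1) / ln (real q))" by (simp only: times_divide_eq_right mult_ac)
    finally show "exp (- (2 * c * (real (N - 1) / ln (real q)))) \<le> exp (- (c * Z))"
      by (simp only: exp_le_cancel_iff neg_le_iff_le)
  qed (use K0 in auto)
  finally have 2: "norm (\<Sum>p | prime p \<and> p < g ^ (N - 1). ee ((real g * \<theta>) * real (rev_digits g (N - 1) p))) \<le> K_const \<epsilon> g * real g ^ N * exp (- (c * Z))" .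
  have fin: "finite {p. prime p \<and> p < n}" for n :: nat by simp
  have pow: "g ^ (N - 1) \<le> g ^ N" using g by (intro power_increasing) auto
  have "(\<Sum>p | p \<in> G_set g N \<and> prime p. ee (\<theta> * real (digit_reverse g p))) = (\<Sum>p | p \<in> G_set g N \<and> prime p. ee (\<theta> * real (rev_digits g N p)))"
    using g N digit_reverse_eq_rev_digits[of g N] by (intro sum.cong) auto
  also have "\<dots> = (\<Sum>p\<in>{p. prime p \<and> p < g ^ N} - {p. prime p \<and> p < g ^ (N - 1)}. ee (\<theta> * real (rev_digits g N p)))"
    using G_set_primes[of g N] g N by simp
  also have "\<dots> = (\<Sum>p | prime p \<and> p < g ^ N. ee (\<theta> * real (rev_digits g N p))) - (\<Sum>p | prime p \<and> p < g ^ (N - 1). ee (\<theta> * real (rev_digits g N p)))"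
    using pow by (intro sum_diff fin) auto
  also have "(\<Sum>p | prime p \<and> p < g ^ (N - 1). ee (\<theta> * real (rev_digits g N p))) =
      (\<Sum>p | prime p \<and> p < g ^ (N - 1). ee ((real g * \<theta>) * real (rev_digits g (N - 1) p)))"
  proof (rule sum.cong[OF refl])
    fix p assume "p \<in> {p. prime p \<and> p < g ^ (N - 1)}"
    then have "rev_digits g N p = g * rev_digits g (N - 1) p" using rev_digits_extend[of p g "N - 1"] N by simp
    then show "ee (\<theta> * real (rev_digits g N p)) = ee ((real g * \<theta>) * real (rev_digits g (N - 1) p))" by (simp add: mult_ac)
  qed
  finally have eq: "(\<Sum>p | p \<in> G_set g N \<and> prime p. ee (\<theta> * real (digit_reverse g p))) =
      (\<Sum>p | prime p \<and> p < g ^ N. ee (\<theta> * real (rev_digits g N p))) -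
      (\<Sum>p | prime p \<and> p < g ^ (N - 1). ee ((real g * \<theta>) * real (rev_digits g (N - 1) p)))" .
  have "norm (\<Sum>p | p \<in> G_set g N \<and> prime p. ee (\<theta> * real (digit_reverse g p))) \<le>
      K_const \<epsilon> g * real g ^ N * exp (- (c * Z)) + K_const \<epsilon> g * real g ^ N * exp (- (c * Z))"
    unfolding eq by (rule order.trans[OF norm_triangle_ineq4 add_mono[OF 1 2]])
  then show ?thesis by (simp add: Z_def)
qed

section \<open>Additive characters modulo \<open>q\<close>\<close>

lemma finite_G_set: "finite (G_set g N)"
  by (rule finite_subset[of _ "{..<g ^ N}"]) (auto simp: G_set_def)

lemma residue_detection:
  fixes f :: "nat \<Rightarrow> nat" and a :: int
  assumes "finite A" "q > 0"
  shows "(\<Sum>h<q. \<Sum>p\<in>A. ee (of_int (int (f p) - a) * real h / real q)) = of_nat q * of_nat (card {p \<in> A. [int (f p) = a] (mod int q)})"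
proof -
  have "(\<Sum>h<q. \<Sum>p\<in>A. ee (of_int (int (f p) - a) * real h / real q)) = (\<Sum>p\<in>A. \<Sum>h<q. ee (of_int (int (f p) - a) * real h / real q))"
    by (rule sum.swap)
  also have "\<dots> = (\<Sum>p\<in>A. if [int (f p) = a] (mod int q) then of_nat q else 0)"
    using assms by (intro sum.cong refl) (simp only: sum_ee_full cong_iff_dvd_diff)
  also have "\<dots> = (\<Sum>p | p \<in> A \<and> [int (f p) = a] (mod int q). of_nat q)"
    by (rule sum.inter_filter[OF assms(1), symmetric])
  finally show ?thesis by simp
qed

text \<open>The condition \<open>q dvd M * h\<close> selects the multiples of
  \<open>q div d\<close>; their characters are exactly those modulo \<open>d\<close>, so the same
  detection applies with \<open>d\<close> in place of \<open>q\<close>.\<close>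

lemma main_frequencies:
  fixes f :: "nat \<Rightarrow> nat" and a :: int
  assumes "finite A" "q > 0" "M > 0"
  defines "d \<equiv> gcd q M"
  shows "(\<Sum>h | h < q \<and> q dvd M * h. \<Sum>p\<in>A. ee (of_int (int (f p) - a) * real h / real q)) = of_nat d * of_nat (card {p \<in> A. [int (f p) = a] (mod int d)})"
proof -
  define e where "e = q div d"
  have d: "d > 0" using assms by (simp add: d_def)
  have q: "q = d * e" by (simp add: e_def d_def)
  have e: "e > 0" using q assms(2) by (cases e) auto
  have dv: "q dvd M * h \<longleftrightarrow> e dvd h" for h
  proof -
    have "d dvd M" unfolding d_def by simp
    then obtain M' where M': "M = d * M'" by (elim dvdE)
    have "gcd (d * e) (d * M') = d"
      by (simp only: q[symmetric] M'[symmetric]) (simp only: d_def)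
    then have "d * gcd e M' = d * 1" by (simp only: gcd_mult_distrib_nat mult_1_right)
    then have "coprime e M'" using d by (simp add: coprime_iff_gcd_eq_1)
    moreover have "q dvd M * h \<longleftrightarrow> e dvd M' * h" unfolding q M' using d by (simp add: mult.assoc)
    ultimately show ?thesis by (simp add: coprime_dvd_mult_right_iff)
  qed
  have "(\<Sum>h | h < q \<and> q dvd M * h. \<Sum>p\<in>A. ee (of_int (int (f p) - a) * real h / real q)) =
      (\<Sum>h<d. \<Sum>p\<in>A. ee (of_int (int (f p) - a) * real (e * h) / real q))"
  proof -
    have "{h. h < q \<and> q dvd M * h} = (\<lambda>h. e * h) ` {..<d}"
    proof (intro set_eqI iffI)
      fix h assume "h \<in> {h. h < q \<and> q dvd M * h}"
      then have h: "h < q" "e dvd h" by (simp_all only: mem_Collect_eq dv)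
      then obtain k where k: "h = e * k" by (elim dvdE)
      have "e * k < e * d" using h(1) unfolding k by (subst (asm) q) (simp only: mult.commute)
      then have "k < d" by simp
      then show "h \<in> (\<lambda>h. e * h) ` {..<d}" using k by blast
    next
      fix h assume "h \<in> (\<lambda>h. e * h) ` {..<d}"
      then obtain k where k: "h = e * k" "k < d" by auto
      have "e * k < e * d" using k(2) e by simp
      then have "h < q" unfolding k by (subst q) (simp only: mult.commute)
      then show "h \<in> {h. h < q \<and> q dvd M * h}" using k by (simp only: mem_Collect_eq dv dvd_triv_left simp_thms)
    qed
    moreover have "inj_on (\<lambda>h. e * h) {..<d}" using e by (simp add: inj_on_def)
    ultimately show ?thesis by (simp only: sum.reindex o_def)
  qed
  also have "\<dots> = (\<Sum>h<d. \<Sum>p\<in>A. ee (of_int (int (f p) - a) * real h / real d))"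
  proof (intro sum.cong refl arg_cong[where f = ee])
    fix h p
    show "of_int (int (f p) - a) * real (e * h) / real q = of_int (int (f p) - a) * real h / real d"
      unfolding q using e d by (simp add: field_simps)
  qed
  also have "\<dots> = of_nat d * of_nat (card {p \<in> A. [int (f p) = a] (mod int d)})"
    using assms(1) d by (rule residue_detection)
  finally show ?thesis .
qed

text \<open>The frequencies with integral \<open>(g\<^sup>2 - 1) * g ^ N * h / q\<close> form the
  main term. Each of the others satisfies \<open>reversal\<close>, and the mean over
  \<open>q\<close> frequencies keeps the bound of a single one.\<close>

lemma reversed_primes_in_residue_class:
  fixes a :: int
  assumes g: "g \<ge> 31699" and N: "N \<ge> 31" and q: "q \<ge> 2"
    and \<epsilon>: "\<epsilon> > 0" "C_const g \<le> real g powr (1/5 - \<epsilon>)"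
    and c: "0 < c" "2 * c \<le> \<epsilon> / 3" "2 * c \<le> 1 / (1760 * real g ^ 5)"
    and qN: "ln (real q) \<le> c * (real N / ln (real N))"
  defines "d \<equiv> gcd q ((g\<^sup>2 - 1) * g ^ N)"
  shows "\<bar>real (card {p \<in> {p. p \<in> G_set g N \<and> prime p}. [int (digit_reverse g p) = a] (mod int q)}) -
     real d / real q * real (card {p \<in> {p. p \<in> G_set g N \<and> prime p}. [int (digit_reverse g p) = a] (mod int d)})\<bar>
     \<le> 2 * K_const \<epsilon> g * real g ^ N * exp (- (c * (real N / ln (real q))))" (is "\<bar>real ?n1 - real d / real q * real ?n2\<bar> \<le> ?R")
proof -
  define A where "A = {p. p \<in> G_set g N \<and> prime p}"
  define M where "M = (g\<^sup>2 - 1) * g ^ N"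
  have fin: "finite A" unfolding A_def using finite_G_set by simp
  have qr: "real q > 0" using q by simp
  have g1: "1 < g\<^sup>2" using g by (intro one_less_power) auto
  then have M0: "M > 0" using g by (simp add: M_def)
  define W where "W = (\<lambda>h. \<Sum>p\<in>A. ee (of_int (int (digit_reverse g p) - a) * real h / real q))"
  have all: "(\<Sum>h<q. W h) = of_nat q * of_nat ?n1"
    unfolding W_def A_def[symmetric] using fin q by (intro residue_detection) auto
  have main: "(\<Sum>h | h < q \<and> q dvd M * h. W h) = of_nat d * of_nat ?n2"
    unfolding W_def A_def[symmetric] d_def M_def[symmetric] using fin q M0 by (intro main_frequencies) auto
  have "(\<Sum>h<q. W h) = (\<Sum>h | h < q \<and> q dvd M * h. W h) + (\<Sum>h | h < q \<and> \<not> q dvd M * h. W h)"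
  proof -
    have "{..<q} = {h. h < q \<and> q dvd M * h} \<union> {h. h < q \<and> \<not> q dvd M * h}" by auto
    then show ?thesis by (simp only:) (rule sum.union_disjoint; auto)
  qed
  then have e1: "of_nat q * of_nat ?n1 - of_nat d * of_nat ?n2 = (\<Sum>h | h < q \<and> \<not> q dvd M * h. W h)"
    unfolding all main by simp
  have e2: "of_nat q * of_nat ?n1 - of_nat d * of_nat ?n2 = complex_of_real (real q * real ?n1 - real d * real ?n2)" by simp
  have "\<bar>real q * real ?n1 - real d * real ?n2\<bar> = norm (complex_of_real (real q * real ?n1 - real d * real ?n2))"
    by (simp only: norm_of_real)
  also have "\<dots> = norm (\<Sum>h | h < q \<and> \<not> q dvd M * h. W h)"
    by (rule arg_cong[OF trans[OF e2[symmetric] e1]])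
  also have "\<dots> \<le> (\<Sum>h | h < q \<and> \<not> q dvd M * h. ?R)"
  proof (rule order.trans[OF norm_sum], rule sum_mono)
    fix h assume h: "h \<in> {h. h < q \<and> \<not> q dvd M * h}"
    define \<theta> where "\<theta> = real h / real q"
    have "reversal g N q \<theta>"
    proof
      show "real q * \<theta> \<in> \<int>" using qr by (simp add: \<theta>_def)
      show "real (g\<^sup>2 - 1) * real g ^ N * \<theta> \<notin> \<int>"
      proof
        assume "real (g\<^sup>2 - 1) * real g ^ N * \<theta> \<in> \<int>"
        then obtain k where "real (g\<^sup>2 - 1) * real g ^ N * \<theta> = of_int k" by (auto elim: Ints_cases)
        then have "real M * real h = real q * of_int k" using qr by (simp add: \<theta>_def M_def field_simps)
        then have "real_of_int (int (M * h)) = real_of_int (int q * k)" by simp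
        then have "int (M * h) = int q * k" by (simp only: of_int_eq_iff)
        then have "int q dvd int (M * h)" by simp
        then show False using h by (simp only: int_dvd_int_iff mem_Collect_eq) simp
      qed
    qed (use g q in auto)
    then have R: "norm (\<Sum>p\<in>A. ee (\<theta> * real (digit_reverse g p))) \<le> ?R"
      unfolding A_def using g N q \<epsilon> c qN by (intro reversed_prime_twisted_sum) auto
    have "W h = (\<Sum>p\<in>A. ee (\<theta> * real (digit_reverse g p)) * ee (- (of_int a * \<theta>)))"
      unfolding W_def by (intro sum.cong refl) (simp add: \<theta>_def algebra_simps diff_divide_distrib flip: ee_add)
    also have "\<dots> = (\<Sum>p\<in>A. ee (\<theta> * real (digit_reverse g p))) * ee (- (of_int a * \<theta>))"
      by (simp only: sum_distrib_right)
    finally show "norm (W h) \<le> ?R" using R by (simp add: norm_mult)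
  qed
  also have "\<dots> = real (card {h. h < q \<and> \<not> q dvd M * h}) * ?R" by simp
  also have "\<dots> \<le> real q * ?R"
  proof (rule mult_right_mono)
    have "card {h. h < q \<and> \<not> q dvd M * h} \<le> card {..<q}" by (intro card_mono) auto
    then show "real (card {h. h < q \<and> \<not> q dvd M * h}) \<le> real q" by simp
    show "0 \<le> ?R" using \<epsilon> by (simp add: K_const_def)
  qed
  finally have "\<bar>real q * real ?n1 - real d * real ?n2\<bar> / real q \<le> ?R" using qr by (simp add: field_simps)
  moreover have "\<bar>real q * real ?n1 - real d * real ?n2\<bar> / real q = \<bar>(real q * real ?n1 - real d * real ?n2) / real q\<bar>" using qr by simp
  moreover have "(real q * real ?n1 - real d * real ?n2) / real q = real ?n1 - real d / real q * real ?n2" using qr by (simp add: field_simps)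
  ultimately show ?thesis by (simp only:)
qed

theorem theorem1p1:
  shows "(\<forall>g\<ge>2. alpha_const g < 1 / 5 \<longleftrightarrow> g \<ge> 31699) \<and>
    (\<exists>c C :: nat \<Rightarrow> real. effectively_computable c \<and> effectively_computable C \<and>
      (\<forall>g\<ge>2. alpha_const g < 1 / 5 \<longrightarrow>
        0 < c g \<and> c g < 1 \<and> 0 < C g \<and>
        (\<forall>(a::int) (q::nat) (N::nat).
          q \<ge> 2 \<and> N \<ge> 2 \<and> real q \<le> exp (c g * (real N / ln (real N))) \<longrightarrow>
          \<bar>real (reverse_prime_count g N a q) -
             real (gcd q ((g\<^sup>2 - 1) * g ^ N)) / real q *
               (\<Sum>p | p \<in> G_set g N \<and> prime p \<and>
                   [int (digit_reverse g p) = a] (mod int (gcd q ((g\<^sup>2 - 1) * g ^ N))). 1)\<bar>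
            \<le> C g * real g ^ N * exp (- c g * (real N / ln (real q))))))"
proof -
  obtain \<epsilon> where \<epsilon>: "\<epsilon> > 0" "\<And>g. g \<ge> 31699 \<Longrightarrow> C_const g \<le> real g powr (1/5 - \<epsilon>)"
    using uniform_alpha by metis
  \<comment> \<open>One power of two dominates every constant: \<open>6 / \<epsilon>\<close> and
    3520 = 2 * 1760 for the conditions on \<open>c\<close>, and twice the coefficients of
    \<open>K_const\<close> for \<open>C\<close>.\<close>
  obtain m where m: "6 / \<epsilon> + 3520 + 2160 * (1 + 6 / \<epsilon>) ^ 3 + 19440 < (2::real) ^ m"
    using real_arch_pow[of 2] by auto
  \<comment> \<open>Since \<open>g ^ 5 \<le> 2 ^ (5 * g)\<close>, the dependence on \<open>g\<close>
    can be put into an exponent that is linear in \<open>g\<close>.\<close>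
  define c :: "nat \<Rightarrow> real" where "c = (\<lambda>n. 1 / 2 ^ (m + 5 * n))"
  define C :: "nat \<Rightarrow> real" where "C = (\<lambda>n. 2 ^ (m + 5 * n))"
  have \<epsilon>6: "6 / \<epsilon> > 0" "2160 * (1 + 6 / \<epsilon>) ^ 3 > 0" using \<epsilon>(1) by (auto intro!: mult_pos_pos add_pos_pos)
  have m6: "6 / \<epsilon> \<le> 2 ^ m" "3520 \<le> (2::real) ^ m" "2160 * (1 + 6 / \<epsilon>) ^ 3 + 19440 \<le> 2 ^ m"
  proof -
    have "u \<le> 2 ^ m \<and> 3520 \<le> (2::real) ^ m \<and> v + 19440 \<le> 2 ^ m"
      if "u + 3520 + v + 19440 < 2 ^ m" "u > 0" "v > 0" for u v :: real using that by linarith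
    from this[OF m \<epsilon>6] show "6 / \<epsilon> \<le> 2 ^ m" "3520 \<le> (2::real) ^ m" "2160 * (1 + 6 / \<epsilon>) ^ 3 + 19440 \<le> 2 ^ m" by auto
  qed
  have pow5: "real g ^ 5 \<le> 2 ^ (5 * g)" for g
  proof -
    have "real g ^ 5 \<le> (2 ^ g) ^ 5" by (intro power_mono of_nat_less_two_power[THEN less_imp_le]) auto
    then show ?thesis by (simp add: mult.commute flip: power_mult)
  qed
  have bound: "\<bar>real (reverse_prime_count g N a q) -
             real (gcd q ((g\<^sup>2 - 1) * g ^ N)) / real q *
               (\<Sum>p | p \<in> G_set g N \<and> prime p \<and>
                   [int (digit_reverse g p) = a] (mod int (gcd q ((g\<^sup>2 - 1) * g ^ N))). 1)\<bar>
            \<le> C g * real g ^ N * exp (- c g * (real N / ln (real q)))"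
    if g: "g \<ge> 31699" and q: "q \<ge> 2" and N: "N \<ge> 2" and qN: "real q \<le> exp (c g * (real N / ln (real N)))"
    for g a q N
  proof -
    define d where "d = gcd q ((g\<^sup>2 - 1) * g ^ N)"
    define A where "A = {p. p \<in> G_set g N \<and> prime p}"
    define n1 where "n1 = card {p \<in> A. [int (digit_reverse g p) = a] (mod int q)}"
    define n2 where "n2 = card {p \<in> A. [int (digit_reverse g p) = a] (mod int d)}"
    have n1: "reverse_prime_count g N a q = n1"
      unfolding reverse_prime_count_def n1_def A_def by (intro arg_cong[where f = card]) auto
    have "{p. p \<in> G_set g N \<and> prime p \<and> [int (digit_reverse g p) = a] (mod int d)} = {p \<in> A. [int (digit_reverse g p) = a] (mod int d)}"
      by (auto simp: A_def)
    then have n2: "(\<Sum>p | p \<in> G_set g N \<and> prime p \<and> [int (digit_reverse g p) = a] (mod int d). 1) = real n2"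
      by (simp add: n2_def)
    have g5: "real g ^ 5 \<ge> 1" using g by (intro one_le_power) auto
    have two5: "(2::real) ^ (5 * g) \<ge> 1" by simp
    have lq: "ln (real q) \<ge> 2 / 3"
    proof -
      have "ln 2 \<le> ln (real q)" using q by (subst ln_le_cancel_iff) auto
      then show ?thesis using ln2_ge_two_thirds by linarith
    qed
    have cpos: "c g > 0" by (simp add: c_def)
    have c_le: "c g \<le> 1 / (t * real g ^ 5)" if "0 < t" "t \<le> 2 ^ m" for t
    proof -
      have "t * real g ^ 5 \<le> 2 ^ m * 2 ^ (5 * g)" using that pow5[of g] by (intro mult_mono) auto
      then show ?thesis unfolding c_def power_add using that g by (intro divide_left_mono) (auto intro!: mult_pos_pos)
    qed
    have c3: "2 * c g \<le> 1 / (1760 * real g ^ 5)"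
      using c_le[OF _ m6(2)] by simp
    have c2: "2 * c g \<le> \<epsilon> / 3"
    proof -
      have "c g \<le> 1 / (6 / \<epsilon> * real g ^ 5)" by (rule c_le[OF \<epsilon>6(1) m6(1)])
      also have "\<dots> \<le> 1 / (6 / \<epsilon> * 1)" using g5 \<epsilon>6(1) by (intro divide_left_mono mult_left_mono mult_pos_pos) linarith+
      finally show ?thesis by simp
    qed
    show ?thesis
    proof (cases "N \<ge> 31")
      case True
      have "ln (real q) \<le> ln (exp (c g * (real N / ln (real N))))" using qN q by (subst ln_le_cancel_iff) auto
      then have lqN: "ln (real q) \<le> c g * (real N / ln (real N))" by simp
      have "\<bar>real n1 - real d / real q * real n2\<bar> \<le> 2 * K_const \<epsilon> g * real g ^ N * exp (- (c g * (real N / ln (real q))))"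
        unfolding n1_def n2_def A_def d_def
        by (rule reversed_primes_in_residue_class[OF g True q \<epsilon>(1) \<epsilon>(2)[OF g] cpos c2 c3 lqN])
      also have "\<dots> \<le> C g * real g ^ N * exp (- (c g * (real N / ln (real q))))"
      proof (intro mult_right_mono)
        have "real g ^ 4 \<le> real g ^ 5" using g by (intro power_increasing) auto
        then have g4: "real g ^ 4 \<le> 2 ^ (5 * g)" using pow5[of g] by linarith
        have "2 * K_const \<epsilon> g = 2160 * (1 + 6 / \<epsilon>) ^ 3 * 1 + 19440 * real g ^ 4" by (simp add: K_const_def)
        also have "\<dots> \<le> 2160 * (1 + 6 / \<epsilon>) ^ 3 * 2 ^ (5 * g) + 19440 * 2 ^ (5 * g)"
          using g4 two5 \<epsilon>6 by (intro add_mono mult_left_mono) auto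
        also have "\<dots> = (2160 * (1 + 6 / \<epsilon>) ^ 3 + 19440) * 2 ^ (5 * g)" by (simp add: algebra_simps)
        also have "\<dots> \<le> 2 ^ m * 2 ^ (5 * g)" using m6(3) by (intro mult_right_mono) auto
        finally show "2 * K_const \<epsilon> g \<le> C g" by (simp add: C_def power_add)
      qed auto
      finally show ?thesis unfolding d_def[symmetric] n1 n2 by simp
    next
      case False
      \<comment> \<open>For \<open>N \<le> 30\<close> the left side is at most \<open>g ^ N\<close>,
        and the exponential is at least 1/3 because \<open>N / ln q \<le> 45\<close> and
        \<open>c g \<le> 1 / 45\<close>; \<open>C g \<ge> 3\<close> makes up for it.\<close>
      have fin: "finite A" unfolding A_def using finite_G_set by simp
      have cardA: "card A \<le> g ^ N"
      proof -
        have "card A \<le> card {..<g ^ N}" by (intro card_mono) (auto simp: A_def G_set_def)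
        then show ?thesis by simp
      qed
      have "n1 \<le> card A" "n2 \<le> card A" unfolding n1_def n2_def using fin by (auto intro!: card_mono)
      then have "real n1 \<le> real (g ^ N)" "real n2 \<le> real (g ^ N)" using cardA by (simp_all only: of_nat_le_iff)
      then have nb: "real n1 \<le> real g ^ N" "real n2 \<le> real g ^ N" by simp_all
      have "d \<le> q" unfolding d_def using q by (intro dvd_imp_le) auto
      then have "real d / real q \<le> 1" using q by simp
      then have "real d / real q * real n2 \<le> 1 * real n2" by (intro mult_right_mono) auto
      moreover have "real d / real q * real n2 \<ge> 0" by simp
      ultimately have triv: "\<bar>real n1 - real d / real q * real n2\<bar> \<le> real g ^ N" using nb by linarith
      have "real N / ln (real q) \<le> real N / (2 / 3)" using lq by (intro divide_left_mono) auto
      moreover have "real N / (2 / 3) \<le> 45" using False by simp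
      ultimately have N45: "real N / ln (real q) \<le> 45" by (rule order.trans)
      have "c g \<le> 1 / (45 * real g ^ 5)" using m6(2) by (intro c_le) auto
      also have "\<dots> \<le> 1 / (45 * 1)" using g5 g by (intro divide_left_mono mult_left_mono) auto
      finally have "c g * (real N / ln (real q)) \<le> 1 / 45 * 45"
        using N45 cpos lq by (intro mult_mono) auto
      then have e1: "exp (- 1) \<le> exp (- (c g * (real N / ln (real q))))" by simp
      have e3: "exp (- 1 :: real) \<ge> 1 / 3" using exp_le by (simp add: exp_minus field_simps)
      have C3: "C g \<ge> 3"
      proof -
        have "(3::real) * 1 \<le> 2 ^ m * 2 ^ (5 * g)" using m6(2) two5 by (intro mult_mono) auto
        then show ?thesis by (simp add: C_def power_add)
      qed
      have "3 * (1 / 3) \<le> C g * exp (- (c g * (real N / ln (real q))))"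
        using C3 by (intro mult_mono[OF C3 order.trans[OF e3 e1]]) auto
      then have "real g ^ N * 1 \<le> real g ^ N * (C g * exp (- (c g * (real N / ln (real q)))))" by (intro mult_left_mono) auto
      then show ?thesis using triv unfolding d_def[symmetric] n1 n2 by (simp add: mult_ac)
    qed
  qed
  have "effectively_computable c" "effectively_computable C"
    unfolding c_def C_def by (rule effectively_computable_inverse_power effectively_computable_power)+
  moreover have "c g < 1" for g
  proof -
    have "(1::real) < 2 ^ m * 1" using m6(2) by simp
    also have "\<dots> \<le> 2 ^ m * 2 ^ (5 * g)" by (intro mult_left_mono) auto
    finally show ?thesis by (simp add: c_def power_add)
  qed
  moreover have "c g > 0" "C g > 0" for g by (auto simp: c_def C_def)
  ultimately show ?thesis
    using alpha_const_less_iff bound by (intro conjI exI[of _ c] exI[of _ C] allI impI) auto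
qed

end
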